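(* Let $(\pi,V)$ be an irreducible supercuspidal representation of $G$. (i) Suppose that $\pi$ is generic. Then $N_\pi\ge 2$ and $N_\pi>n_\pi$. (ii) If $\pi$ is not generic, then $\pi$ has no non-zero $K_n$-fixed vectors for all $n\ge0$.
   Context: $F$ is a non-archimedean local field of characteristic zero with ring of integers $\mathfrak{o}_F$, maximal ideal $\mathfrak{p}_F=\varpi\mathfrak{o}_F$ and finite residue field of odd characteristic. $E = F[\sqrt{\epsilon}]$ ($\epsilon \in \mathfrak{o}_F^\times \setminus (\mathfrak{o}_F^\times)^2$) is the unramified quadratic extension of $F$, with ring of integers $\mathfrak{o}_E$ and maximal ideal $\mathfrak{p}_E=\varpi\mathfrak{o}_E$; $\overline{\phantom{x}}$ is the non-trivial element of $\mathrm{Gal}(E/F)$. $G = \{g \in \mathrm{GL}_3(E) : {}^t\overline{g}Jg = J\}$ with $J=\begin{pmatrix}0&0&1\\0&1&0\\1&0&0\end{pmatrix}$. For $n\ge 0$, $$K_n=\begin{pmatrix}\mathfrak{o}_E&\mathfrak{o}_E&\mathfrak{p}_E^{-n}\\ \mathfrak{p}_E^n&1+\mathfrak{p}_E^n&\mathfrak{o}_E\\ \mathfrak{p}_E^n&\mathfrak{p}_E^n&\mathfrak{o}_E\end{pmatrix}\cap G$$ (with $\mathfrak{p}_E^0 = 1+\mathfrak{p}_E^0=\mathfrak{o}_E$). Representations are on complex vector spaces; irreducible representations are assumed admissible. $V(n)$ is the space of $K_n$-fixed vectors in $V$. $N_\pi=\min\{n\ge 0: V(n)\ne\{0\}\}$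 when some $V(n)\ne\{0\}$ (this holds for every irreducible generic representation). Let $E^1=\{\lambda\in E^\times:\lambda\overline{\lambda}=1\}$, $E^1_0=E^1$, $E^1_n=E^1\cap(1+\mathfrak{p}_E^n)$ for $n\ge1$. The center of $G$ is $\{\lambda I_3:\lambda\in E^1\}$; put $Z_n=\{\lambda I_3:\lambda\in E^1_n\}$. With $\omega_\pi$ the central character of $\pi$, $n_\pi=\min\{n\ge0:\omega_\pi|_{Z_n}=1\}$. Let $U$ be the group of all $u(x,y)=\begin{pmatrix}1&x&y\\0&1&-\overline{x}\\0&0&1\end{pmatrix}$ with $x,y\in E$, $y+\overline{y}+x\overline{x}=0$. Fix a non-trivial additive character $\psi_E$ of $E$ with conductor $\mathfrak{o}_E$ (i.e. $\mathfrak{o}_E$ is the largest fractional ideal on which $\psi_E$ is trivial), and put $\psi(u(x,y))=\psi_E(x)$. An irreducible admissible $\pi$ is generic if $\mathrm{Hom}_U(\pi,\psi)\ne\{0\}$. *)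

theory Defs
  imports
    "HOL-Analysis.Analysis"
    "HOL-Algebra.Group"
    "HOL-Computational_Algebra.Polynomial"
begin

section \<open>Local fields\<close>

text \<open>
  A non-archimedean local field is given by its normalized discrete valuation
  \<open>v : F\<^sup>\<times> \<rightarrow> \<int>\<close>; the value of \<open>v\<close> at \<open>0\<close> is never used.
  \<open>val_ideal v n\<close> is the \<open>n\<close>-th power of the maximal ideal and \<open>val_ideal v 0\<close> the ring of integers.
\<close>

definition val_ideal :: "('f::field \<Rightarrow> int) \<Rightarrow> int \<Rightarrow> 'f set" where
  "val_ideal v n = {x. x = 0 \<or> n \<le> v x}"

definition residue_rel :: "('f::field \<Rightarrow> int) \<Rightarrow> ('f \<times> 'f) set" where
  "residue_rel v = {(x, y). x \<in> val_ideal v 0 \<and> y \<in> val_ideal v 0 \<and> x - y \<in> val_ideal v 1}"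

definition residue_char :: "('f::field \<Rightarrow> int) \<Rightarrow> nat" where
  "residue_char v = (LEAST p. 0 < p \<and> of_nat p \<in> val_ideal v 1)"

locale local_field_odd =
  fixes v :: "'f::field_char_0 \<Rightarrow> int"
  assumes v_mult: "\<And>x y. x \<noteq> 0 \<Longrightarrow> y \<noteq> 0 \<Longrightarrow> v (x * y) = v x + v y"
    and v_add: "\<And>x y. x \<noteq> 0 \<Longrightarrow> y \<noteq> 0 \<Longrightarrow> x + y \<noteq> 0 \<Longrightarrow> min (v x) (v y) \<le> v (x + y)"
    and v_normalized: "\<exists>t. t \<noteq> 0 \<and> v t = 1"
    and v_complete: "\<And>X :: nat \<Rightarrow> 'f.
          (\<forall>m. \<exists>N. \<forall>i\<ge>N. \<forall>j\<ge>N. X i - X j \<in> val_ideal v m) \<Longrightarrow>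
          (\<exists>L. \<forall>m. \<exists>N. \<forall>i\<ge>N. X i - L \<in> val_ideal v m)"
    and finite_residue_field: "finite (val_ideal v 0 // residue_rel v)"
    and odd_residue_char: "odd (residue_char v)"

section \<open>The unramified quadratic extension and the unitary group\<close>

definition antidiag :: "'e::field ^ 3 ^ 3" where
  "antidiag = vector [vector [0, 0, 1], vector [0, 1, 0], vector [1, 0, 0]]"

text \<open>
  \<open>\<iota>\<close> is the inclusion of \<open>F\<close> in \<open>E = F[\<surd>\<epsilon>]\<close>, \<open>\<omega>\<close> a uniformizer of \<open>F\<close>,
  and \<open>\<sigma>\<close> the non-trivial element of the Galois group of \<open>E/F\<close>.
\<close>

locale unramified_quadratic = local_field_odd v
  for v :: "'f::field_char_0 \<Rightarrow> int" +
  fixes \<omega> :: 'f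
    and \<iota> :: "'f \<Rightarrow> 'e::field_char_0"
    and \<sigma> :: "'e \<Rightarrow> 'e"
  assumes uniformizer: "\<omega> \<noteq> 0" "v \<omega> = 1"
    and emb_one: "\<iota> 1 = 1"
    and emb_add: "\<And>a b. \<iota> (a + b) = \<iota> a + \<iota> b"
    and emb_mult: "\<And>a b. \<iota> (a * b) = \<iota> a * \<iota> b"
    and extension: "\<exists>\<epsilon> s. \<epsilon> \<noteq> 0 \<and> v \<epsilon> = 0 \<and> \<not> (\<exists>a. a \<noteq> 0 \<and> v a = 0 \<and> \<epsilon> = a\<^sup>2) \<and>
          s\<^sup>2 = \<iota> \<epsilon> \<and> (\<forall>z. \<exists>a b. z = \<iota> a + \<iota> b * s)"
    and conj_bij: "bij \<sigma>"
    and conj_add: "\<And>x y. \<sigma> (x + y) = \<sigma> x + \<sigma> y"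
    and conj_mult: "\<And>x y. \<sigma> (x * y) = \<sigma> x * \<sigma> y"
    and conj_fixes: "\<And>a. \<sigma> (\<iota> a) = \<iota> a"
    and conj_nontrivial: "\<exists>x. \<sigma> x \<noteq> x"
begin

text \<open>The ring of integers of \<open>E\<close> is the integral closure of that of \<open>F\<close>.\<close>

definition oE :: "'e set" where
  "oE = {x. \<exists>p. lead_coeff p = 1 \<and> (\<forall>i. coeff p i \<in> \<iota> ` val_ideal v 0) \<and> poly p x = 0}"

definition pE :: "int \<Rightarrow> 'e set" where
  "pE n = (\<lambda>x. \<iota> \<omega> powi n * x) ` oE"

definition E1 :: "nat \<Rightarrow> 'e set" where
  "E1 n = {x. x * \<sigma> x = 1 \<and> (n = 0 \<or> x - 1 \<in> pE (int n))}"

definition E_top :: "'e topology" where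
  "E_top = topology_generated_by {{y. y - x \<in> pE n} | x n. True}"

definition G :: "('e ^ 3 ^ 3) monoid" where
  "G = \<lparr>carrier = {g. invertible g \<and>
                 Finite_Cartesian_Product.transpose (map_matrix \<sigma> g) ** antidiag ** g = antidiag},
        mult = (**), one = mat 1\<rparr>"

text \<open>The generating sets are products of nine balls, so this is the topology induced from
  \<open>E\<^sup>9\<close>.\<close>

definition G_top :: "('e ^ 3 ^ 3) topology" where
  "G_top = subtopology
     (topology_generated_by {{B. \<forall>i j. B $ i $ j - A $ i $ j \<in> pE n} | A n. True}) (carrier G)"

text \<open>For \<open>n = 0\<close>, the coset \<open>1 + pE n\<close> of the middle entry is \<open>oE\<close>.\<close>

definition K :: "nat \<Rightarrow> ('e ^ 3 ^ 3) set" where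
  "K n = {g \<in> carrier G.
     g $ 1 $ 1 \<in> oE \<and>         g $ 1 $ 2 \<in> oE \<and>             g $ 1 $ 3 \<in> pE (- int n) \<and>
     g $ 2 $ 1 \<in> pE (int n) \<and> g $ 2 $ 2 - 1 \<in> pE (int n) \<and> g $ 2 $ 3 \<in> oE \<and>
     g $ 3 $ 1 \<in> pE (int n) \<and> g $ 3 $ 2 \<in> pE (int n) \<and>     g $ 3 $ 3 \<in> oE}"

definition u :: "'e \<Rightarrow> 'e \<Rightarrow> 'e ^ 3 ^ 3" where
  "u x y = vector [vector [1, x, y], vector [0, 1, - \<sigma> x], vector [0, 0, 1]]"

definition U :: "('e ^ 3 ^ 3) set" where
  "U = {u x y | x y. y + \<sigma> y + x * \<sigma> x = 0}"

section \<open>Representations\<close>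

text \<open>
  A representation is a scalar multiplication \<open>sc\<close> making the type \<open>'v\<close> a complex vector space,
  with an action \<open>\<pi>\<close> of which only the values on \<open>carrier G\<close> matter.
\<close>

definition representation ::
    "(complex \<Rightarrow> 'v::ab_group_add \<Rightarrow> 'v) \<Rightarrow> ('e ^ 3 ^ 3 \<Rightarrow> 'v \<Rightarrow> 'v) \<Rightarrow> bool" where
  "representation sc \<pi> \<longleftrightarrow>
     vector_space sc \<and>
     (\<forall>g\<in>carrier G. Vector_Spaces.linear sc sc (\<pi> g)) \<and>
     (\<forall>x. \<pi> (mat 1) x = x) \<and>
     (\<forall>g\<in>carrier G. \<forall>h\<in>carrier G. \<forall>x. \<pi> (g ** h) x = \<pi> g (\<pi> h x))"

definition fixed_vectors ::
    "('e ^ 3 ^ 3 \<Rightarrow> 'v \<Rightarrow> 'v) \<Rightarrow> ('e ^ 3 ^ 3) set \<Rightarrow> 'v::ab_group_add set" where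
  "fixed_vectors \<pi> H = {x. \<forall>k\<in>H. \<pi> k x = x}"

definition smooth :: "('e ^ 3 ^ 3 \<Rightarrow> 'v::ab_group_add \<Rightarrow> 'v) \<Rightarrow> bool" where
  "smooth \<pi> \<longleftrightarrow> (\<forall>x. openin G_top {g \<in> carrier G. \<pi> g x = x})"

definition admissible ::
    "(complex \<Rightarrow> 'v::ab_group_add \<Rightarrow> 'v) \<Rightarrow> ('e ^ 3 ^ 3 \<Rightarrow> 'v \<Rightarrow> 'v) \<Rightarrow> bool" where
  "admissible sc \<pi> \<longleftrightarrow> smooth \<pi> \<and>
     (\<forall>H. subgroup H G \<and> openin G_top H \<and> compactin G_top H \<longrightarrow>
        (\<exists>B. finite B \<and> fixed_vectors \<pi> H = module.span sc B))"

definition irreducible_admissible ::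
    "(complex \<Rightarrow> 'v::ab_group_add \<Rightarrow> 'v) \<Rightarrow> ('e ^ 3 ^ 3 \<Rightarrow> 'v \<Rightarrow> 'v) \<Rightarrow> bool" where
  "irreducible_admissible sc \<pi> \<longleftrightarrow>
     representation sc \<pi> \<and> admissible sc \<pi> \<and> (UNIV :: 'v set) \<noteq> {0} \<and>
     (\<forall>W. module.subspace sc W \<and> (\<forall>g\<in>carrier G. \<pi> g ` W \<subseteq> W) \<longrightarrow> W = {0} \<or> W = UNIV)"

text \<open>
  The unipotent radicals of the proper parabolic subgroups of \<open>G\<close> are the conjugates of \<open>U\<close>;
  the Jacquet module along each of them, the quotient of the whole space by the span below,
  has to vanish.
\<close>

definition supercuspidal ::
    "(complex \<Rightarrow> 'v::ab_group_add \<Rightarrow> 'v) \<Rightarrow> ('e ^ 3 ^ 3 \<Rightarrow> 'v \<Rightarrow> 'v) \<Rightarrow> bool" where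
  "supercuspidal sc \<pi> \<longleftrightarrow>
     (\<forall>g\<in>carrier G.
        module.span sc {\<pi> (g ** n ** matrix_inv g) x - x | n x. n \<in> U} = UNIV)"

definition fractional_ideal :: "'e set \<Rightarrow> bool" where
  "fractional_ideal I \<longleftrightarrow> 0 \<in> I \<and> (\<forall>x\<in>I. \<forall>y\<in>I. x + y \<in> I) \<and> (\<forall>a\<in>oE. \<forall>x\<in>I. a * x \<in> I) \<and>
     (\<exists>d. d \<noteq> 0 \<and> (\<forall>x\<in>I. d * x \<in> oE))"

definition character_of_conductor_oE :: "('e \<Rightarrow> complex) \<Rightarrow> bool" where
  "character_of_conductor_oE \<psi> \<longleftrightarrow>
     (\<forall>x y. \<psi> (x + y) = \<psi> x * \<psi> y) \<and> (\<forall>x. norm (\<psi> x) = 1) \<and>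
     continuous_map E_top euclidean \<psi> \<and> (\<exists>x. \<psi> x \<noteq> 1) \<and>
     (\<forall>x\<in>oE. \<psi> x = 1) \<and>
     (\<forall>I. fractional_ideal I \<and> (\<forall>x\<in>I. \<psi> x = 1) \<longrightarrow> I \<subseteq> oE)"

definition generic ::
    "('e \<Rightarrow> complex) \<Rightarrow> (complex \<Rightarrow> 'v::ab_group_add \<Rightarrow> 'v) \<Rightarrow> ('e ^ 3 ^ 3 \<Rightarrow> 'v \<Rightarrow> 'v) \<Rightarrow> bool" where
  "generic \<psi> sc \<pi> \<longleftrightarrow>
     (\<exists>l. Vector_Spaces.linear sc (*) l \<and> (\<exists>w. l w \<noteq> 0) \<and>
        (\<forall>x y w. y + \<sigma> y + x * \<sigma> x = 0 \<longrightarrow> l (\<pi> (u x y) w) = \<psi> x * l w))"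

text \<open>
  The least \<open>n\<close> below is meaningful only if some \<open>fixed_vectors \<pi> (K n)\<close> is non-zero, which holds
  for irreducible generic representations. The central character is only meaningful on \<open>E1 0\<close>,
  for irreducible admissible representations, by Schur's lemma.
\<close>

definition conductor :: "('e ^ 3 ^ 3 \<Rightarrow> 'v::ab_group_add \<Rightarrow> 'v) \<Rightarrow> nat" where
  "conductor \<pi> = (LEAST n. fixed_vectors \<pi> (K n) \<noteq> {0})"

definition central_char ::
    "(complex \<Rightarrow> 'v::ab_group_add \<Rightarrow> 'v) \<Rightarrow> ('e ^ 3 ^ 3 \<Rightarrow> 'v \<Rightarrow> 'v) \<Rightarrow> 'e \<Rightarrow> complex" where
  "central_char sc \<pi> z = (THE c. \<forall>x. \<pi> (mat z) x = sc c x)"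

definition central_conductor ::
    "(complex \<Rightarrow> 'v::ab_group_add \<Rightarrow> 'v) \<Rightarrow> ('e ^ 3 ^ 3 \<Rightarrow> 'v \<Rightarrow> 'v) \<Rightarrow> nat" where
  "central_conductor sc \<pi> = (LEAST n. \<forall>z\<in>E1 n. central_char sc \<pi> z = 1)"

end

end

theory Submission
  imports Defs
begin

text \<open>
  Let \<open>x\<close> be fixed by the subgroup \<open>L\<close> of \<open>K n\<close>, \<open>n \<ge> 1\<close>, whose upper right entries lie in \<open>pE (1 - n)\<close>.  The two
  affine reflections \<open>swap n\<close> and \<open>swap (n - 1)\<close> give Hecke operators on the \<open>L\<close>-fixed vectors, and each of them is
  injective by a quadratic relation; for \<open>swap (n - 1)\<close> and \<open>n \<ge> 2\<close> this needs that no non-zero vector is fixed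
  by the central elements from \<open>E1 (n - 1)\<close>, since otherwise a further double coset intervenes.  The
  \<open>k\<close>-th power of their product maps \<open>x\<close> to a translate of its average over a compact subgroup of \<open>U\<close> that grows
  with \<open>k\<close>, so \<open>x = 0\<close> as soon as \<open>x\<close> vanishes in the Jacquet module.  For a supercuspidal representation this shows
  that non-zero \<open>L\<close>-fixed vectors exist only if \<open>n \<ge> 2\<close> and the central character is trivial on \<open>E1 (n - 1)\<close>.

  The same argument in the corner \<open>SU(1,1)\<close> embeds the \<open>K n\<close>-fixed vectors into the coinvariants of the centre of
  \<open>U\<close>.  For a non-generic supercuspidal representation these coinvariants vanish, since all their twisted
  coinvariants under \<open>U\<close> do.  A generic representation has a vector \<open>x\<close> with Iwahori-type invariance on which a
  Whittaker functional does not vanish, and the sum of \<open>x\<close> over cosets in \<open>K n\<close> is non-zero for some large \<open>n\<close>.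
\<close>

section \<open>Valuations of the local field and its quadratic extension\<close>

text \<open>Both inequalities come from one exceptional double coset. For
  \<open>swap (n - 1)\<close> the quadratic relation on \<open>L\<close>-fixed vectors is disturbed
  by the elements \<open>low X Y\<close> with \<open>X\<close> of valuation exactly
  \<open>n - 1\<close> and \<open>Y\<close> in \<open>pE n\<close>. The isotropy relation allows
  them only for \<open>n \<ge> 2\<close>, and what they contribute is fixed by the central elements
  from \<open>E1 (n - 1)\<close>. So a non-zero fixed vector forces both \<open>n \<ge> 2\<close>
  and a non-zero vector fixed by these central elements, which irreducibility spreads to the whole
  space. In \<open>corner\<close> always \<open>X = 0\<close>, the disturbance disappears, and the
  non-generic case needs no condition on the level or the central character.

  \<open>K n\<close> itself would not do for this argument: it contains \<open>swap n\<close>, which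
  therefore acts trivially on its fixed vectors. The smaller group \<open>L\<close> no longer
  contains it and factors into an upper and a lower triangular part, on which the translation acts
  in opposite directions.

  That generic representations have fixed vectors at some level is needed because
  \<open>conductor\<close> is a least number, which carries no information if all levels
  vanish.\<close>

context local_field_odd begin

lemma v_one: "v 1 = 0"
  using v_mult[of 1 1] by simp

lemma v_minus_one: "v (- 1) = 0"
proof -
  have "v ((- 1) * (- 1)) = v (- 1) + v (- 1)" by (rule v_mult) auto
  then show ?thesis using v_one by simp
qed

lemma v_uminus: "v (- x) = v x"
proof (cases "x = 0")
  case False
  then show ?thesis using v_mult[of "- 1" x] v_minus_one by simp
qed simp

lemma v_power: "x \<noteq> 0 \<Longrightarrow> v (x ^ k) = int k * v x"
  by (induction k) (auto simp: v_one v_mult algebra_simps)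

lemma v_inverse: "x \<noteq> 0 \<Longrightarrow> v (inverse x) = - v x"
  using v_mult[of x "inverse x"] v_one by simp

lemma v_divide: "x \<noteq> 0 \<Longrightarrow> y \<noteq> 0 \<Longrightarrow> v (x / y) = v x - v y"
  by (simp add: divide_inverse v_mult v_inverse)

lemma ideal_zero: "0 \<in> val_ideal v n"
  by (simp add: val_ideal_def)

lemma ideal_uminus: "x \<in> val_ideal v n \<Longrightarrow> - x \<in> val_ideal v n"
  by (auto simp: val_ideal_def v_uminus)

lemma ideal_add: "x \<in> val_ideal v n \<Longrightarrow> y \<in> val_ideal v n \<Longrightarrow> x + y \<in> val_ideal v n"
  using v_add[of x y] by (cases "x = 0"; cases "y = 0"; cases "x + y = 0") (auto simp: val_ideal_def)

lemma ideal_diff: "x \<in> val_ideal v n \<Longrightarrow> y \<in> val_ideal v n \<Longrightarrow> x - y \<in> val_ideal v n"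
  using ideal_add[of x n "- y"] ideal_uminus[of y n] by simp

lemma ideal_mult: "x \<in> val_ideal v i \<Longrightarrow> y \<in> val_ideal v j \<Longrightarrow> x * y \<in> val_ideal v (i + j)"
  by (cases "x = 0"; cases "y = 0") (auto simp: val_ideal_def v_mult)

lemma ideal_mono: "x \<in> val_ideal v i \<Longrightarrow> j \<le> i \<Longrightarrow> x \<in> val_ideal v j"
  by (auto simp: val_ideal_def)

lemma ideal_divide:
  "x \<in> val_ideal v i \<Longrightarrow> y \<noteq> 0 \<Longrightarrow> x / y \<in> val_ideal v (i - v y)"
  by (cases "x = 0") (auto simp: val_ideal_def v_divide)

lemma ideal_Inter:
  assumes "\<And>n. x \<in> val_ideal v n"
  shows "x = 0"
  using assms[of "v x + 1"] by (auto simp: val_ideal_def)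

text \<open>Completeness with an explicit rate: by the ultrametric inequality a sum of later steps
  is no larger than the bound for the first of them, so the limit approximates \<open>Y m\<close> to
  that same order.\<close>

lemma telescoping_limit:
  assumes step: "\<And>m. Y (Suc m) - Y m \<in> val_ideal v (int m + k)"
  shows "\<exists>L. \<forall>m. L - Y m \<in> val_ideal v (int m + k)"
proof -
  have tail: "Y (m + n) - Y m \<in> val_ideal v (int m + k)" for m n
  proof (induction n)
    case (Suc n)
    have "(Y (Suc (m + n)) - Y (m + n)) + (Y (m + n) - Y m) \<in> val_ideal v (int m + k)"
      by (rule ideal_add[OF ideal_mono[OF step] Suc]) simp
    then show ?case by simp
  qed (simp add: ideal_zero)
  have "\<exists>L. \<forall>m::int. \<exists>N::nat. \<forall>i\<ge>N. Y i - L \<in> val_ideal v m"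
  proof (rule v_complete, rule allI)
    fix m :: int
    have *: "Y i - Y (nat (m - k)) \<in> val_ideal v m" if "i \<ge> nat (m - k)" for i
      using ideal_mono[OF tail[of "nat (m - k)" "i - nat (m - k)"], of m] that by simp
    show "\<exists>N::nat. \<forall>i\<ge>N. \<forall>j\<ge>N. Y i - Y j \<in> val_ideal v m"
    proof (intro exI[of _ "nat (m - k)"] allI impI)
      fix i j assume "i \<ge> nat (m - k)" "j \<ge> nat (m - k)"
      from ideal_diff[OF *[OF this(1)] *[OF this(2)]] show "Y i - Y j \<in> val_ideal v m" by simp
    qed
  qed
  then obtain L where L: "\<And>m::int. \<exists>N::nat. \<forall>i\<ge>N. Y i - L \<in> val_ideal v m" by blast
  have "L - Y m \<in> val_ideal v (int m + k)" for m
  proof -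
    obtain N :: nat where N: "\<And>i. i \<ge> N \<Longrightarrow> Y i - L \<in> val_ideal v (int m + k)"
      using L[of "int m + k"] by blast
    have "(Y (m + N) - Y m) - (Y (m + N) - L) \<in> val_ideal v (int m + k)"
      by (rule ideal_diff[OF tail N]) simp
    then show ?thesis by simp
  qed
  then show ?thesis by blast
qed

text \<open>If \<open>2\<close> were a non-unit, it would satisfy the predicate minimised by
  \<open>residue_char\<close>, leaving \<open>1\<close> as the only odd value; but \<open>1\<close>
  is a unit.\<close>

lemma v_two: "v 2 = 0"
proof (rule ccontr)
  assume nz: "v 2 \<noteq> 0"
  have "0 \<le> v 2" using v_add[of 1 1] v_one by simp
  then have two: "(2 :: 'f) \<in> val_ideal v 1" using nz by (auto simp: val_ideal_def)
  let ?P = "\<lambda>p::nat. 0 < p \<and> of_nat p \<in> val_ideal v 1"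
  have P2: "?P 2" using two by simp
  have "?P (residue_char v)" unfolding residue_char_def by (rule LeastI[of ?P, OF P2])
  moreover have "residue_char v \<le> 2" unfolding residue_char_def by (rule Least_le[of ?P, OF P2])
  moreover have "odd (residue_char v)" by (rule odd_residue_char)
  ultimately have "residue_char v = 1" "?P (residue_char v)"
    by (cases "residue_char v = 2"; fastforce)+
  then show False using v_one by (auto simp: val_ideal_def)
qed

text \<open>Newton's iteration for a square root of \<open>e\<close>; it converges because \<open>2\<close> is a unit.\<close>

lemma hensel_square_root:
  assumes "c \<noteq> 0" "v c = 0" "c\<^sup>2 - e \<in> val_ideal v 1" "e \<noteq> 0" "v e = 0"
  shows "\<exists>a. a \<noteq> 0 \<and> v a = 0 \<and> e = a\<^sup>2"
proof -
  define X where "X = rec_nat c (\<lambda>_ x. x - (x\<^sup>2 - e) / (2 * x))"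
  have X0: "X 0 = c" and XS: "X (Suc n) = X n - ((X n)\<^sup>2 - e) / (2 * X n)" for n
    by (simp_all add: X_def)
  have inv: "X n \<noteq> 0 \<and> v (X n) = 0 \<and> (X n)\<^sup>2 - e \<in> val_ideal v (int n + 1)" for n
  proof (induction n)
    case 0
    show ?case using assms X0 by simp
  next
    case (Suc n)
    let ?x = "X n" and ?h = "((X n)\<^sup>2 - e) / (2 * X n)"
    have v2x: "v (2 * ?x) = 0" "2 * ?x \<noteq> 0" using Suc v_two by (auto simp: v_mult)
    have h: "?h \<in> val_ideal v (int n + 1)"
      using ideal_divide[of "?x\<^sup>2 - e" "int n + 1" "2 * ?x"] Suc v2x by simp
    \<comment> \<open>The correction cancels the linear term exactly, so the new error is the square
      of the correction and gains at least one power.\<close>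
    have "(?x - ?h)\<^sup>2 - e = ?h\<^sup>2"
      using v2x(2) by (simp add: field_simps power2_eq_square)
    then have i1: "(X (Suc n))\<^sup>2 - e \<in> val_ideal v (int (Suc n) + 1)"
      unfolding XS using ideal_mono[OF ideal_mult[OF h h], of "int (Suc n) + 1"]
      by (simp add: power2_eq_square)
    then have i2: "(X (Suc n))\<^sup>2 - e \<in> val_ideal v 1" by (rule ideal_mono) simp
    have nz: "X (Suc n) \<noteq> 0"
    proof
      assume "X (Suc n) = 0"
      then have "- e \<in> val_ideal v 1" using i2 by simp
      then show False using assms(4,5) by (auto simp: val_ideal_def v_uminus)
    qed
    have "v ((X (Suc n))\<^sup>2) = 0"
    proof (rule ccontr)
      assume a: "v ((X (Suc n))\<^sup>2) \<noteq> 0"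
      have "((X (Suc n))\<^sup>2 - e) + e \<in> val_ideal v 0"
        using ideal_mono[OF i2, of 0] assms by (intro ideal_add) (auto simp: val_ideal_def)
      then have "(X (Suc n))\<^sup>2 \<in> val_ideal v 1" using nz a by (auto simp: val_ideal_def)
      from ideal_diff[OF this i2] have "e \<in> val_ideal v 1" by simp
      then show False using assms(4,5) by (auto simp: val_ideal_def)
    qed
    then have "v (X (Suc n)) = 0" using nz by (simp add: v_power)
    then show ?case using nz i1 by blast
  qed
  have step: "X (Suc n) - X n \<in> val_ideal v (int n + 1)" for n
  proof -
    have "v (2 * X n) = 0" "2 * X n \<noteq> 0" using inv[of n] v_two by (auto simp: v_mult)
    then have "((X n)\<^sup>2 - e) / (2 * X n) \<in> val_ideal v (int n + 1)"
      using ideal_divide[of "(X n)\<^sup>2 - e" "int n + 1" "2 * X n"] inv[of n] by simp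
    then show ?thesis unfolding XS using ideal_uminus by fastforce
  qed
  then obtain L where L: "\<And>m. L - X m \<in> val_ideal v (int m + 1)"
    using telescoping_limit[of X 1] by blast
  have xi: "X i \<in> val_ideal v 0" for i using inv[of i] by (auto simp: val_ideal_def)
  have Lint: "L \<in> val_ideal v 0"
    using ideal_add[OF ideal_mono[OF L[of 0], of 0] xi[of 0]] by simp
  have "L\<^sup>2 - e = 0"
  proof (rule ideal_Inter)
    fix n :: int
    define i where "i = nat n"
    have "(L - X i) * (X i + L) \<in> val_ideal v (int i + 1)"
      using ideal_mult[OF L ideal_add[OF xi Lint]] by simp
    moreover have "(X i)\<^sup>2 - e \<in> val_ideal v (int i + 1)" using inv by blast
    ultimately have "(L - X i) * (X i + L) + ((X i)\<^sup>2 - e) \<in> val_ideal v (int i + 1)" by (rule ideal_add)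
    then have "L\<^sup>2 - e \<in> val_ideal v (int i + 1)" by (simp add: algebra_simps power2_eq_square)
    then show "L\<^sup>2 - e \<in> val_ideal v n" by (rule ideal_mono) (simp add: i_def)
  qed
  then have "e = L\<^sup>2" by simp
  moreover have "L \<noteq> 0" using calculation assms(4) by auto
  moreover have "v L = 0" using v_power[of L 2] calculation assms(5) by simp
  ultimately show ?thesis by blast
qed

text \<open>The form is anisotropic modulo the maximal ideal: cancellation requires \<open>a\<close>
  and \<open>b\<close> of equal valuation, and then \<open>a / b\<close> is a square root of
  \<open>e\<close> modulo the maximal ideal, which Hensel's lemma lifts. That the odd exponent
  \<open>2 * k - 1\<close> suffices is what later makes norms have even valuation.\<close>

lemma nonsquare_form_ideal:
  assumes "e \<noteq> 0" "v e = 0" "\<not> (\<exists>a. a \<noteq> 0 \<and> v a = 0 \<and> e = a\<^sup>2)"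
    and "a\<^sup>2 - e * b\<^sup>2 \<in> val_ideal v (2 * k - 1)"
  shows "a \<in> val_ideal v k \<and> b \<in> val_ideal v k"
proof (rule ccontr)
  assume neg: "\<not> ?thesis"
  have sq: "x \<in> val_ideal v m" if "x\<^sup>2 \<in> val_ideal v (2 * m - 1)" for x m
    using that by (cases "x = 0") (auto simp: val_ideal_def v_power)
  have sqe: "x \<in> val_ideal v m" if "e * x\<^sup>2 \<in> val_ideal v (2 * m - 1)" for x m
    using that assms(1,2) by (cases "x = 0") (auto simp: val_ideal_def v_power v_mult)
  have nn: "a \<noteq> 0" "b \<noteq> 0" "v a = v b" "v b < k"
  proof -
    have A: "b \<notin> val_ideal v m" if "a \<notin> val_ideal v m" "m \<le> k" for m
    proof
      assume "b \<in> val_ideal v m"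
      then have "b\<^sup>2 \<in> val_ideal v (2 * m)" using ideal_mult[of b m b m] by (simp add: power2_eq_square)
      then have "e * b\<^sup>2 \<in> val_ideal v (2 * m - 1)"
        using assms(1,2) ideal_mult[of e 0 "b\<^sup>2" "2 * m"] by (auto simp: val_ideal_def)
      moreover have "a\<^sup>2 - e * b\<^sup>2 \<in> val_ideal v (2 * m - 1)"
        using assms(4) by (rule ideal_mono) (use that in simp)
      ultimately have "(a\<^sup>2 - e * b\<^sup>2) + e * b\<^sup>2 \<in> val_ideal v (2 * m - 1)" by (rule ideal_add[rotated])
      then show False using sq[of a m] that by simp
    qed
    have B: "a \<notin> val_ideal v m" if "b \<notin> val_ideal v m" "m \<le> k" for m
    proof
      assume "a \<in> val_ideal v m"
      then have "a\<^sup>2 \<in> val_ideal v (2 * m)" using ideal_mult[of a m a m] by (simp add: power2_eq_square)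
      then have "a\<^sup>2 \<in> val_ideal v (2 * m - 1)" by (rule ideal_mono) simp
      moreover have "a\<^sup>2 - e * b\<^sup>2 \<in> val_ideal v (2 * m - 1)"
        using assms(4) by (rule ideal_mono) (use that in simp)
      ultimately have "a\<^sup>2 - (a\<^sup>2 - e * b\<^sup>2) \<in> val_ideal v (2 * m - 1)" by (rule ideal_diff)
      then show False using sqe[of b m] that by simp
    qed
    have k: "a \<notin> val_ideal v k" "b \<notin> val_ideal v k" using A[OF _ order_refl] B[OF _ order_refl] neg by blast+
    then show nz: "a \<noteq> 0" "b \<noteq> 0" and "v b < k" by (auto simp: val_ideal_def)
    have "v a < k" using k by (auto simp: val_ideal_def)
    moreover have "a \<notin> val_ideal v (v a + 1)" "b \<notin> val_ideal v (v b + 1)"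
      using nz by (auto simp: val_ideal_def)
    ultimately have "b \<notin> val_ideal v (v a + 1)" "a \<notin> val_ideal v (v b + 1)"
      using A[of "v a + 1"] B[of "v b + 1"] \<open>v b < k\<close> by simp_all
    then show "v a = v b" by (auto simp: val_ideal_def)
  qed
  define c where "c = a / b"
  have c: "c \<noteq> 0" "v c = 0" using nn by (auto simp: c_def v_divide)
  have "(a\<^sup>2 - e * b\<^sup>2) / b\<^sup>2 \<in> val_ideal v (2 * k - 1 - v (b\<^sup>2))"
    using assms(4) nn by (intro ideal_divide) auto
  moreover have "(a\<^sup>2 - e * b\<^sup>2) / b\<^sup>2 = c\<^sup>2 - e" using nn by (simp add: c_def field_simps)
  moreover have "1 \<le> 2 * k - 1 - v (b\<^sup>2)" using nn by (simp add: v_power)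
  ultimately have "c\<^sup>2 - e \<in> val_ideal v 1" by (metis ideal_mono)
  from hensel_square_root[OF c this assms(1,2)] assms(3) show False by blast
qed

lemma residue_representatives:
  obtains C where "finite C" "\<And>x. x \<in> val_ideal v 0 \<Longrightarrow> \<exists>c\<in>C. x - c \<in> val_ideal v 1"
proof -
  define C where "C = (\<lambda>S. SOME c. c \<in> S) ` (val_ideal v 0 // residue_rel v)"
  have "finite C" using finite_residue_field by (simp add: C_def)
  moreover have "\<exists>c\<in>C. x - c \<in> val_ideal v 1" if x: "x \<in> val_ideal v 0" for x
  proof -
    let ?S = "residue_rel v `` {x}"
    have "x \<in> ?S" using x ideal_zero by (simp add: residue_rel_def)
    then have "(SOME c. c \<in> ?S) \<in> ?S" by (rule someI)
    moreover have "(SOME c. c \<in> ?S) \<in> C" unfolding C_def by (intro imageI quotientI x)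
    ultimately show ?thesis by (auto simp: residue_rel_def)
  qed
  ultimately show ?thesis using that by blast
qed

end

section \<open>Coordinates, norm and valuation on the quadratic extension\<close>

context unramified_quadratic begin

lemma emb_zero: "\<iota> 0 = 0"
  using emb_add[of 0 0] by simp

lemma emb_uminus: "\<iota> (- a) = - \<iota> a"
  using emb_add[of a "- a"] emb_zero by (simp add: eq_neg_iff_add_eq_0 add.commute)

lemma emb_diff: "\<iota> (a - b) = \<iota> a - \<iota> b"
  using emb_add[of a "- b"] emb_uminus by simp

lemma emb_eq_zero: "\<iota> a = 0 \<longleftrightarrow> a = 0"
proof
  assume "\<iota> a = 0"
  show "a = 0"
  proof (rule ccontr)
    assume "a \<noteq> 0"
    then have "\<iota> a * \<iota> (inverse a) = 1" by (simp flip: emb_mult add: emb_one)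
    then show False using \<open>\<iota> a = 0\<close> by simp
  qed
qed (simp add: emb_zero)

lemma emb_inj: "\<iota> a = \<iota> b \<longleftrightarrow> a = b"
  using emb_eq_zero[of "a - b"] by (simp add: emb_diff)

lemma emb_power: "\<iota> (a ^ k) = \<iota> a ^ k"
  by (induction k) (simp_all add: emb_one emb_mult)

lemma conj_zero: "\<sigma> 0 = 0"
  using conj_add[of 0 0] by simp

lemma conj_one: "\<sigma> 1 = 1"
  using conj_fixes[of 1] by (simp add: emb_one)

lemma conj_uminus: "\<sigma> (- x) = - \<sigma> x"
  using conj_add[of x "- x"] conj_zero by (simp add: eq_neg_iff_add_eq_0 add.commute)

lemma conj_diff: "\<sigma> (x - y) = \<sigma> x - \<sigma> y"
  using conj_add[of x "- y"] conj_uminus by simp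

lemma conj_eq_zero: "\<sigma> x = 0 \<longleftrightarrow> x = 0"
  using conj_bij conj_zero by (metis bij_def injD)

lemma conj_inverse: "\<sigma> (inverse x) = inverse (\<sigma> x)"
proof (cases "x = 0")
  case False
  then have "\<sigma> x * \<sigma> (inverse x) = 1" by (simp flip: conj_mult add: conj_one)
  then show ?thesis by (metis inverse_unique)
qed (simp add: conj_zero)

lemma conj_divide: "\<sigma> (x / y) = \<sigma> x / \<sigma> y"
  by (simp add: divide_inverse conj_mult conj_inverse)

lemma conj_power: "\<sigma> (x ^ k) = \<sigma> x ^ k"
  by (induction k) (simp_all add: conj_one conj_mult)

lemma conj_numeral: "\<sigma> (numeral k) = numeral k"
proof -
  have "\<sigma> (of_nat m) = of_nat m" for m
    by (induction m) (simp_all add: conj_zero conj_one conj_add)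
  from this[of "numeral k"] show ?thesis by simp
qed

text \<open>The locale asserts only that a suitable pair exists. One choice of
  \<open>\<epsilon>\<close> and, in \<open>rt\<close>, of its square root is fixed here so that all
  coordinates refer to the same basis.\<close>

definition nonsquare :: 'f where
  "nonsquare = (SOME \<epsilon>. \<epsilon> \<noteq> 0 \<and> v \<epsilon> = 0 \<and> \<not> (\<exists>a. a \<noteq> 0 \<and> v a = 0 \<and> \<epsilon> = a\<^sup>2) \<and>
      (\<exists>s. s\<^sup>2 = \<iota> \<epsilon> \<and> (\<forall>z. \<exists>a b. z = \<iota> a + \<iota> b * s)))"

definition rt :: 'e where
  "rt = (SOME s. s\<^sup>2 = \<iota> nonsquare \<and> (\<forall>z. \<exists>a b. z = \<iota> a + \<iota> b * s))"

lemma nonsquare: "nonsquare \<noteq> 0" "v nonsquare = 0"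
    "\<not> (\<exists>a. a \<noteq> 0 \<and> v a = 0 \<and> nonsquare = a\<^sup>2)"
  and rt: "rt\<^sup>2 = \<iota> nonsquare" "\<exists>a b. z = \<iota> a + \<iota> b * rt"
proof -
  let ?P = "\<lambda>\<epsilon>. \<epsilon> \<noteq> 0 \<and> v \<epsilon> = 0 \<and> \<not> (\<exists>a. a \<noteq> 0 \<and> v a = 0 \<and> \<epsilon> = a\<^sup>2) \<and>
      (\<exists>s. s\<^sup>2 = \<iota> \<epsilon> \<and> (\<forall>z. \<exists>a b. z = \<iota> a + \<iota> b * s))"
  have "\<exists>\<epsilon>. ?P \<epsilon>" using extension by blast
  then have *: "?P nonsquare" unfolding nonsquare_def by (rule someI_ex)
  then show "nonsquare \<noteq> 0" "v nonsquare = 0"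
    "\<not> (\<exists>a. a \<noteq> 0 \<and> v a = 0 \<and> nonsquare = a\<^sup>2)" by blast+
  have "\<exists>s. s\<^sup>2 = \<iota> nonsquare \<and> (\<forall>z. \<exists>a b. z = \<iota> a + \<iota> b * s)" using * by blast
  then have "rt\<^sup>2 = \<iota> nonsquare \<and> (\<forall>z. \<exists>a b. z = \<iota> a + \<iota> b * rt)"
    unfolding rt_def by (rule someI_ex)
  then show "rt\<^sup>2 = \<iota> nonsquare" "\<exists>a b. z = \<iota> a + \<iota> b * rt" by blast+
qed

lemma conj_rt: "\<sigma> rt = - rt"
proof -
  have "(\<sigma> rt)\<^sup>2 = rt\<^sup>2" using rt(1) by (metis conj_fixes conj_power)
  then have "\<sigma> rt = rt \<or> \<sigma> rt = - rt" by (simp add: power2_eq_iff)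
  moreover have "\<sigma> rt \<noteq> rt"
  proof
    assume *: "\<sigma> rt = rt"
    have "\<sigma> z = z" for z
    proof -
      obtain a b where "z = \<iota> a + \<iota> b * rt" using rt(2) by blast
      then show ?thesis by (simp add: conj_add conj_mult conj_fixes *)
    qed
    then show False using conj_nontrivial by blast
  qed
  ultimately show ?thesis by blast
qed

lemma conj_coords: "\<sigma> (\<iota> a + \<iota> b * rt) = \<iota> a + \<iota> (- b) * rt"
  by (simp add: conj_add conj_mult conj_fixes conj_rt emb_uminus)

lemma conj_conj: "\<sigma> (\<sigma> z) = z"
proof -
  obtain a b where "z = \<iota> a + \<iota> b * rt" using rt(2) by blast
  then show ?thesis by (simp only: conj_coords) simp
qed

lemma coords_norm:
  "(\<iota> a + \<iota> b * rt) * \<sigma> (\<iota> a + \<iota> b * rt) = \<iota> (a\<^sup>2 - nonsquare * b\<^sup>2)"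
proof -
  have "(\<iota> a + \<iota> b * rt) * \<sigma> (\<iota> a + \<iota> b * rt) = (\<iota> a)\<^sup>2 - rt\<^sup>2 * (\<iota> b)\<^sup>2"
    unfolding conj_coords by (simp add: emb_uminus algebra_simps power2_eq_square)
  then show ?thesis by (simp add: rt(1) emb_diff emb_mult emb_power)
qed

definition nm :: "'e \<Rightarrow> 'f" where
  "nm z = (THE c. \<iota> c = z * \<sigma> z)"

lemma emb_nm: "\<iota> (nm z) = z * \<sigma> z"
proof -
  obtain a b where "z = \<iota> a + \<iota> b * rt" using rt(2) by blast
  then have "\<iota> (a\<^sup>2 - nonsquare * b\<^sup>2) = z * \<sigma> z" using coords_norm by simp
  then have "\<exists>!c. \<iota> c = z * \<sigma> z" by (metis emb_inj)
  then show ?thesis unfolding nm_def by (rule theI')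
qed

lemma nm_coords: "nm (\<iota> a + \<iota> b * rt) = a\<^sup>2 - nonsquare * b\<^sup>2"
  using emb_nm coords_norm by (metis emb_inj)

lemma nm_mult: "nm (x * y) = nm x * nm y"
  by (simp add: emb_nm emb_mult conj_mult flip: emb_inj)

lemma nm_emb: "nm (\<iota> a) = a\<^sup>2"
  using nm_coords[of a 0] by (simp add: emb_zero)

lemma nm_conj: "nm (\<sigma> z) = nm z"
  by (simp add: emb_nm conj_conj flip: emb_inj)

lemma nm_eq_zero: "nm z = 0 \<longleftrightarrow> z = 0"
  using emb_nm[of z] emb_eq_zero[of "nm z"] conj_eq_zero by auto

text \<open>Since \<open>E/F\<close> is unramified, \<open>v \<circ> nm\<close> takes even values only.\<close>

definition valE :: "'e \<Rightarrow> int" where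
  "valE z = v (nm z) div 2"

text \<open>The coordinate form of \<open>pE k\<close>. It mediates between the integral closure
  (\<open>oE_eq\<close>) and the valuation (\<open>mem_integer_pow\<close>), and closure under
  addition is immediate in it.\<close>

definition integer_pow :: "int \<Rightarrow> 'e set" where
  "integer_pow k = {\<iota> a + \<iota> b * rt | a b. a \<in> val_ideal v k \<and> b \<in> val_ideal v k}"

text \<open>The two exponents differ on purpose: a norm in the ideal of exponent
  \<open>2 * k - 1\<close> forces both coordinates into the \<open>k\<close>-th ideal, hence the
  norm into that of exponent \<open>2 * k\<close>.\<close>

lemma integer_pow_iff_norm: "z \<in> integer_pow k \<longleftrightarrow> nm z \<in> val_ideal v (2 * k - 1)"
  and integer_pow_norm: "z \<in> integer_pow k \<Longrightarrow> nm z \<in> val_ideal v (2 * k)"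
proof -
  show *: "nm z \<in> val_ideal v (2 * k)" if h: "z \<in> integer_pow k"
  proof -
    obtain a b where z: "z = \<iota> a + \<iota> b * rt" "a \<in> val_ideal v k" "b \<in> val_ideal v k"
      using h by (auto simp: integer_pow_def)
    have "nonsquare \<in> val_ideal v 0" using nonsquare by (simp add: val_ideal_def)
    then have "nonsquare * (b * b) \<in> val_ideal v (0 + (k + k))" using z by (intro ideal_mult)
    moreover have "a * a \<in> val_ideal v (k + k)" using z by (intro ideal_mult)
    ultimately show ?thesis using ideal_diff[of "a * a" "k + k" "nonsquare * (b * b)"]
      by (simp add: z nm_coords power2_eq_square)
  qed
  show "z \<in> integer_pow k \<longleftrightarrow> nm z \<in> val_ideal v (2 * k - 1)"
  proof
    assume "z \<in> integer_pow k"
    from *[OF this] show "nm z \<in> val_ideal v (2 * k - 1)" by (rule ideal_mono) simp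
  next
    assume h: "nm z \<in> val_ideal v (2 * k - 1)"
    obtain a b where z: "z = \<iota> a + \<iota> b * rt" using rt(2) by blast
    have "a\<^sup>2 - nonsquare * b\<^sup>2 \<in> val_ideal v (2 * k - 1)" using h by (simp add: z nm_coords)
    from nonsquare_form_ideal[OF nonsquare this] have "a \<in> val_ideal v k \<and> b \<in> val_ideal v k" .
    then show "z \<in> integer_pow k" using z by (auto simp: integer_pow_def)
  qed
qed

lemma v_nm: "z \<noteq> 0 \<Longrightarrow> v (nm z) = 2 * valE z"
proof -
  assume nz: "z \<noteq> 0"
  \<comment> \<open>The largest \<open>k\<close> with \<open>2 * k - 1 \<le> v (nm z)\<close>; the
    improvement to \<open>2 * k\<close> then leaves only even values.\<close>
  define k where "k = (v (nm z) + 1) div 2"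
  have "z \<in> integer_pow k" unfolding integer_pow_iff_norm k_def by (auto simp: val_ideal_def)
  from integer_pow_norm[OF this] have "2 * k \<le> v (nm z)"
    using nz by (simp add: val_ideal_def nm_eq_zero)
  then show ?thesis by (simp add: k_def valE_def) presburger
qed

lemma mem_integer_pow: "z \<in> integer_pow k \<longleftrightarrow> z = 0 \<or> k \<le> valE z"
  using v_nm[of z] by (cases "z = 0") (auto simp: integer_pow_iff_norm val_ideal_def nm_eq_zero)

lemma valE_mult: "x \<noteq> 0 \<Longrightarrow> y \<noteq> 0 \<Longrightarrow> valE (x * y) = valE x + valE y"
  using v_nm[of "x * y"] v_nm[of x] v_nm[of y] v_mult[of "nm x" "nm y"]
  by (simp add: nm_mult nm_eq_zero)

lemma valE_emb: "a \<noteq> 0 \<Longrightarrow> valE (\<iota> a) = v a"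
  by (simp add: valE_def nm_emb v_power)

lemma valE_one: "valE 1 = 0"
  using valE_emb[of 1] by (simp add: emb_one v_one)

lemma valE_uminus: "valE (- x) = valE x"
  by (simp add: valE_def nm_def conj_uminus)

lemma valE_conj: "valE (\<sigma> x) = valE x"
  by (simp add: valE_def nm_conj)

lemma valE_inverse: "x \<noteq> 0 \<Longrightarrow> valE (inverse x) = - valE x"
  using valE_mult[of x "inverse x"] valE_one by simp

lemma valE_divide: "x \<noteq> 0 \<Longrightarrow> y \<noteq> 0 \<Longrightarrow> valE (x / y) = valE x - valE y"
  by (simp add: divide_inverse valE_mult valE_inverse)

lemma valE_power: "x \<noteq> 0 \<Longrightarrow> valE (x ^ k) = int k * valE x"
  by (induction k) (auto simp: valE_one valE_mult algebra_simps)

lemma valE_power_int: "x \<noteq> 0 \<Longrightarrow> valE (x powi k) = k * valE x"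
  by (cases "k \<ge> 0") (auto simp: power_int_def valE_power valE_inverse)

lemma integer_pow_add: "x \<in> integer_pow k \<Longrightarrow> y \<in> integer_pow k \<Longrightarrow> x + y \<in> integer_pow k"
proof -
  assume "x \<in> integer_pow k" "y \<in> integer_pow k"
  then obtain a b c d where "x = \<iota> a + \<iota> b * rt" "y = \<iota> c + \<iota> d * rt"
    "a \<in> val_ideal v k" "b \<in> val_ideal v k" "c \<in> val_ideal v k" "d \<in> val_ideal v k"
    by (auto simp: integer_pow_def)
  moreover from this have "x + y = \<iota> (a + c) + \<iota> (b + d) * rt"
    by (simp add: emb_add algebra_simps)
  ultimately show ?thesis unfolding integer_pow_def using ideal_add by blast
qed

lemma integer_pow_mult: "x \<in> integer_pow i \<Longrightarrow> y \<in> integer_pow j \<Longrightarrow> x * y \<in> integer_pow (i + j)"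
  by (cases "x = 0"; cases "y = 0") (auto simp: mem_integer_pow valE_mult)

text \<open>An element with integral coordinates is a root of its characteristic polynomial, built
  from trace and norm. Conversely, if \<open>valE z < 0\<close>, the leading term of a monic
  integral equation has strictly smaller valuation than all others and cannot cancel.\<close>

lemma oE_eq: "oE = integer_pow 0"
proof (intro equalityI subsetI)
  fix z assume "z \<in> integer_pow 0"
  then obtain a b where z: "z = \<iota> a + \<iota> b * rt" "a \<in> val_ideal v 0" "b \<in> val_ideal v 0"
    by (auto simp: integer_pow_def)
  have nz: "nm z \<in> val_ideal v 0" using integer_pow_norm[OF \<open>z \<in> integer_pow 0\<close>] by simp
  let ?p = "[:\<iota> (nm z), \<iota> (- (a + a)), \<iota> 1:]"
  have "coeff ?p i \<in> \<iota> ` val_ideal v 0" for i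
  proof -
    have "1 \<in> val_ideal v 0" "0 \<in> val_ideal v 0" "- (a + a) \<in> val_ideal v 0"
      using v_one ideal_zero ideal_uminus[OF ideal_add[OF z(2) z(2)]] by (simp_all add: val_ideal_def)
    then have "\<iota> 1 \<in> \<iota> ` val_ideal v 0" "\<iota> 0 \<in> \<iota> ` val_ideal v 0"
      "\<iota> (- (a + a)) \<in> \<iota> ` val_ideal v 0" "\<iota> (nm z) \<in> \<iota> ` val_ideal v 0"
      using nz by blast+
    then show ?thesis by (auto simp: coeff_pCons emb_zero split: nat.split)
  qed
  moreover have "poly ?p z = 0"
  proof -
    have "z + \<sigma> z = \<iota> (a + a)" unfolding z conj_coords emb_uminus emb_add by simp
    then have s: "\<sigma> z = \<iota> (a + a) - z" by (simp add: algebra_simps)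
    have "poly ?p z = \<iota> (nm z) - z * (\<iota> (a + a) - z)"
      by (simp add: emb_uminus emb_one algebra_simps)
    also have "\<dots> = 0" unfolding emb_nm s by simp
    finally show ?thesis .
  qed
  moreover have "lead_coeff ?p = 1" by (simp add: emb_one)
  ultimately show "z \<in> oE" unfolding oE_def by blast
next
  fix z assume "z \<in> oE"
  then obtain p where p: "lead_coeff p = 1" "\<And>i. coeff p i \<in> \<iota> ` val_ideal v 0" "poly p z = 0"
    unfolding oE_def by blast
  show "z \<in> integer_pow 0"
  proof (rule ccontr)
    assume nz: "z \<notin> integer_pow 0"
    then have z: "z \<noteq> 0" "valE z < 0" by (auto simp: mem_integer_pow)
    define n where "n = degree p"
    have n: "n > 0"
    proof (rule ccontr)
      assume "\<not> n > 0"
      then obtain c where "p = [:c:]" using degree_eq_zeroE[of p] n_def by auto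
      then show False using p(1,3) by simp
    qed
    have c: "coeff p i \<in> integer_pow 0" for i
    proof -
      obtain a where "coeff p i = \<iota> a" "a \<in> val_ideal v 0" using p(2) by blast
      then show ?thesis using valE_emb[of a]
        by (cases "a = 0") (auto simp: mem_integer_pow val_ideal_def emb_zero)
    qed
    have "(\<Sum>i\<le>n. coeff p i * z ^ i) = 0" using p(3) by (simp add: poly_altdef n_def)
    moreover have "{..n} = insert n {..<n}" by auto
    ultimately have "z ^ n + (\<Sum>i<n. coeff p i * z ^ i) = 0"
      using p(1) by (simp add: n_def)
    then have e: "z ^ n = - (\<Sum>i<n. coeff p i * z ^ i)" by (simp add: eq_neg_iff_add_eq_0)
    have "(\<Sum>i\<in>A. coeff p i * z ^ i) \<in> integer_pow (int (n - 1) * valE z)" if "A \<subseteq> {..<n}" "finite A" for A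
      using that(2,1)
    proof (induction A)
      case (insert i A)
      have "z ^ i \<in> integer_pow (int (n - 1) * valE z)"
        using insert.prems z by (auto simp: mem_integer_pow valE_power mult_right_mono_neg)
      then have "coeff p i * z ^ i \<in> integer_pow (int (n - 1) * valE z)"
        using integer_pow_mult[OF c[of i]] by fastforce
      then show ?case using insert by (auto intro: integer_pow_add)
    qed (simp add: mem_integer_pow)
    from this[of "{..<n}"] have "z ^ n \<in> integer_pow (int (n - 1) * valE z)"
      unfolding e by (auto simp: mem_integer_pow valE_uminus)
    then have "int (n - 1) * valE z \<le> int n * valE z"
      using z(1) by (metis mem_integer_pow power_not_zero valE_power)
    moreover obtain m where "n = Suc m" using n gr0_implies_Suc by blast
    ultimately show False using z by (simp add: algebra_simps)
  qed
qed

lemma emb_uniformizer: "\<iota> \<omega> \<noteq> 0" "valE (\<iota> \<omega>) = 1"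
  using uniformizer by (auto simp: emb_eq_zero valE_emb)

lemma valE_uniformizer_power: "valE (\<iota> \<omega> powi k) = k"
  using emb_uniformizer by (simp add: valE_power_int)

lemma pE_iff: "x \<in> pE n \<longleftrightarrow> x = 0 \<or> n \<le> valE x"
proof -
  let ?w = "\<iota> \<omega> powi n"
  have w: "?w \<noteq> 0" "valE ?w = n"
    using emb_uniformizer valE_uniformizer_power by auto
  show ?thesis
  proof
    assume "x \<in> pE n"
    then obtain y where y: "x = ?w * y" "y = 0 \<or> 0 \<le> valE y"
      unfolding pE_def oE_eq by (metis imageE mem_integer_pow)
    then show "x = 0 \<or> n \<le> valE x" using w by (cases "y = 0") (auto simp: valE_mult)
  next
    assume "x = 0 \<or> n \<le> valE x"
    then have "x / ?w \<in> oE" "x = ?w * (x / ?w)"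
      using w by (auto simp: oE_eq mem_integer_pow valE_divide)
    then show "x \<in> pE n" unfolding pE_def by (rule rev_image_eqI)
  qed
qed

lemma pE_eq_integer_pow: "pE n = integer_pow n"
  by (auto simp: pE_iff mem_integer_pow)

lemma oE_eq_pE: "oE = pE 0"
  by (simp add: pE_eq_integer_pow oE_eq)

lemma pE_zero [simp]: "0 \<in> pE n"
  by (simp add: pE_iff)

lemma pE_add: "x \<in> pE n \<Longrightarrow> y \<in> pE n \<Longrightarrow> x + y \<in> pE n"
  unfolding pE_eq_integer_pow by (rule integer_pow_add)

lemma pE_uminus: "x \<in> pE n \<Longrightarrow> - x \<in> pE n"
  by (auto simp: pE_iff valE_uminus)

lemma pE_uminus_iff [simp]: "- x \<in> pE n \<longleftrightarrow> x \<in> pE n"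
  by (auto simp: pE_iff valE_uminus)

lemma pE_diff: "x \<in> pE n \<Longrightarrow> y \<in> pE n \<Longrightarrow> x - y \<in> pE n"
  using pE_add[of x n "- y"] pE_uminus[of y n] by simp

lemma pE_mult: "x \<in> pE i \<Longrightarrow> y \<in> pE j \<Longrightarrow> k \<le> i + j \<Longrightarrow> x * y \<in> pE k"
  by (cases "x = 0"; cases "y = 0") (auto simp: pE_iff valE_mult)

lemma pE_mono: "x \<in> pE i \<Longrightarrow> j \<le> i \<Longrightarrow> x \<in> pE j"
  by (auto simp: pE_iff)

lemma pE_conj [simp]: "\<sigma> x \<in> pE n \<longleftrightarrow> x \<in> pE n"
  by (auto simp: pE_iff valE_conj conj_eq_zero)

lemma pE_one [simp]: "1 \<in> pE n \<longleftrightarrow> n \<le> 0"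
  by (simp add: pE_iff valE_one)

lemma valE_two: "valE 2 = 0"
  using valE_emb[of 2] v_two emb_add[of 1 1] by (simp add: emb_one)

lemma pE_divide: "x \<in> pE i \<Longrightarrow> y \<noteq> 0 \<Longrightarrow> k \<le> i - valE y \<Longrightarrow> x / y \<in> pE k"
  by (cases "x = 0") (auto simp: pE_iff valE_divide)

lemma pE_half: "x \<in> pE n \<Longrightarrow> x / 2 \<in> pE n"
  by (rule pE_divide) (auto simp: valE_two)

lemma valE_eqI: "x \<in> pE n \<Longrightarrow> x \<notin> pE (n + 1) \<Longrightarrow> x \<noteq> 0 \<and> valE x = n"
  by (auto simp: pE_iff)

lemma valE_one_plus: "x - 1 \<in> pE 1 \<Longrightarrow> x \<noteq> 0 \<and> valE x = 0"
proof -
  assume a: "x - 1 \<in> pE 1"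
  show ?thesis
  proof (rule valE_eqI)
    show "x \<in> pE 0" using pE_add[of "x - 1" 0 1] pE_mono[OF a, of 0] by simp
    show "x \<notin> pE (0 + 1)" using pE_diff[of x 1 "x - 1"] a by auto
  qed
qed

text \<open>Residue representatives for the two coordinates refine a cover by one power of the
  uniformizer at a time. Every finite orbit and finite coset space below rests on this
  finiteness.\<close>

lemma pE_cover:
  assumes "i \<le> j"
  shows "\<exists>C. finite C \<and> C \<subseteq> pE i \<and> (\<forall>z\<in>pE i. \<exists>c\<in>C. z - c \<in> pE j)"
  using assms
proof (induction j rule: int_ge_induct)
  case base
  show ?case by (intro exI[of _ "{0}"]) auto
next
  case (step j)
  then obtain C where C: "finite C" "C \<subseteq> pE i" "\<And>z. z \<in> pE i \<Longrightarrow> \<exists>c\<in>C. z - c \<in> pE j" by blast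
  obtain R where R: "finite R" "\<And>x. x \<in> val_ideal v 0 \<Longrightarrow> \<exists>c\<in>R. x - c \<in> val_ideal v 1"
    using residue_representatives by blast
  let ?w = "\<iota> \<omega> powi j"
  have w: "?w \<noteq> 0" "valE ?w = j" using emb_uniformizer valE_uniformizer_power by auto
  define B where "B = (\<lambda>(c, r, r'). c + ?w * (\<iota> r + \<iota> r' * rt)) ` (C \<times> R \<times> R)"
  have "finite B" using C(1) R(1) by (auto simp: B_def)
  moreover have cov: "\<exists>c\<in>B. z - c \<in> pE (j + 1)" if zi: "z \<in> pE i" for z
  proof -
    obtain c where c: "c \<in> C" "z - c \<in> pE j" using C(3)[OF zi] by blast
    have "(z - c) / ?w \<in> integer_pow 0" unfolding pE_eq_integer_pow[symmetric]
      using c w by (intro pE_divide) auto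
    then obtain a b where ab: "(z - c) / ?w = \<iota> a + \<iota> b * rt" "a \<in> val_ideal v 0" "b \<in> val_ideal v 0"
      by (auto simp: integer_pow_def)
    then obtain r r' where r: "r \<in> R" "r' \<in> R" "a - r \<in> val_ideal v 1" "b - r' \<in> val_ideal v 1"
      using R(2) by meson
    have "\<iota> (a - r) + \<iota> (b - r') * rt \<in> pE 1" unfolding pE_eq_integer_pow integer_pow_def using r by blast
    then have "?w * (\<iota> (a - r) + \<iota> (b - r') * rt) \<in> pE (j + 1)"
      using w by (intro pE_mult[of _ j _ 1]) (auto simp: pE_iff)
    moreover have "?w * (\<iota> (a - r) + \<iota> (b - r') * rt) = z - (c + ?w * (\<iota> r + \<iota> r' * rt))"
    proof -
      have "z - c = ?w * (\<iota> a + \<iota> b * rt)" using ab(1) w by (simp add: field_simps)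
      then show ?thesis by (simp add: emb_diff algebra_simps)
    qed
    moreover have "c + ?w * (\<iota> r + \<iota> r' * rt) \<in> B" using c r by (force simp: B_def)
    ultimately show ?thesis by metis
  qed
  moreover have "\<exists>c\<in>B \<inter> pE i. z - c \<in> pE (j + 1)" if z: "z \<in> pE i" for z
  proof -
    obtain c where c: "c \<in> B" "z - c \<in> pE (j + 1)" using cov z by blast
    then have "z - c \<in> pE i" using step.hyps by (auto intro: pE_mono)
    with z have "z - (z - c) \<in> pE i" by (rule pE_diff)
    then have "c \<in> pE i" by simp
    then show ?thesis using c by blast
  qed
  ultimately show ?case by (intro exI[of _ "B \<inter> pE i"]) auto
qed

definition transversal :: "int \<Rightarrow> int \<Rightarrow> 'e set \<Rightarrow> bool" where
  "transversal i j X \<longleftrightarrow> finite X \<and> X \<subseteq> pE i \<and> (\<forall>z\<in>pE i. \<exists>!x. x \<in> X \<and> z - x \<in> pE j)"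

lemma transversal_exists:
  assumes "i \<le> j"
  shows "\<exists>X. transversal i j X"
proof -
  obtain C where C: "finite C" "C \<subseteq> pE i" "\<And>z. z \<in> pE i \<Longrightarrow> \<exists>c\<in>C. z - c \<in> pE j"
    using pE_cover[OF assms] by blast
  have minus: "a - b \<in> pE j \<Longrightarrow> b - a \<in> pE j" for a b
    using pE_uminus_iff[of "a - b" j] by simp
  have trans: "a - b \<in> pE j \<Longrightarrow> b - c \<in> pE j \<Longrightarrow> a - c \<in> pE j" for a b c
    using pE_add[of "a - b" j "b - c"] by simp
  define r where "r z = (SOME c. c \<in> C \<and> z - c \<in> pE j)" for z
  have r: "r z \<in> C" "z - r z \<in> pE j" if "z \<in> pE i" for z
    using someI_ex[of "\<lambda>c. c \<in> C \<and> z - c \<in> pE j"] C(3)[OF that] unfolding r_def by blast+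
  have rc: "r a = r b" if "a - b \<in> pE j" for a b
  proof -
    have "(c \<in> C \<and> a - c \<in> pE j) = (c \<in> C \<and> b - c \<in> pE j)" for c
      using that trans minus by blast
    then show ?thesis by (simp add: r_def)
  qed
  show ?thesis
    unfolding transversal_def
  proof (intro exI[of _ "r ` pE i"] conjI ballI)
    show "finite (r ` pE i)" using C(1) r by (auto intro: finite_subset[of _ C])
    show "r ` pE i \<subseteq> pE i" using C(2) r by auto
    fix z assume z: "z \<in> pE i"
    show "\<exists>!x. x \<in> r ` pE i \<and> z - x \<in> pE j"
    proof (rule ex1I[of _ "r z"])
      show "r z \<in> r ` pE i \<and> z - r z \<in> pE j" using r z by blast
      fix x assume "x \<in> r ` pE i \<and> z - x \<in> pE j"
      then obtain y where y: "y \<in> pE i" "x = r y" "z - r y \<in> pE j" by blast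
      then have "y - z \<in> pE j" using r trans minus by blast
      then show "x = r z" using rc y by blast
    qed
  qed
qed

text \<open>Completeness passes from \<open>F\<close> to \<open>E\<close> coordinatewise: by
  anisotropy of the norm form, the coordinates of an element of \<open>pE j\<close> lie in the ideal
  of the same exponent.\<close>

lemma pE_complete:
  assumes "\<And>m. X (Suc m) - X m \<in> pE (int m + k)"
  obtains L where "\<And>m. L - X m \<in> pE (int m + k)"
proof -
  have "\<exists>a b. X m = \<iota> a + \<iota> b * rt" for m using rt(2) by blast
  then obtain A B where AB: "\<And>m. X m = \<iota> (A m) + \<iota> (B m) * rt" by metis
  have unique: "a \<in> val_ideal v j \<and> b \<in> val_ideal v j" if "\<iota> a + \<iota> b * rt \<in> pE j" for a b j
    by (rule nonsquare_form_ideal[OF nonsquare])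
       (use that in \<open>simp add: pE_eq_integer_pow integer_pow_iff_norm nm_coords\<close>)
  have "X (Suc m) - X m = \<iota> (A (Suc m) - A m) + \<iota> (B (Suc m) - B m) * rt" for m
    by (simp add: AB emb_diff algebra_simps)
  then have d: "A (Suc m) - A m \<in> val_ideal v (int m + k) \<and> B (Suc m) - B m \<in> val_ideal v (int m + k)" for m
    using assms[of m] unique by metis
  obtain a b where ab: "\<And>m. a - A m \<in> val_ideal v (int m + k)" "\<And>m. b - B m \<in> val_ideal v (int m + k)"
    using telescoping_limit[of A k] telescoping_limit[of B k] d by blast
  have "(\<iota> a + \<iota> b * rt) - X m = \<iota> (a - A m) + \<iota> (b - B m) * rt" for m
    by (simp add: AB emb_diff algebra_simps)
  then have "(\<iota> a + \<iota> b * rt) - X m \<in> pE (int m + k)" for m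
    using ab[of m] unfolding pE_eq_integer_pow integer_pow_def by auto
  then show ?thesis using that by blast
qed

end

section \<open>Averages over finite orbits\<close>

text \<open>Averaging a vector over its orbit, instead of integrating over a compact group, needs no
  measure and makes invariance statements immediate; only additivity requires an argument.\<close>

definition orbit :: "('v \<Rightarrow> 'v) set \<Rightarrow> 'v \<Rightarrow> 'v set" where
  "orbit M x = (\<lambda>f. f x) ` M"

definition average :: "(complex \<Rightarrow> 'v::ab_group_add \<Rightarrow> 'v) \<Rightarrow> ('v \<Rightarrow> 'v) set \<Rightarrow> 'v \<Rightarrow> 'v" where
  "average sc M x = sc (1 / of_nat (card (orbit M x))) (\<Sum>y\<in>orbit M x. y)"

text \<open>The group laws are stated through translations, which allows the unit to be an
  idempotent other than the identity map. This happens for \<open>twists\<close>, where the unit is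
  a projection onto a model of a quotient space.\<close>

locale linear_group = vector_space sc for sc :: "complex \<Rightarrow> 'v::ab_group_add \<Rightarrow> 'v" +
  fixes M :: "('v \<Rightarrow> 'v) set"
  assumes nonempty: "M \<noteq> {}"
    and linear_M: "f \<in> M \<Longrightarrow> Vector_Spaces.linear sc sc f"
    and comp_left: "f \<in> M \<Longrightarrow> (\<lambda>g. f \<circ> g) ` M = M"
    and comp_right: "f \<in> M \<Longrightarrow> (\<lambda>g. g \<circ> f) ` M = M"
begin

lemma orbit_image: "f \<in> M \<Longrightarrow> f ` orbit M x = orbit M x"
proof -
  assume "f \<in> M"
  have "f ` orbit M x = (\<lambda>g. g x) ` ((\<lambda>g. f \<circ> g) ` M)" by (simp add: orbit_def image_image)
  then show ?thesis using comp_left[OF \<open>f \<in> M\<close>] by (simp add: orbit_def)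
qed

lemma orbit_apply: "f \<in> M \<Longrightarrow> orbit M (f x) = orbit M x"
proof -
  assume "f \<in> M"
  have "orbit M (f x) = (\<lambda>g. g x) ` ((\<lambda>g. g \<circ> f) ` M)" by (simp add: orbit_def image_image)
  then show ?thesis using comp_right[OF \<open>f \<in> M\<close>] by (simp add: orbit_def)
qed

lemma orbit_transitive: "y \<in> orbit M x \<Longrightarrow> orbit M y = orbit M x"
  using orbit_apply by (auto simp: orbit_def[of M x])

lemma orbit_nonempty: "orbit M x \<noteq> {}"
  using nonempty by (simp add: orbit_def)

lemma card_orbit: "finite (orbit M x) \<Longrightarrow> (of_nat (card (orbit M x)) :: complex) \<noteq> 0"
  using orbit_nonempty by (simp add: card_eq_0_iff)

lemma average_apply: "f \<in> M \<Longrightarrow> average sc M (f x) = average sc M x"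
  by (simp add: average_def orbit_apply)

lemma apply_average:
  assumes "f \<in> M" "finite (orbit M x)"
  shows "f (average sc M x) = average sc M x"
proof -
  interpret f: Vector_Spaces.linear sc sc f using linear_M assms by blast
  have inj: "inj_on f (orbit M x)"
    using assms orbit_image by (metis eq_card_imp_inj_on)
  have "f (\<Sum>y\<in>orbit M x. y) = (\<Sum>y\<in>orbit M x. f y)" by (simp add: f.sum)
  also have "\<dots> = (\<Sum>y\<in>f ` orbit M x. y)" by (simp add: sum.reindex[OF inj])
  also have "\<dots> = (\<Sum>y\<in>orbit M x. y)" using assms orbit_image by simp
  finally show ?thesis by (simp add: average_def f.scale)
qed

lemma orbit_fixed:
  assumes "\<And>f. f \<in> M \<Longrightarrow> f x = x"
  shows "orbit M x = {x}"
proof -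
  have "orbit M x = (\<lambda>_. x) ` M" unfolding orbit_def by (rule image_cong) (use assms in auto)
  then show ?thesis using nonempty by (simp add: image_constant_conv)
qed

lemma average_fixed: "(\<And>f. f \<in> M \<Longrightarrow> f x = x) \<Longrightarrow> average sc M x = x"
  by (simp add: average_def orbit_fixed)

text \<open>An average over the orbit of a pair projects to the average of either component, because the
  fibres of the projection are permuted transitively and so have the same size.\<close>

lemma average_pair:
  fixes p :: "'b \<Rightarrow> 'v" and act :: "('v \<Rightarrow> 'v) \<Rightarrow> 'b"
  assumes fin: "finite (act ` M)"
    and p: "\<And>f. f \<in> M \<Longrightarrow> p (act f) = f x"
    and act: "\<And>f g h. f \<in> M \<Longrightarrow> g \<in> M \<Longrightarrow> h \<in> M \<Longrightarrow> act g = act h \<Longrightarrow> act (f \<circ> g) = act (f \<circ> h)"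
  shows "sc (1 / of_nat (card (act ` M))) (\<Sum>b\<in>act ` M. p b) = average sc M x"
proof -
  let ?O = "orbit M x" and ?F = "\<lambda>y. {b \<in> act ` M. p b = y}"
  have closed: "f \<circ> g \<in> M" if "f \<in> M" "g \<in> M" for f g using comp_left that by blast
  have img: "p ` act ` M = ?O" using p by (force simp: orbit_def image_image)
  have finO: "finite ?O" using fin img by (metis finite_imageI)
  have le: "card (?F y) \<le> card (?F z)" if "y \<in> ?O" "z \<in> ?O" for y z
  proof -
    from that(1) that(2) have "z \<in> orbit M y" using orbit_transitive by blast
    then obtain f where f: "f \<in> M" "z = f y" by (auto simp: orbit_def)
    have finj: "inj_on f ?O" using f finO orbit_image by (metis eq_card_imp_inj_on)
    \<comment> \<open>Translation by \<open>f\<close> acts on the points \<open>act g\<close>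
      themselves; the hypothesis on \<open>act\<close> makes this well defined, and it carries the
      fibre over \<open>y\<close> into the fibre over \<open>z\<close>.\<close>
    have "\<exists>F. \<forall>g\<in>M. F (act g) = act (f \<circ> g)"
    proof -
      have "\<forall>b. \<exists>c. \<forall>g\<in>M. b = act g \<longrightarrow> c = act (f \<circ> g)" using act[OF f(1)] by metis
      then show ?thesis by metis
    qed
    then obtain F where F: "\<And>g. g \<in> M \<Longrightarrow> F (act g) = act (f \<circ> g)" by blast
    have Fsurj: "F ` act ` M = act ` M"
    proof -
      have "F ` act ` M = act ` ((\<lambda>g. f \<circ> g) ` M)" using F by (simp add: image_image cong: image_cong)
      then show ?thesis using comp_left[OF f(1)] by simp
    qed
    then have Finj: "inj_on F (act ` M)" using fin by (metis eq_card_imp_inj_on)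
    have "F ` ?F y \<subseteq> ?F z"
    proof
      fix c assume "c \<in> F ` ?F y"
      then obtain g where g: "g \<in> M" "p (act g) = y" "c = F (act g)" by blast
      then have "p c = z" using F p closed f by (metis comp_apply)
      then show "c \<in> ?F z" using g F closed f by auto
    qed
    moreover have "inj_on F (?F y)" using Finj by (rule inj_on_subset) auto
    ultimately show ?thesis using fin by (intro card_inj_on_le[of F]) auto
  qed
  obtain y0 where y0: "y0 \<in> ?O" using orbit_nonempty by blast
  define k where "k = card (?F y0)"
  have k: "card (?F y) = k" if "y \<in> ?O" for y
    using le[OF that y0] le[OF y0 that] by (simp add: k_def)
  have "card (act ` M) = (\<Sum>y\<in>p ` act ` M. card (?F y))"
    using sum.group[OF fin finite_imageI[OF fin, of p] order_refl, of "\<lambda>_. 1::nat"]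
    by simp
  then have card: "card (act ` M) = card ?O * k" using k by (simp add: img)
  then have k0: "(of_nat k :: complex) \<noteq> 0" using fin nonempty
    by (metis card_eq_0_iff image_is_empty mult_0_right of_nat_eq_0_iff)
  have "(\<Sum>b\<in>act ` M. p b) = (\<Sum>y\<in>?O. \<Sum>b\<in>?F y. p b)"
    using sum.group[OF fin finite_imageI[OF fin, of p] order_refl, of p] by (simp add: img)
  also have "\<dots> = (\<Sum>y\<in>?O. sc (of_nat k) y)"
  proof (rule sum.cong)
    fix y assume "y \<in> ?O"
    have "(\<Sum>b\<in>?F y. p b) = (\<Sum>b\<in>?F y. y)" by (rule sum.cong) auto
    also have "\<dots> = sc (of_nat k) y" using k[OF \<open>y \<in> ?O\<close>] by (simp add: sum_constant_scale)
    finally show "(\<Sum>b\<in>?F y. p b) = sc (of_nat k) y" .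
  qed simp
  also have "\<dots> = sc (of_nat k) (\<Sum>y\<in>?O. y)" by (simp add: scale_sum_right)
  finally show ?thesis using k0 by (simp add: average_def card)
qed

text \<open>The orbits of \<open>x\<close>, \<open>y\<close> and \<open>x + y\<close> may have
  different sizes, so the three averages cannot be compared termwise. All three orbits are images of
  the orbit of the pair, over which addition is termwise.\<close>

lemma average_add:
  assumes "finite (orbit M x)" "finite (orbit M y)"
  shows "average sc M (x + y) = average sc M x + average sc M y"
    and "finite (orbit M (x + y))"
proof -
  define act where "act f = (f x, f y)" for f :: "'v \<Rightarrow> 'v"
  have fin: "finite (act ` M)"
    by (rule finite_subset[of _ "orbit M x \<times> orbit M y"]) (use assms in \<open>auto simp: act_def orbit_def\<close>)
  have lin: "f (x + y) = f x + f y" if "f \<in> M" for f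
    using linear_M[OF that] by (simp add: Vector_Spaces.linear_iff)
  have "orbit M (x + y) = (\<lambda>(a, b). a + b) ` act ` M"
    using lin by (auto simp: orbit_def act_def image_image)
  then show "finite (orbit M (x + y))" using fin by simp
  have comp: "act (f \<circ> g) = act (f \<circ> h)" if "act g = act h" for f g h
    using that by (simp add: act_def)
  have "average sc M (x + y) = sc (1 / of_nat (card (act ` M))) (\<Sum>b\<in>act ` M. fst b + snd b)"
    by (rule average_pair[OF fin _ comp, symmetric]) (simp_all add: act_def lin)
  also have "\<dots> = sc (1 / of_nat (card (act ` M))) (\<Sum>b\<in>act ` M. fst b)
      + sc (1 / of_nat (card (act ` M))) (\<Sum>b\<in>act ` M. snd b)"
    by (simp add: sum.distrib scale_right_distrib)
  also have "sc (1 / of_nat (card (act ` M))) (\<Sum>b\<in>act ` M. fst b) = average sc M x"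
    by (rule average_pair[OF fin _ comp]) (simp_all add: act_def)
  also have "sc (1 / of_nat (card (act ` M))) (\<Sum>b\<in>act ` M. snd b) = average sc M y"
    by (rule average_pair[OF fin _ comp]) (simp_all add: act_def)
  finally show "average sc M (x + y) = average sc M x + average sc M y" .
qed

lemma orbit_scale: "orbit M (sc c x) = sc c ` orbit M x"
  using linear_M by (auto simp: orbit_def image_image Vector_Spaces.linear_iff cong: image_cong)

lemma apply_zero: "f \<in> M \<Longrightarrow> f 0 = 0"
  using linear_M[of f] by (metis Vector_Spaces.linear_iff scale_zero_left)

lemma average_zero: "average sc M 0 = 0"
  by (rule average_fixed) (rule apply_zero)

lemma average_scale: "average sc M (sc c x) = sc c (average sc M x)"
proof (cases "c = 0")
  case True
  then show ?thesis by (simp add: average_zero)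
next
  case False
  then have inj: "inj_on (sc c) (orbit M x)" by (auto simp: inj_on_def)
  have "(\<Sum>y\<in>sc c ` orbit M x. y) = sc c (\<Sum>y\<in>orbit M x. y)"
    by (simp add: sum.reindex[OF inj] scale_sum_right)
  then show ?thesis by (simp add: average_def orbit_scale card_image[OF inj] mult.commute)
qed

lemma average_sum:
  assumes "finite I" "\<And>i. i \<in> I \<Longrightarrow> finite (orbit M (f i))"
  shows "average sc M (\<Sum>i\<in>I. f i) = (\<Sum>i\<in>I. average sc M (f i)) \<and> finite (orbit M (\<Sum>i\<in>I. f i))"
  using assms
proof (induction I)
  case empty
  have "orbit M 0 = {0}" by (rule orbit_fixed) (rule apply_zero)
  then show ?case by (simp add: average_zero)
next
  case (insert i I)
  then show ?case by (simp add: average_add)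
qed

lemma average_diff:
  assumes "finite (orbit M x)" "finite (orbit M y)"
  shows "average sc M (x - y) = average sc M x - average sc M y"
proof -
  have "finite (orbit M (sc (- 1) y))" unfolding orbit_scale using assms by (intro finite_imageI)
  from average_add(1)[OF assms(1) this] show ?thesis by (simp only: average_scale) simp
qed

lemma average_functional:
  assumes l: "Vector_Spaces.linear sc (*) l" and fin: "finite (orbit M x)"
    and "\<And>f. f \<in> M \<Longrightarrow> l (f x) = c"
  shows "l (average sc M x) = c"
proof -
  interpret l: Vector_Spaces.linear sc "(*)" l by (rule l)
  have "l (average sc M x) = 1 / of_nat (card (orbit M x)) * (\<Sum>y\<in>orbit M x. l y)"
    by (simp add: average_def l.scale l.sum)
  also have "(\<Sum>y\<in>orbit M x. l y) = (\<Sum>y\<in>orbit M x. c)"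
    by (rule sum.cong) (use assms(3) in \<open>auto simp: orbit_def\<close>)
  finally show ?thesis using card_orbit[OF fin] by simp
qed

text \<open>All vectors of the small orbit have the same average over the large group. This is how
  inner averages get absorbed by outer ones.\<close>

lemma average_average:
  assumes "linear_group sc M'" "M' \<subseteq> M" "finite (orbit M x)"
  shows "average sc M (average sc M' x) = average sc M x"
proof -
  interpret M': linear_group sc M' by fact
  have sub: "orbit M' x \<subseteq> orbit M x" using assms(2) by (auto simp: orbit_def)
  have fin': "finite (orbit M' x)" using sub assms(3) by (rule finite_subset)
  have "average sc M (\<Sum>y\<in>orbit M' x. y) = (\<Sum>y\<in>orbit M' x. average sc M y)"
  proof -
    have "finite (orbit M y)" if "y \<in> orbit M' x" for y
      using orbit_transitive sub assms(3) that by (metis subsetD)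
    then show ?thesis using average_sum[OF fin', of "\<lambda>y. y"] by simp
  qed
  also have "\<dots> = (\<Sum>y\<in>orbit M' x. average sc M x)"
    by (rule sum.cong) (use sub average_apply in \<open>auto simp: orbit_def\<close>)
  also have "\<dots> = sc (of_nat (card (orbit M' x))) (average sc M x)" by (simp add: sum_constant_scale)
  finally show ?thesis using M'.card_orbit[OF fin'] by (simp add: average_def[of sc M' x] average_scale)
qed

end

section \<open>The unitary group and its smooth representations\<close>

definition mat3 :: "'a::zero \<Rightarrow> 'a \<Rightarrow> 'a \<Rightarrow> 'a \<Rightarrow> 'a \<Rightarrow> 'a \<Rightarrow> 'a \<Rightarrow> 'a \<Rightarrow> 'a \<Rightarrow> 'a ^ 3 ^ 3" where
  "mat3 a b c d e f g h i = vector [vector [a, b, c], vector [d, e, f], vector [g, h, i]]"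

lemma mat3_nth [simp]:
  "mat3 a b c d e f g h i $ 1 $ 1 = a" "mat3 a b c d e f g h i $ 1 $ 2 = b"
  "mat3 a b c d e f g h i $ 1 $ 3 = c" "mat3 a b c d e f g h i $ 2 $ 1 = d"
  "mat3 a b c d e f g h i $ 2 $ 2 = e" "mat3 a b c d e f g h i $ 2 $ 3 = f"
  "mat3 a b c d e f g h i $ 3 $ 1 = g" "mat3 a b c d e f g h i $ 3 $ 2 = h"
  "mat3 a b c d e f g h i $ 3 $ 3 = i"
  by (simp_all add: mat3_def vector_3)

lemma mat3_eqI:
  assumes "A $ 1 $ 1 = B $ 1 $ 1" "A $ 1 $ 2 = B $ 1 $ 2" "A $ 1 $ 3 = B $ 1 $ 3"
    "A $ 2 $ 1 = B $ 2 $ 1" "A $ 2 $ 2 = B $ 2 $ 2" "A $ 2 $ 3 = B $ 2 $ 3"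
    "A $ 3 $ 1 = B $ 3 $ 1" "A $ 3 $ 2 = B $ 3 $ 2" "A $ 3 $ 3 = B $ 3 $ 3"
  shows "(A :: 'a ^ 3 ^ 3) = B"
  using assms by (simp add: vec_eq_iff forall_3)

lemma mat3_cases:
  fixes A :: "'a::zero ^ 3 ^ 3"
  obtains a b c d e f g h i where "A = mat3 a b c d e f g h i"
proof
  show "A = mat3 (A $ 1 $ 1) (A $ 1 $ 2) (A $ 1 $ 3) (A $ 2 $ 1) (A $ 2 $ 2) (A $ 2 $ 3)
      (A $ 3 $ 1) (A $ 3 $ 2) (A $ 3 $ 3)"
    by (rule mat3_eqI) simp_all
qed

lemma mat3_eq_iff [simp]:
  "mat3 a b c d e f g h i = mat3 a' b' c' d' e' f' g' h' i' \<longleftrightarrow>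
    a = a' \<and> b = b' \<and> c = c' \<and> d = d' \<and> e = e' \<and> f = f' \<and> g = g' \<and> h = h' \<and> i = i'"
  by (metis mat3_nth)

lemma matrix_mult_nth3:
  "((A :: 'a::semiring_1 ^ 3 ^ 3) ** B) $ i $ j
    = A $ i $ 1 * B $ 1 $ j + A $ i $ 2 * B $ 2 $ j + A $ i $ 3 * B $ 3 $ j"
  by (simp add: matrix_matrix_mult_def sum_3)

lemma mat3_mult:
  "mat3 a b c d e f g h i ** mat3 a' b' c' d' e' f' g' h' (i' :: 'a::semiring_1)
    = mat3 (a*a' + b*d' + c*g') (a*b' + b*e' + c*h') (a*c' + b*f' + c*i')
           (d*a' + e*d' + f*g') (d*b' + e*e' + f*h') (d*c' + e*f' + f*i')
           (g*a' + h*d' + i*g') (g*b' + h*e' + i*h') (g*c' + h*f' + i*i')"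
  by (rule mat3_eqI) (simp_all add: matrix_mult_nth3)

lemma mat1_eq: "(mat 1 :: 'a::{zero,one} ^ 3 ^ 3) = mat3 1 0 0 0 1 0 0 0 1"
  by (rule mat3_eqI) (simp_all add: mat_def)

context unramified_quadratic begin

text \<open>\<open>adj g = J \<^sup>t\<sigma>(g) J\<close> is the inverse of \<open>g\<close> exactly when \<open>g\<close> is unitary.\<close>

definition adj :: "'e ^ 3 ^ 3 \<Rightarrow> 'e ^ 3 ^ 3" where
  "adj g = mat3 (\<sigma> (g $ 3 $ 3)) (\<sigma> (g $ 2 $ 3)) (\<sigma> (g $ 1 $ 3))
                (\<sigma> (g $ 3 $ 2)) (\<sigma> (g $ 2 $ 2)) (\<sigma> (g $ 1 $ 2))
                (\<sigma> (g $ 3 $ 1)) (\<sigma> (g $ 2 $ 1)) (\<sigma> (g $ 1 $ 1))"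

lemma adj_mat3: "adj (mat3 a b c d e f g h i)
    = mat3 (\<sigma> i) (\<sigma> f) (\<sigma> c) (\<sigma> h) (\<sigma> e) (\<sigma> b) (\<sigma> g) (\<sigma> d) (\<sigma> a)"
  by (simp add: adj_def)

lemma adj_mult: "adj (g ** h) = adj h ** adj g"
  by (rule mat3_eqI) (simp_all add: adj_def matrix_mult_nth3 conj_add conj_mult algebra_simps)

lemma adj_adj: "adj (adj g) = g"
  by (rule mat3_eqI) (simp_all add: adj_def conj_conj)

lemma adj_one: "adj (mat 1) = mat 1"
  by (simp add: mat1_eq adj_mat3 conj_one conj_zero)

lemma mem_G: "g \<in> carrier G \<longleftrightarrow> adj g ** g = mat 1"
proof -
  have "Finite_Cartesian_Product.transpose (map_matrix \<sigma> g) ** antidiag ** g = antidiag \<longleftrightarrow> adj g ** g = mat 1"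
    by (cases g rule: mat3_cases)
       (auto simp: adj_def vec_eq_iff forall_3 matrix_mult_nth3 mat_def antidiag_def vector_3
         Finite_Cartesian_Product.transpose_def map_matrix_def)
  moreover have "adj g ** g = mat 1 \<Longrightarrow> invertible g"
    by (metis invertible_def matrix_left_right_inverse)
  ultimately show ?thesis by (auto simp: G_def)
qed

lemma adj_left: "g \<in> carrier G \<Longrightarrow> adj g ** g = mat 1"
  by (simp add: mem_G)

lemma adj_right: "g \<in> carrier G \<Longrightarrow> g ** adj g = mat 1"
  by (simp add: mem_G matrix_left_right_inverse)

lemma G_one: "mat 1 \<in> carrier G"
  by (simp add: mem_G adj_one)

lemma G_adj: "g \<in> carrier G \<Longrightarrow> adj g \<in> carrier G"
  by (simp add: mem_G adj_adj matrix_left_right_inverse)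

lemma G_mult: "g \<in> carrier G \<Longrightarrow> h \<in> carrier G \<Longrightarrow> g ** h \<in> carrier G"
proof -
  assume "g \<in> carrier G" "h \<in> carrier G"
  have "adj (g ** h) ** (g ** h) = adj h ** (adj g ** g) ** h"
    by (simp only: adj_mult matrix_mul_assoc)
  then show ?thesis using \<open>g \<in> carrier G\<close> \<open>h \<in> carrier G\<close> by (simp add: mem_G)
qed

lemma adj_cancel: "g \<in> carrier G \<Longrightarrow> adj g ** (g ** h) = h"
  by (simp add: matrix_mul_assoc adj_left)

lemma adj_cancel': "g \<in> carrier G \<Longrightarrow> g ** (adj g ** h) = h"
  by (simp add: matrix_mul_assoc adj_right)

lemma adj_eq_matrix_inv: "g \<in> carrier G \<Longrightarrow> matrix_inv g = adj g"
proof -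
  assume g: "g \<in> carrier G"
  then have "\<exists>h. g ** h = mat 1 \<and> h ** g = mat 1" using adj_left adj_right by blast
  then have "matrix_inv g ** g = mat 1" unfolding matrix_inv_def by (rule someI2_ex) simp
  then have "matrix_inv g ** g ** adj g = adj g" by simp
  then show ?thesis using adj_right[OF g] by (simp flip: matrix_mul_assoc)
qed

text \<open>Only boundedness is needed: it makes the orbits of smooth vectors finite.\<close>

definition compact_subgroup :: "('e ^ 3 ^ 3) set \<Rightarrow> bool" where
  "compact_subgroup S \<longleftrightarrow> S \<subseteq> carrier G \<and> mat 1 \<in> S \<and> (\<forall>g\<in>S. \<forall>h\<in>S. g ** h \<in> S) \<and>
     (\<forall>g\<in>S. adj g \<in> S) \<and> (\<exists>m. \<forall>g\<in>S. \<forall>i j. g $ i $ j \<in> pE (- m))"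

lemma compact_subgroupD:
  assumes "compact_subgroup S"
  shows "g \<in> S \<Longrightarrow> g \<in> carrier G" "mat 1 \<in> S" "g \<in> S \<Longrightarrow> h \<in> S \<Longrightarrow> g ** h \<in> S"
    "g \<in> S \<Longrightarrow> adj g \<in> S"
  using assms by (auto simp: compact_subgroup_def)

definition conjugate :: "'e ^ 3 ^ 3 \<Rightarrow> ('e ^ 3 ^ 3) set \<Rightarrow> ('e ^ 3 ^ 3) set" where
  "conjugate g S = (\<lambda>h. g ** h ** adj g) ` S"

lemma compact_subgroup_conjugate:
  assumes S: "compact_subgroup S" and g: "g \<in> carrier G" and sub: "conjugate g S \<subseteq> S'" "compact_subgroup S'"
  shows "compact_subgroup (conjugate g S)"
  unfolding compact_subgroup_def
proof (intro conjI)
  show "conjugate g S \<subseteq> carrier G" using sub compact_subgroupD by blast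
  show "mat 1 \<in> conjugate g S" unfolding conjugate_def using compact_subgroupD(2)[OF S] adj_right[OF g]
    by (intro image_eqI[of _ _ "mat 1"]) simp_all
  show "\<forall>h\<in>conjugate g S. \<forall>h'\<in>conjugate g S. h ** h' \<in> conjugate g S"
  proof (intro ballI)
    fix h h' assume "h \<in> conjugate g S" "h' \<in> conjugate g S"
    then obtain a b where ab: "a \<in> S" "b \<in> S" "h = g ** a ** adj g" "h' = g ** b ** adj g"
      by (auto simp: conjugate_def)
    have "h ** h' = g ** a ** (adj g ** g) ** b ** adj g" by (simp only: ab matrix_mul_assoc)
    then have "h ** h' = g ** (a ** b) ** adj g" using adj_left[OF g] by (simp add: matrix_mul_assoc)
    then show "h ** h' \<in> conjugate g S" using compact_subgroupD(3)[OF S] ab by (auto simp: conjugate_def)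
  qed
  show "\<forall>h\<in>conjugate g S. adj h \<in> conjugate g S"
    using compact_subgroupD(4)[OF S] by (auto simp: conjugate_def adj_mult adj_adj matrix_mul_assoc)
  obtain m where "\<forall>g\<in>S'. \<forall>i j. g $ i $ j \<in> pE (- m)" using sub(2) by (auto simp: compact_subgroup_def)
  then show "\<exists>m. \<forall>h\<in>conjugate g S. \<forall>i j. h $ i $ j \<in> pE (- m)" using sub(1) by blast
qed

text \<open>Every point of an ultrametric ball is a centre of it, and balls with a common centre are
  nested, so the generating family is already a basis.\<close>

lemma ball_in_open:
  assumes "openin (topology_generated_by {{B. \<forall>i j. B $ i $ j - A $ i $ j \<in> pE n} | A n. True}) T"
    and "A \<in> T"
  shows "\<exists>n. {B :: 'e ^ 3 ^ 3. \<forall>i j. B $ i $ j - A $ i $ j \<in> pE n} \<subseteq> T"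
proof -
  have "generate_topology_on {{B :: 'e ^ 3 ^ 3. \<forall>i j. B $ i $ j - A $ i $ j \<in> pE n} | A n. True} T"
    using assms(1) by (simp add: openin_topology_generated_by_iff)
  then show ?thesis using assms(2)
  proof (induction T arbitrary: A)
    case Empty
    then show ?case by simp
  next
    case (Int S T)
    then obtain m n where "{B. \<forall>i j. B $ i $ j - A $ i $ j \<in> pE m} \<subseteq> S"
      "{B. \<forall>i j. B $ i $ j - A $ i $ j \<in> pE n} \<subseteq> T" by blast
    moreover have "x \<in> pE (max m n) \<Longrightarrow> x \<in> pE m \<and> x \<in> pE n" for x by (auto intro: pE_mono)
    ultimately show ?case by (intro exI[of _ "max m n"]) blast
  next
    case (UN \<T>)
    then obtain T where "T \<in> \<T>" "A \<in> T" by blast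
    with UN.IH show ?case by blast
  next
    case (Basis S)
    then obtain C n where S: "S = {B. \<forall>i j. B $ i $ j - C $ i $ j \<in> pE n}" by blast
    have "B $ i $ j - C $ i $ j \<in> pE n"
      if "B $ i $ j - A $ i $ j \<in> pE n" "A $ i $ j - C $ i $ j \<in> pE n" for B :: "'e ^ 3 ^ 3" and i j
      using pE_add[OF that] by simp
    then show ?case using Basis S by (intro exI[of _ n]) blast
  qed
qed

end

section \<open>Smooth representations: finite orbits and averages over compact subgroups\<close>

locale smooth_representation = unramified_quadratic v \<omega> \<iota> \<sigma>
  for v :: "'f::field_char_0 \<Rightarrow> int" and \<omega> :: 'f and \<iota> :: "'f \<Rightarrow> 'e::field_char_0" and \<sigma> :: "'e \<Rightarrow> 'e" +
  fixes sc :: "complex \<Rightarrow> 'v::ab_group_add \<Rightarrow> 'v"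
    and \<pi> :: "'e ^ 3 ^ 3 \<Rightarrow> 'v \<Rightarrow> 'v"
  assumes rep: "representation sc \<pi>"
    and smooth: "smooth \<pi>"
begin

sublocale V: vector_space sc
  using rep by (simp add: representation_def)

lemma rep_linear: "g \<in> carrier G \<Longrightarrow> Vector_Spaces.linear sc sc (\<pi> g)"
  using rep by (simp add: representation_def)

lemma rep_one [simp]: "\<pi> (mat 1) x = x"
  using rep by (simp add: representation_def)

lemma rep_mult: "g \<in> carrier G \<Longrightarrow> h \<in> carrier G \<Longrightarrow> \<pi> (g ** h) x = \<pi> g (\<pi> h x)"
  using rep by (simp add: representation_def)

lemma supercuspidal_span:
  assumes "supercuspidal sc \<pi>"
  shows "V.span {\<pi> g w - w | g w. g \<in> U} = UNIV"
proof -
  have "matrix_inv (mat 1) = (mat 1 :: 'e ^ 3 ^ 3)" using adj_eq_matrix_inv[OF G_one] adj_one by simp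
  moreover have "V.span {\<pi> (mat 1 ** g ** matrix_inv (mat 1)) w - w | g w. g \<in> U} = UNIV"
    using assms G_one unfolding supercuspidal_def by blast
  ultimately show ?thesis by simp
qed

lemma rep_adj: "g \<in> carrier G \<Longrightarrow> \<pi> (adj g) (\<pi> g x) = x"
  using rep_mult[OF G_adj, of g g x] by (simp add: adj_left)

lemma rep_adj': "g \<in> carrier G \<Longrightarrow> \<pi> g (\<pi> (adj g) x) = x"
  using rep_mult[OF _ G_adj, of g g x] by (simp add: adj_right)

lemma rep_add: "g \<in> carrier G \<Longrightarrow> \<pi> g (x + y) = \<pi> g x + \<pi> g y"
  and rep_scale: "g \<in> carrier G \<Longrightarrow> \<pi> g (sc c x) = sc c (\<pi> g x)"
  using rep_linear[of g] by (simp_all add: Vector_Spaces.linear_iff)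

lemma rep_zero: "g \<in> carrier G \<Longrightarrow> \<pi> g 0 = 0"
  using rep_scale[of g 0 0] by simp

lemma rep_diff: "g \<in> carrier G \<Longrightarrow> \<pi> g (x - y) = \<pi> g x - \<pi> g y"
  using rep_add[of g "x - y" y] by simp

lemma rep_sum: "g \<in> carrier G \<Longrightarrow> \<pi> g (\<Sum>i\<in>I. f i) = (\<Sum>i\<in>I. \<pi> g (f i))"
  by (induction I rule: infinite_finite_induct) (simp_all add: rep_zero rep_add)

definition near_one :: "int \<Rightarrow> ('e ^ 3 ^ 3) set" where
  "near_one k = {g \<in> carrier G. \<forall>i j. g $ i $ j - mat 1 $ i $ j \<in> pE k}"

lemma smooth_near_one:
  obtains k where "k \<ge> m" "\<And>g. g \<in> near_one k \<Longrightarrow> \<pi> g x = x"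
proof -
  have "openin G_top {g \<in> carrier G. \<pi> g x = x}" using smooth by (simp add: smooth_def)
  from this[unfolded G_top_def openin_subtopology] obtain T
    where T: "openin (topology_generated_by {{B. \<forall>i j. B $ i $ j - A $ i $ j \<in> pE n} | A n. True}) T"
      "{g \<in> carrier G. \<pi> g x = x} = T \<inter> carrier G"
    by (elim exE conjE) (rule that)
  have memT: "g \<in> T \<longleftrightarrow> \<pi> g x = x" if "g \<in> carrier G" for g
    using T(2) that by blast
  have "mat 1 \<in> T" using memT[OF G_one] by simp
  from ball_in_open[OF T(1) this] obtain n
    where n: "{B :: 'e ^ 3 ^ 3. \<forall>i j. B $ i $ j - mat 1 $ i $ j \<in> pE n} \<subseteq> T" by blast
  show ?thesis
  proof (rule that[of "max m n"])
    fix g assume "g \<in> near_one (max m n)"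
    then have "g \<in> carrier G" "\<And>i j. g $ i $ j - mat 1 $ i $ j \<in> pE n"
      by (auto simp: near_one_def intro: pE_mono[where i = "max m n"])
    then show "\<pi> g x = x" using n memT by blast
  qed simp
qed

lemma finite_image_coarser:
  assumes "finite (F ` S)" "\<And>g h. g \<in> S \<Longrightarrow> h \<in> S \<Longrightarrow> F g = F h \<Longrightarrow> f g = f h"
  shows "finite (f ` S)"
proof -
  have "f ` S = (\<lambda>a. f (SOME g. g \<in> S \<and> F g = a)) ` (F ` S)"
  proof -
    have "f (SOME h. h \<in> S \<and> F h = F g) = f g" if "g \<in> S" for g
    proof (rule assms(2))
      show "(SOME h. h \<in> S \<and> F h = F g) \<in> S" "F (SOME h. h \<in> S \<and> F h = F g) = F g"
        using someI[of "\<lambda>h. h \<in> S \<and> F h = F g" g] that by auto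
    qed (rule that)
    then show ?thesis by (auto simp: image_image)
  qed
  then show ?thesis using assms(1) by simp
qed

lemma finite_congruence_classes:
  assumes S: "S \<subseteq> carrier G" "\<And>g i j. g \<in> S \<Longrightarrow> g $ i $ j \<in> pE (- m)"
    and f: "\<And>g h. g \<in> S \<Longrightarrow> h \<in> S \<Longrightarrow> adj h ** g \<in> near_one k \<Longrightarrow> f g = f h"
  shows "finite (f ` S)"
proof -
  \<comment> \<open>Congruence modulo \<open>pE (k + m)\<close> leaves room for the factor
    \<open>adj h\<close>, whose entries lie in \<open>pE (- m)\<close>; the maximum keeps the
    exponent from falling below \<open>- m\<close>, as \<open>pE_cover\<close> requires.\<close>
  define n where "n = max (k + m) (- m)"
  obtain C where C: "finite C" "\<And>z. z \<in> pE (- m) \<Longrightarrow> \<exists>c\<in>C. z - c \<in> pE n"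
    using pE_cover[of "- m" n] by (auto simp: n_def)
  define r where "r z = (SOME c. c \<in> C \<and> z - c \<in> pE n)" for z
  have r: "r z \<in> C" "z - r z \<in> pE n" if "z \<in> pE (- m)" for z
    using someI_ex[of "\<lambda>c. c \<in> C \<and> z - c \<in> pE n"] C(2)[OF that] unfolding r_def by blast+
  define F where "F g = (r (g$1$1), r (g$1$2), r (g$1$3), r (g$2$1), r (g$2$2), r (g$2$3),
      r (g$3$1), r (g$3$2), r (g$3$3))" for g :: "'e ^ 3 ^ 3"
  have fin: "finite (F ` S)"
    by (rule finite_subset[of _ "C \<times> C \<times> C \<times> C \<times> C \<times> C \<times> C \<times> C \<times> C"])
       (use S(2) r(1) C(1) in \<open>auto simp: F_def\<close>)
  have "f g = f h" if g: "g \<in> S" and h: "h \<in> S" and "F g = F h" for g h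
  proof (rule f[OF g h])
    have "r (g $ i $ j) = r (h $ i $ j)" for i j
      using \<open>F g = F h\<close> exhaust_3[of i] exhaust_3[of j] by (auto simp: F_def)
    then have d: "g $ i $ j - h $ i $ j \<in> pE n" for i j
      using pE_diff[OF r(2)[OF S(2)[OF g, of i j]] r(2)[OF S(2)[OF h, of i j]]] by simp
    have hG: "h \<in> carrier G" "g \<in> carrier G" using S(1) g h by auto
    have a: "adj h $ i $ j \<in> pE (- m)" for i j
      using exhaust_3[of i] exhaust_3[of j] S(2)[OF h] by (auto simp: adj_def)
    have "(adj h ** g) $ i $ j - mat 1 $ i $ j \<in> pE k" for i j
    proof -
      have "(adj h ** g) $ i $ j - mat 1 $ i $ j = (adj h ** g) $ i $ j - (adj h ** h) $ i $ j"
        using adj_left[OF hG(1)] by simp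
      also have "\<dots> = adj h $ i $ 1 * (g $ 1 $ j - h $ 1 $ j) + adj h $ i $ 2 * (g $ 2 $ j - h $ 2 $ j)
          + adj h $ i $ 3 * (g $ 3 $ j - h $ 3 $ j)"
        by (simp add: matrix_mult_nth3 algebra_simps)
      also have "\<dots> \<in> pE k"
        by (intro pE_add pE_mult[OF a d]) (auto simp: n_def)
      finally show ?thesis .
    qed
    then show "adj h ** g \<in> near_one k" using hG by (auto simp: near_one_def G_mult G_adj)
  qed
  then show ?thesis by (rule finite_image_coarser[OF fin])
qed

lemma finite_orbit:
  assumes "compact_subgroup S"
  shows "finite (orbit (\<pi> ` S) x)"
proof -
  obtain k where k: "k \<ge> 0" "\<And>g. g \<in> near_one k \<Longrightarrow> \<pi> g x = x" using smooth_near_one by metis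
  obtain m where m: "\<And>g i j. g \<in> S \<Longrightarrow> g $ i $ j \<in> pE (- m)"
    using assms unfolding compact_subgroup_def by blast
  note SG = compact_subgroupD(1)[OF assms]
  have "finite ((\<lambda>g. \<pi> g x) ` S)"
  proof (rule finite_congruence_classes[OF _ m])
    show "S \<subseteq> carrier G" using SG by blast
    fix g h assume "g \<in> S" "h \<in> S" "adj h ** g \<in> near_one k"
    then have "\<pi> (adj h ** g) x = x" using k by blast
    then have "\<pi> h (\<pi> (adj h ** g) x) = \<pi> h x" by simp
    then show "\<pi> g x = \<pi> h x"
      using SG \<open>g \<in> S\<close> \<open>h \<in> S\<close> by (simp add: G_adj G_mult adj_cancel' flip: rep_mult)
  qed
  then show ?thesis by (simp add: orbit_def image_image)
qed

lemma linear_group_rep: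
  assumes "compact_subgroup S"
  shows "linear_group sc (\<pi> ` S)"
proof (intro linear_group.intro linear_group_axioms.intro)
  note S = compact_subgroupD[OF assms]
  show "vector_space sc" by (rule V.vector_space_axioms)
  show "\<pi> ` S \<noteq> {}" using S(2) by blast
  show "f \<in> \<pi> ` S \<Longrightarrow> Vector_Spaces.linear sc sc f" for f using S(1) rep_linear by blast
  have comp: "\<pi> g \<circ> \<pi> h = \<pi> (g ** h)" if "g \<in> S" "h \<in> S" for g h
    using that S(1) by (auto simp: rep_mult)
  show "(\<lambda>g. f \<circ> g) ` \<pi> ` S = \<pi> ` S" if f: "f \<in> \<pi> ` S" for f
  proof -
    obtain h where h: "h \<in> S" "f = \<pi> h" using f by blast
    have "\<pi> g \<in> (\<lambda>g. f \<circ> g) ` \<pi> ` S" if "g \<in> S" for g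
    proof -
      have "\<pi> g = f \<circ> \<pi> (adj h ** g)" using h that S by (simp add: comp adj_cancel')
      then show ?thesis using h that S by blast
    qed
    moreover have "f \<circ> \<pi> g \<in> \<pi> ` S" if "g \<in> S" for g using h that S comp by auto
    ultimately show ?thesis by blast
  qed
  show "(\<lambda>g. g \<circ> f) ` \<pi> ` S = \<pi> ` S" if f: "f \<in> \<pi> ` S" for f
  proof -
    obtain h where h: "h \<in> S" "f = \<pi> h" using f by blast
    have "\<pi> g \<in> (\<lambda>g. g \<circ> f) ` \<pi> ` S" if "g \<in> S" for g
    proof -
      have "\<pi> g = \<pi> (g ** adj h) \<circ> f" using h that S
        by (simp add: comp adj_left flip: matrix_mul_assoc)
      then show ?thesis using h that S by blast
    qed
    moreover have "\<pi> g \<circ> f \<in> \<pi> ` S" if "g \<in> S" for g using h that S comp by auto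
    ultimately show ?thesis by blast
  qed
qed

definition avg :: "('e ^ 3 ^ 3) set \<Rightarrow> 'v \<Rightarrow> 'v" where
  "avg S x = average sc (\<pi> ` S) x"

lemma orbit_rep: "orbit (\<pi> ` S) x = (\<lambda>g. \<pi> g x) ` S"
  by (simp add: orbit_def image_image)

text \<open>An orbit average depends only on the set of translates. If part of a group fixes
  \<open>x\<close>, the average can be taken over a smaller subgroup that covers the
  quotient.\<close>

lemma avg_cong: "(\<lambda>g. \<pi> g x) ` S = (\<lambda>g. \<pi> g x) ` S' \<Longrightarrow> avg S x = avg S' x"
  by (simp add: avg_def average_def orbit_rep)

context
  fixes S assumes S: "compact_subgroup S"
begin

interpretation M: linear_group sc "\<pi> ` S"
  by (rule linear_group_rep[OF S])

lemma rep_avg: "g \<in> S \<Longrightarrow> \<pi> g (avg S x) = avg S x"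
  unfolding avg_def by (rule M.apply_average) (auto simp: finite_orbit[OF S])

lemma avg_rep: "g \<in> S \<Longrightarrow> avg S (\<pi> g x) = avg S x"
  unfolding avg_def by (rule M.average_apply) auto

lemma avg_fixed: "(\<And>g. g \<in> S \<Longrightarrow> \<pi> g x = x) \<Longrightarrow> avg S x = x"
  unfolding avg_def by (rule M.average_fixed) auto

lemma avg_zero: "avg S 0 = 0"
  unfolding avg_def by (rule M.average_zero)

lemma avg_add: "avg S (x + y) = avg S x + avg S y"
  unfolding avg_def by (rule M.average_add) (rule finite_orbit[OF S])+

lemma avg_diff: "avg S (x - y) = avg S x - avg S y"
  unfolding avg_def by (rule M.average_diff) (rule finite_orbit[OF S])+

lemma avg_scale: "avg S (sc c x) = sc c (avg S x)"
  unfolding avg_def by (rule M.average_scale)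

lemma avg_sum: "finite I \<Longrightarrow> avg S (\<Sum>i\<in>I. f i) = (\<Sum>i\<in>I. avg S (f i))"
  unfolding avg_def using M.average_sum finite_orbit[OF S] by blast

lemma avg_functional:
  assumes "Vector_Spaces.linear sc (*) l" "\<And>g. g \<in> S \<Longrightarrow> l (\<pi> g x) = c"
  shows "l (avg S x) = c"
  unfolding avg_def by (rule M.average_functional[OF assms(1) finite_orbit[OF S]]) (use assms(2) in auto)

lemma avg_avg:
  assumes "compact_subgroup S'" "S' \<subseteq> S"
  shows "avg S (avg S' x) = avg S x"
  unfolding avg_def
  by (rule M.average_average) (use assms linear_group_rep finite_orbit[OF S] in auto)

lemma card_orbit_nonzero: "(of_nat (card ((\<lambda>g. \<pi> g x) ` S)) :: complex) \<noteq> 0"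
  using M.card_orbit[OF finite_orbit[OF S]] by (simp add: orbit_rep)

end

lemma rep_avg_conjugate:
  assumes S: "S \<subseteq> carrier G" and g: "g \<in> carrier G"
  shows "\<pi> g (avg S x) = avg (conjugate g S) (\<pi> g x)"
proof -
  have "\<pi> (g ** h ** adj g) (\<pi> g x) = \<pi> g (\<pi> h x)" if "h \<in> S" for h
    using that S g by (simp add: rep_mult rep_adj G_mult G_adj subset_iff)
  then have "(\<lambda>h. \<pi> (g ** h ** adj g) (\<pi> g x)) ` S = (\<lambda>h. \<pi> g (\<pi> h x)) ` S"
    by (intro image_cong refl)
  then have o: "orbit (\<pi> ` conjugate g S) (\<pi> g x) = \<pi> g ` orbit (\<pi> ` S) x"
    unfolding orbit_rep conjugate_def by (simp only: image_image)
  have inj: "inj_on (\<pi> g) A" for A by (metis inj_onI rep_adj[OF g])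
  have "\<pi> g (avg S x) = sc (1 / of_nat (card (orbit (\<pi> ` S) x))) (\<Sum>y\<in>orbit (\<pi> ` S) x. \<pi> g y)"
    by (simp add: avg_def average_def rep_scale[OF g] rep_sum[OF g])
  also have "(\<Sum>y\<in>orbit (\<pi> ` S) x. \<pi> g y) = (\<Sum>y\<in>\<pi> g ` orbit (\<pi> ` S) x. y)"
    by (simp add: sum.reindex[OF inj])
  finally show ?thesis by (simp add: avg_def average_def o card_image[OF inj])
qed

definition fixed_by :: "('e ^ 3 ^ 3) set \<Rightarrow> 'v \<Rightarrow> bool" where
  "fixed_by S x \<longleftrightarrow> (\<forall>g\<in>S. \<pi> g x = x)"

text \<open>A quadratic relation in disguise: expand \<open>avg S \<circ> \<pi> s\<close> applied to \<open>avg S (\<pi> s w) = 0\<close>; every point of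
  the orbit other than \<open>\<pi> s w\<close> itself contributes zero.\<close>

lemma reflection_injective:
  assumes S: "compact_subgroup S" and s: "s \<in> carrier G" "s ** s = mat 1"
    and w: "fixed_by S w" and zero: "avg S (\<pi> s w) = 0"
    and other: "\<And>x. x \<in> S \<Longrightarrow> \<pi> x (\<pi> s w) \<noteq> \<pi> s w \<Longrightarrow> avg S (\<pi> s (\<pi> x (\<pi> s w))) = 0"
  shows "w = 0"
proof -
  let ?O = "(\<lambda>x. \<pi> x (\<pi> s w)) ` S"
  have fin: "finite ?O" using finite_orbit[OF S] by (simp add: orbit_rep)
  have "sc (1 / of_nat (card ?O)) (\<Sum>y\<in>?O. y) = 0"
    using zero by (simp add: avg_def average_def orbit_rep)
  then have "(\<Sum>y\<in>?O. y) = 0" using card_orbit_nonzero[OF S, of "\<pi> s w"] by simp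
  then have "avg S (\<pi> s (\<Sum>y\<in>?O. y)) = 0" using s(1) by (simp add: rep_zero avg_zero[OF S])
  then have "(\<Sum>y\<in>?O. avg S (\<pi> s y)) = 0" by (simp add: rep_sum[OF s(1)] avg_sum[OF S fin])
  moreover have "\<pi> s w \<in> ?O" using compact_subgroupD(2)[OF S] by (intro image_eqI[of _ _ "mat 1"]) simp_all
  moreover have "(\<Sum>y\<in>?O - {\<pi> s w}. avg S (\<pi> s y)) = 0"
    by (rule sum.neutral) (use other in auto)
  ultimately have "avg S (\<pi> s (\<pi> s w)) = 0" using fin by (simp add: sum.remove)
  moreover have "\<pi> s (\<pi> s w) = w" using s rep_mult[of s s w] by simp
  ultimately show "w = 0" using avg_fixed[OF S, of w] w by (simp add: fixed_by_def)
qed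

text \<open>Elements of \<open>B\<close> move past the powers of \<open>\<delta>\<close>, so on
  \<open>(\<pi> \<delta> ^^ k) x\<close> the groups \<open>L\<close> and \<open>A\<close> have the
  same orbit. Since \<open>\<delta>\<close> conjugates \<open>A\<close> into itself, the average
  over the conjugate is absorbed by the next one. The \<open>k\<close>-th power of the composite
  operator thus sends \<open>x\<close> to \<open>avg A ((\<pi> \<delta> ^^ k) x)\<close>, and
  injectivity of the two factors carries its vanishing back to \<open>x\<close>.\<close>

lemma chain_injective:
  assumes L: "compact_subgroup L" and A: "compact_subgroup A" "A \<subseteq> L"
    and s: "s0 \<in> carrier G" "s1 \<in> carrier G" "\<delta> = s0 ** s1"
    and inj0: "\<And>w. fixed_by L w \<Longrightarrow> avg L (\<pi> s0 w) = 0 \<Longrightarrow> w = 0"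
    and inj1: "\<And>w. fixed_by L w \<Longrightarrow> avg L (\<pi> s1 w) = 0 \<Longrightarrow> w = 0"
    and comp: "\<And>w. fixed_by L w \<Longrightarrow> avg L (\<pi> s0 (avg L (\<pi> s1 w))) = avg L (\<pi> \<delta> w)"
    and B: "B \<subseteq> L" "\<And>b. b \<in> B \<Longrightarrow> adj \<delta> ** b ** \<delta> \<in> B"
    and AB: "\<And>g. g \<in> L \<Longrightarrow> \<exists>a\<in>A. \<exists>b\<in>B. g = a ** b"
    and A_contract: "\<And>a. a \<in> A \<Longrightarrow> \<delta> ** a ** adj \<delta> \<in> A"
    and x: "fixed_by L x" and zero: "avg A ((\<pi> \<delta> ^^ k) x) = 0"
  shows "x = 0"
proof -
  have \<delta>: "\<delta> \<in> carrier G" using s by (simp add: G_mult)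
  define T where "T w = avg L (\<pi> s0 (avg L (\<pi> s1 w)))" for w
  have avgL: "fixed_by L (avg L w)" for w by (simp add: fixed_by_def rep_avg[OF L])
  have T_inj: "w = 0" if "fixed_by L w" "T w = 0" for w
    using inj0[of "avg L (\<pi> s1 w)"] inj1[of w] avgL that by (simp add: T_def)
  have LG: "g \<in> L \<Longrightarrow> g \<in> carrier G" and AG: "g \<in> A \<Longrightarrow> g \<in> carrier G" for g
    using compact_subgroupD(1) L A(1) by blast+
  have B_fix: "\<pi> b ((\<pi> \<delta> ^^ k) x) = (\<pi> \<delta> ^^ k) x" if "b \<in> B" for b k
    using that
  proof (induction k arbitrary: b)
    case 0
    then show ?case using x B(1) by (auto simp: fixed_by_def)
  next
    case (Suc k)
    let ?y = "(\<pi> \<delta> ^^ k) x"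
    have bG: "b \<in> carrier G" using Suc.prems B(1) LG by blast
    have "\<pi> b (\<pi> \<delta> ?y) = \<pi> (\<delta> ** (adj \<delta> ** b ** \<delta>)) ?y"
      using \<delta> bG by (simp add: rep_mult adj_cancel' flip: matrix_mul_assoc)
    also have "\<dots> = \<pi> \<delta> (\<pi> (adj \<delta> ** b ** \<delta>) ?y)"
      using \<delta> bG by (intro rep_mult) (auto simp: G_mult G_adj)
    also have "\<dots> = \<pi> \<delta> ?y" using Suc.IH[OF B(2)[OF Suc.prems]] by simp
    finally show ?case by simp
  qed
  have LA: "avg L ((\<pi> \<delta> ^^ k) x) = avg A ((\<pi> \<delta> ^^ k) x)" for k
  proof (rule avg_cong)
    have "\<pi> g ((\<pi> \<delta> ^^ k) x) \<in> (\<lambda>g. \<pi> g ((\<pi> \<delta> ^^ k) x)) ` A" if gL: "g \<in> L" for g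
    proof -
      obtain a b where ab: "a \<in> A" "b \<in> B" "g = a ** b" using AB[OF gL] by blast
      then have "\<pi> g ((\<pi> \<delta> ^^ k) x) = \<pi> a (\<pi> b ((\<pi> \<delta> ^^ k) x))"
        using AG LG B(1) by (auto intro!: rep_mult)
      then show ?thesis using ab B_fix by simp
    qed
    then show "(\<lambda>g. \<pi> g ((\<pi> \<delta> ^^ k) x)) ` L = (\<lambda>g. \<pi> g ((\<pi> \<delta> ^^ k) x)) ` A" using A(2) by blast
  qed
  have conj_sub: "conjugate \<delta> A \<subseteq> A" using A_contract by (auto simp: conjugate_def)
  have pow: "(T ^^ k) x = avg L ((\<pi> \<delta> ^^ k) x)" for k
  proof (induction k)
    case 0
    then show ?case using avg_fixed[OF L, of x] x by (simp add: fixed_by_def)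
  next
    case (Suc k)
    let ?y = "(\<pi> \<delta> ^^ k) x"
    have "(T ^^ Suc k) x = avg L (\<pi> s0 (avg L (\<pi> s1 (avg L ?y))))"
      by (simp add: Suc T_def)
    also have "\<dots> = avg L (\<pi> \<delta> (avg A ?y))" 
      by (simp only: comp[OF avgL]) (simp only: LA)
    also have "\<dots> = avg L (avg (conjugate \<delta> A) (\<pi> \<delta> ?y))"
      using rep_avg_conjugate[OF _ \<delta>, of A] AG by (simp add: subset_iff)
    also have "\<dots> = avg L (\<pi> \<delta> ?y)"
      by (rule avg_avg[OF L compact_subgroup_conjugate[OF A(1) \<delta> conj_sub A(1)]])
         (use conj_sub A(2) in blast)
    finally show ?case by simp
  qed
  have fixT: "fixed_by L ((T ^^ k) x)" for k using avgL by (simp add: pow)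
  have "(T ^^ k) x = 0 \<Longrightarrow> x = 0"
  proof (induction k)
    case (Suc k)
    then show ?case using T_inj[OF fixT] by simp
  qed simp
  then show ?thesis using zero by (simp add: pow LA)
qed

end

section \<open>Unipotent, reflection and torus elements, and the parahoric subgroups\<close>

context unramified_quadratic begin

abbreviation unif :: 'e where "unif \<equiv> \<iota> \<omega>"

lemma unif_power_nonzero [simp]: "unif powi k \<noteq> 0" "unif \<noteq> 0"
  using emb_uniformizer by auto

lemma unif_power_mem: "i \<le> k \<Longrightarrow> unif powi k \<in> pE i"
  by (simp add: pE_iff valE_uniformizer_power)

lemma conj_unif_power [simp]: "\<sigma> (unif powi k) = unif powi k" "\<sigma> unif = unif"
  by (simp_all add: power_int_def conj_power conj_inverse conj_fixes)

lemmas conj_simps = conj_add conj_mult conj_uminus conj_diff conj_zero conj_one conj_conj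
  conj_divide conj_inverse conj_eq_zero

text \<open>Isotropy of the vector \<open>(1, x, y)\<close> for the hermitian form with matrix
  \<open>antidiag\<close>.\<close>

definition isotropic :: "'e \<Rightarrow> 'e \<Rightarrow> bool" where
  "isotropic x y \<longleftrightarrow> y + \<sigma> y + x * \<sigma> x = 0"

definition low :: "'e \<Rightarrow> 'e \<Rightarrow> 'e ^ 3 ^ 3" where
  "low x y = mat3 1 0 0 x 1 0 y (- \<sigma> x) 1"

text \<open>Representatives of reflections in the affine Weyl group; \<open>k\<close> shifts the
  wall, and neighbouring ones compose to a translation (\<open>swap_product\<close>).\<close>

definition swap :: "int \<Rightarrow> 'e ^ 3 ^ 3" where
  "swap k = mat3 0 0 (unif powi (- k)) 0 1 0 (unif powi k) 0 0"

definition torus :: "'e \<Rightarrow> 'e \<Rightarrow> 'e ^ 3 ^ 3" where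
  "torus a m = mat3 a 0 0 0 m 0 0 0 (inverse (\<sigma> a))"

lemma u_eq: "u x y = mat3 1 x y 0 1 (- \<sigma> x) 0 0 1"
  by (simp add: u_def mat3_def)

lemma adj_u: "adj (u x y) = u (- x) (\<sigma> y)"
  by (simp add: u_eq adj_mat3 conj_simps)

lemma adj_low: "adj (low x y) = low (- x) (\<sigma> y)"
  by (simp add: low_def adj_mat3 conj_simps)

lemma u_mult: "u x y ** u x' y' = u (x + x') (y + y' - x * \<sigma> x')"
  by (simp add: u_eq mat3_mult conj_simps algebra_simps)

lemma u_mem: "u x y \<in> carrier G \<longleftrightarrow> isotropic x y"
  by (auto simp: mem_G u_eq adj_mat3 mat3_mult mat1_eq conj_simps isotropic_def algebra_simps)

lemma low_mem: "low x y \<in> carrier G \<longleftrightarrow> isotropic x y"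
  by (auto simp: mem_G low_def adj_mat3 mat3_mult mat1_eq conj_simps isotropic_def algebra_simps)

lemma swap_mem: "swap k \<in> carrier G"
  by (simp add: mem_G swap_def adj_mat3 mat3_mult mat1_eq conj_simps power_int_minus)

lemma swap_swap: "swap k ** swap k = mat 1"
  by (simp add: swap_def mat3_mult mat1_eq power_int_minus)

lemma torus_mem: "a \<noteq> 0 \<Longrightarrow> m * \<sigma> m = 1 \<Longrightarrow> torus a m \<in> carrier G"
  by (simp add: mem_G torus_def adj_mat3 mat3_mult mat1_eq conj_simps mult.commute)

lemma swap_conj:
  "swap m ** g ** swap m = mat3 (g$3$3) (unif powi (-m) * g$3$2) (unif powi (-2*m) * g$3$1)
     (unif powi m * g$2$3) (g$2$2) (unif powi (-m) * g$2$1)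
     (unif powi (2*m) * g$1$3) (unif powi m * g$1$2) (g$1$1)"
proof -
  have "unif powi (- 2 * m) = unif powi (- m) * unif powi (- m)"
    "unif powi (2 * m) = unif powi m * unif powi m"
    by (simp_all add: power_int_add[symmetric] power_int_minus)
       (simp flip: power_int_add power_int_minus)
  moreover have "unif powi m * unif powi (- m) = 1" by (simp add: power_int_minus)
  ultimately show ?thesis
    by (cases g rule: mat3_cases) (simp add: swap_def mat3_mult algebra_simps)
qed

lemma torus_commute_swap: "m * \<sigma> m = 1 \<Longrightarrow> torus 1 m ** swap k = swap k ** torus 1 m"
  by (simp add: torus_def swap_def mat3_mult conj_simps)

lemma isotropic_conj: "isotropic x y \<Longrightarrow> isotropic (- x) (\<sigma> y)"
  by (simp add: isotropic_def conj_simps algebra_simps)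

lemma isotropic_half: "isotropic x (- (x * \<sigma> x) / 2)"
  by (simp add: isotropic_def conj_simps conj_numeral field_simps)

lemma adj_nth:
  "adj g$1$1 = \<sigma> (g$3$3)" "adj g$1$2 = \<sigma> (g$2$3)" "adj g$1$3 = \<sigma> (g$1$3)"
  "adj g$2$1 = \<sigma> (g$3$2)" "adj g$2$2 = \<sigma> (g$2$2)" "adj g$2$3 = \<sigma> (g$1$2)"
  "adj g$3$1 = \<sigma> (g$3$1)" "adj g$3$2 = \<sigma> (g$2$1)" "adj g$3$3 = \<sigma> (g$1$1)"
  by (simp_all add: adj_def)

text \<open>Entries of \<open>adj g ** g = mat 1\<close>, read as hermitian products of the columns
  named.\<close>

lemma column3: "g \<in> carrier G \<Longrightarrow> \<sigma> (g$3$3) * g$1$3 + \<sigma> (g$2$3) * g$2$3 + \<sigma> (g$1$3) * g$3$3 = 0"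
  and column1: "g \<in> carrier G \<Longrightarrow> \<sigma> (g$3$1) * g$1$1 + \<sigma> (g$2$1) * g$2$1 + \<sigma> (g$1$1) * g$3$1 = 0"
  and column23: "g \<in> carrier G \<Longrightarrow> \<sigma> (g$3$3) * g$1$2 + \<sigma> (g$2$3) * g$2$2 + \<sigma> (g$1$3) * g$3$2 = 0"
  and column13: "g \<in> carrier G \<Longrightarrow> \<sigma> (g$1$1) * g$3$3 + \<sigma> (g$2$1) * g$2$3 + \<sigma> (g$3$1) * g$1$3 = 1"
  by (cases g rule: mat3_cases; simp add: mem_G adj_mat3 mat3_mult mat1_eq algebra_simps)+

text \<open>Interpolates between \<open>parahoric n 0\<close>, which has an Iwahori factorization, and \<open>parahoric n n = K n\<close>.\<close>

definition parahoric :: "nat \<Rightarrow> int \<Rightarrow> ('e ^ 3 ^ 3) set" where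
  "parahoric n j = {g \<in> carrier G.
     g$1$1 \<in> pE 0 \<and> g$1$2 \<in> pE 0 \<and> g$1$3 \<in> pE (- j) \<and>
     g$2$1 \<in> pE (int n) \<and> g$2$2 - 1 \<in> pE (int n) \<and> g$2$3 \<in> pE 0 \<and>
     g$3$1 \<in> pE (int n) \<and> g$3$2 \<in> pE (int n) \<and> g$3$3 \<in> pE 0}"

lemma K_eq: "n \<ge> 1 \<Longrightarrow> K n = parahoric n (int n)"
  by (simp add: K_def parahoric_def oE_eq_pE)

lemma parahoric_mono: "j \<le> j' \<Longrightarrow> parahoric n j \<subseteq> parahoric n j'"
  by (auto simp: parahoric_def intro: pE_mono)

lemma parahoric_1_subset_K_0: "parahoric 1 0 \<subseteq> K 0"
  by (auto simp: K_def parahoric_def oE_eq_pE intro: pE_mono)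

lemma parahoric_middle: "g \<in> parahoric n j \<Longrightarrow> g$2$2 \<in> pE 0"
  using pE_add[of "g$2$2 - 1" 0 1] pE_mono[of "g$2$2 - 1" "int n" 0] by (simp add: parahoric_def)

lemma parahoric_compact:
  assumes "n \<ge> 1" "0 \<le> j" "j \<le> int n"
  shows "compact_subgroup (parahoric n j)"
  unfolding compact_subgroup_def
proof (intro conjI ballI)
  show "parahoric n j \<subseteq> carrier G" by (auto simp: parahoric_def)
  show "mat 1 \<in> parahoric n j" using G_one by (simp add: parahoric_def mat1_eq)
  show "adj g \<in> parahoric n j" if "g \<in> parahoric n j" for g
    using that G_adj conj_diff[of "g$2$2" 1] pE_conj[of "g$2$2 - 1"]
    by (auto simp: parahoric_def adj_def conj_one)
  show "g ** h \<in> parahoric n j" if gh: "g \<in> parahoric n j" "h \<in> parahoric n j" for g h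
  proof -
    note g = gh(1)[unfolded parahoric_def mem_Collect_eq] and h = gh(2)[unfolded parahoric_def mem_Collect_eq]
    have g22: "g$2$2 \<in> pE 0" and h22: "h$2$2 \<in> pE 0" using gh parahoric_middle by blast+
    have m: "(g ** h)$2$2 - 1 = g$2$1 * h$1$2 + (g$2$2 - 1) * h$2$2 + (h$2$2 - 1) + g$2$3 * h$3$2"
      by (simp add: matrix_mult_nth3 algebra_simps)
    have P: "x * y \<in> pE 0" if "x \<in> pE 0" "y \<in> pE 0" for x y using that pE_mult by fastforce
    have N1: "x * y \<in> pE (int n)" if "x \<in> pE (int n)" "y \<in> pE 0" for x y using that pE_mult by fastforce
    have N2: "x * y \<in> pE (int n)" if "x \<in> pE 0" "y \<in> pE (int n)" for x y using that pE_mult by fastforce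
    have J1: "x * y \<in> pE (- j)" if "x \<in> pE (- j)" "y \<in> pE 0" for x y using that pE_mult by fastforce
    have J2: "x * y \<in> pE (- j)" if "x \<in> pE 0" "y \<in> pE (- j)" for x y using that pE_mult by fastforce
    \<comment> \<open>Here \<open>j \<le> n\<close> enters: denominators of an upper right entry are
      compensated by the entries below the diagonal.\<close>
    have M: "x * y \<in> pE 0" if "x \<in> pE (- j)" "y \<in> pE (int n)" for x y
      using that assms by (intro pE_mult[of x "- j" y "int n"]) auto
    have M': "y * x \<in> pE 0" if "x \<in> pE (- j)" "y \<in> pE (int n)" for x y
      using M[OF that] by (simp add: mult.commute)
    have I: "x \<in> pE 0" if "x \<in> pE (int n)" for x using that by (rule pE_mono) simp
    have J: "x \<in> pE (- j)" if "x \<in> pE 0" for x using that by (rule pE_mono) (use assms in simp)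
    have "(g ** h)$2$2 - 1 \<in> pE (int n)" unfolding m
      by (intro pE_add N1[of "g$2$1"] N1[of "g$2$2 - 1"] N2[of "g$2$3"]) (use g h h22 in blast)+
    moreover have "(g ** h)$1$1 \<in> pE 0" unfolding matrix_mult_nth3
      by (intro pE_add P[of "g$1$1"] P[of "g$1$2"] M[of "g$1$3"]) (use g h I in blast)+
    moreover have "(g ** h)$1$2 \<in> pE 0" unfolding matrix_mult_nth3
      by (intro pE_add P[of "g$1$1"] P[of "g$1$2"] M[of "g$1$3"]) (use g h h22 in blast)+
    moreover have "(g ** h)$1$3 \<in> pE (- j)" unfolding matrix_mult_nth3
      by (intro pE_add J2[of "g$1$1"] J[of "g$1$2 * h$2$3"] P[of "g$1$2"] J1[of "g$1$3"]) (use g h in blast)+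
    moreover have "(g ** h)$2$1 \<in> pE (int n)" unfolding matrix_mult_nth3
      by (intro pE_add N1[of "g$2$1"] N2[of "g$2$2"] N2[of "g$2$3"]) (use g h g22 in blast)+
    moreover have "(g ** h)$2$3 \<in> pE 0" unfolding matrix_mult_nth3
      by (intro pE_add M'[of "h$1$3" "g$2$1"] P[of "g$2$2"] P[of "g$2$3"]) (use g h g22 in blast)+
    moreover have "(g ** h)$3$1 \<in> pE (int n)" unfolding matrix_mult_nth3
      by (intro pE_add N1[of "g$3$1"] N2[of "g$3$2"] N2[of "g$3$3"]) (use g h I in blast)+
    moreover have "(g ** h)$3$2 \<in> pE (int n)" unfolding matrix_mult_nth3
      by (intro pE_add N1[of "g$3$1"] N1[of "g$3$2"] N2[of "g$3$3"]) (use g h h22 in blast)+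
    moreover have "(g ** h)$3$3 \<in> pE 0" unfolding matrix_mult_nth3
      by (intro pE_add M'[of "h$1$3" "g$3$1"] P[of "g$3$2"] P[of "g$3$3"]) (use g h I in blast)+
    ultimately show ?thesis using g h by (simp add: parahoric_def G_mult)
  qed
  have "g$i$k \<in> pE (- int n)" if g: "g \<in> parahoric n j" for g i k
  proof -
    have m: "x \<in> pE (- int n)" if "x \<in> pE 0 \<or> x \<in> pE (int n) \<or> x \<in> pE (- j)" for x
      using that assms by (auto simp: pE_iff)
    have "\<forall>i k. g$i$k \<in> pE (- int n)"
      using g parahoric_middle[OF g] unfolding forall_3 by (simp add: parahoric_def m)
    then show ?thesis by blast
  qed
  then show "\<exists>m. \<forall>g\<in>parahoric n j. \<forall>i k. g$i$k \<in> pE (- m)" by blast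
qed

definition corner :: "('e ^ 3 ^ 3) set" where
  "corner = {g \<in> carrier G. g$1$2 = 0 \<and> g$2$1 = 0 \<and> g$2$3 = 0 \<and> g$3$2 = 0 \<and> g$2$2 = 1}"

lemma compact_subgroup_corner:
  assumes "compact_subgroup S"
  shows "compact_subgroup (S \<inter> corner)"
proof -
  obtain m where "\<forall>g\<in>S. \<forall>i j. g$i$j \<in> pE (- m)" using assms by (auto simp: compact_subgroup_def)
  then have "\<exists>m. \<forall>g\<in>S \<inter> corner. \<forall>i j. g$i$j \<in> pE (- m)" by blast
  moreover have "mat 1 \<in> corner" using G_one by (simp add: corner_def mat1_eq)
  moreover have "adj g \<in> corner" if "g \<in> corner" for g
    using that by (simp add: corner_def G_adj adj_nth conj_zero conj_one)
  moreover have "g ** h \<in> corner" if "g \<in> corner" "h \<in> corner" for g h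
    using that by (simp add: corner_def G_mult matrix_mult_nth3)
  ultimately show ?thesis using compact_subgroupD[OF assms] unfolding compact_subgroup_def by blast
qed

definition upper :: "int \<Rightarrow> int \<Rightarrow> ('e ^ 3 ^ 3) set" where
  "upper i j = {u x y | x y. x \<in> pE i \<and> y \<in> pE j \<and> isotropic x y}"

text \<open>The term \<open>x * \<sigma> x'\<close> in the product of two elements lies in
  \<open>pE (2 * i)\<close>, whence the condition on \<open>j\<close>.\<close>

lemma upper_compact:
  assumes "j \<le> 2 * i"
  shows "compact_subgroup (upper i j)"
  unfolding compact_subgroup_def
proof (intro conjI ballI)
  show "upper i j \<subseteq> carrier G" by (auto simp: upper_def u_mem)
  show "mat 1 \<in> upper i j"
    unfolding upper_def by (intro CollectI exI[of _ 0]) (simp add: u_eq mat1_eq isotropic_def conj_zero)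
  show "adj g \<in> upper i j" if g: "g \<in> upper i j" for g
  proof -
    obtain x y where "g = u x y" "x \<in> pE i" "y \<in> pE j" "isotropic x y"
      using g by (auto simp: upper_def)
    then have "adj g = u (- x) (\<sigma> y)" "- x \<in> pE i" "\<sigma> y \<in> pE j" "isotropic (- x) (\<sigma> y)"
      by (simp_all add: adj_u isotropic_conj)
    then show ?thesis unfolding upper_def by blast
  qed
  show "g ** h \<in> upper i j" if gh: "g \<in> upper i j" "h \<in> upper i j" for g h
  proof -
    obtain x y x' y' where *: "g = u x y" "x \<in> pE i" "y \<in> pE j" "isotropic x y"
      "h = u x' y'" "x' \<in> pE i" "y' \<in> pE j" "isotropic x' y'"
      using gh by (auto simp: upper_def)
    have "g ** h = u (x + x') (y + y' - x * \<sigma> x')" by (simp add: * u_mult)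
    moreover have "g ** h \<in> carrier G" using * by (simp add: G_mult u_mem)
    moreover have "x + x' \<in> pE i" using * by (simp add: pE_add)
    moreover have "y + y' - x * \<sigma> x' \<in> pE j"
      using * assms by (intro pE_diff pE_add pE_mult[of _ i _ i]) auto
    ultimately show ?thesis by (auto simp: upper_def u_mem)
  qed
  have "g$k$l \<in> pE (- (\<bar>i\<bar> + \<bar>j\<bar>))" if "g \<in> upper i j" for g k l
    using that exhaust_3[of k] exhaust_3[of l]
    by (auto simp: upper_def u_eq intro: pE_mono[where i = i] pE_mono[where i = j])
  then show "\<exists>m. \<forall>g\<in>upper i j. \<forall>k l. g$k$l \<in> pE (- m)" by blast
qed

text \<open>For \<open>j < n\<close> the off-diagonal products in \<open>column13\<close> lie in
  \<open>pE 1\<close>, so the product of the outer diagonal entries is a unit. For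
  \<open>j = n\<close> this fails, as \<open>swap n\<close> shows.\<close>

lemma parahoric_units:
  assumes "g \<in> parahoric n j" "n \<ge> 1" "j < int n"
  shows "g$1$1 \<noteq> 0 \<and> valE (g$1$1) = 0" "g$3$3 \<noteq> 0 \<and> valE (g$3$3) = 0"
proof -
  note g = assms(1)[unfolded parahoric_def mem_Collect_eq]
  have "\<sigma> (g$1$1) * g$3$3 - 1 = - (\<sigma> (g$2$1) * g$2$3 + \<sigma> (g$3$1) * g$1$3)"
    using column13[of g] g by (simp add: algebra_simps)
  moreover have "\<sigma> (g$2$1) * g$2$3 + \<sigma> (g$3$1) * g$1$3 \<in> pE 1"
    by (intro pE_add pE_mult[of _ "int n" _ 0] pE_mult[of "\<sigma> (g$3$1)" "int n" _ "- j"]) (use g assms in auto)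
  ultimately have "\<sigma> (g$1$1) * g$3$3 - 1 \<in> pE 1" by (metis pE_uminus_iff)
  from valE_one_plus[OF this] have e: "g$1$1 \<noteq> 0" "g$3$3 \<noteq> 0" "valE (g$1$1) + valE (g$3$3) = 0"
    by (auto simp: conj_eq_zero valE_mult valE_conj)
  then show "g$1$1 \<noteq> 0 \<and> valE (g$1$1) = 0" "g$3$3 \<noteq> 0 \<and> valE (g$3$3) = 0"
    using g by (auto simp: pE_iff)
qed

text \<open>The last column of \<open>u x y\<close> is that of \<open>g\<close> divided by
  \<open>g$3$3\<close>, so the quotient has a last column proportional to the third basis vector.
  The hermitian product of the second and third columns then clears the entry \<open>(1, 2)\<close>
  as well.\<close>

lemma upper_lower_decomposition:
  assumes g: "g \<in> carrier G" "g$3$3 \<noteq> 0"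
  defines "x \<equiv> - \<sigma> (g$2$3 / g$3$3)" and "y \<equiv> g$1$3 / g$3$3"
  shows "isotropic x y"
    and "(adj (u x y) ** g)$1$2 = 0 \<and> (adj (u x y) ** g)$1$3 = 0 \<and> (adj (u x y) ** g)$2$3 = 0"
proof -
  have "y + \<sigma> y + x * \<sigma> x = (\<sigma> (g$3$3) * g$1$3 + \<sigma> (g$2$3) * g$2$3 + \<sigma> (g$1$3) * g$3$3) / (g$3$3 * \<sigma> (g$3$3))"
    using g(2) by (simp add: x_def y_def conj_simps field_simps)
  then show iso: "isotropic x y" using column3[OF g(1)] by (simp add: isotropic_def)
  let ?b = "adj (u x y) ** g"
  have b13: "?b$1$3 = (y + \<sigma> y + x * \<sigma> x) * g$3$3"
    unfolding adj_u unfolding u_eq matrix_mult_nth3 using g(2) by (simp add: x_def y_def conj_simps field_simps)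
  have b23: "?b$2$3 = 0"
    unfolding adj_u unfolding u_eq matrix_mult_nth3 using g(2) by (simp add: x_def conj_simps)
  have b33: "?b$3$3 = g$3$3" unfolding adj_u unfolding u_eq matrix_mult_nth3 by simp
  have b: "?b \<in> carrier G" using g iso by (simp add: G_mult G_adj u_mem)
  have b13': "?b$1$3 = 0" using b13 iso by (simp add: isotropic_def)
  have "\<sigma> (?b$3$3) * ?b$1$2 = 0" using column23[OF b] by (simp add: b13' b23 conj_zero)
  then show "?b$1$2 = 0 \<and> ?b$1$3 = 0 \<and> ?b$2$3 = 0" using b23 b13' g(2) b33 by (simp add: conj_eq_zero)
qed

end

section \<open>Vectors fixed by a parahoric subgroup and Jacquet modules\<close>

context unramified_quadratic begin

lemma unif_nat_power_mem [simp]: "i \<le> int k \<Longrightarrow> unif ^ k \<in> pE i"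
  using unif_power_mem[of i "int k"] by simp

lemma mat_eq: "(mat m :: 'e ^ 3 ^ 3) = mat3 m 0 0 0 m 0 0 0 m"
  by (rule mat3_eqI) (simp_all add: mat_def)

lemma mat_mem: "m * \<sigma> m = 1 \<Longrightarrow> (mat m :: 'e ^ 3 ^ 3) \<in> carrier G"
  by (simp add: mem_G mat_eq adj_mat3 mat3_mult conj_zero mult.commute mat1_eq)

lemma mat_central: "(mat m :: 'e ^ 3 ^ 3) ** (g :: 'e ^ 3 ^ 3) = g ** mat m"
  by (cases g rule: mat3_cases) (simp add: mat_eq mat3_mult mult.commute)

lemma adj_swap: "adj (swap k) = swap k"
  by (simp add: swap_def adj_mat3 conj_simps)

text \<open>The translation in the affine Weyl group: conjugation by it contracts \<open>U\<close>
  and expands the lower unipotent elements.\<close>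

definition delta :: "'e ^ 3 ^ 3" where
  "delta = torus unif 1"

lemma delta_eq: "delta = mat3 unif 0 0 0 1 0 0 0 (inverse unif)"
  by (simp add: delta_def torus_def)

lemma delta_mem: "delta \<in> carrier G"
  unfolding delta_def by (rule torus_mem) (simp_all add: conj_one)

lemma swap_product: "swap (k - 1) ** swap k = delta"
proof -
  have "unif powi (- (k - 1)) * unif powi k = unif" "unif powi (k - 1) * unif powi (- k) = inverse unif"
    by (simp_all flip: power_int_add add: power_int_minus[symmetric])
  then show ?thesis by (simp add: swap_def delta_eq mat3_mult)
qed

lemma delta_u_conj: "delta ** u x y ** adj delta = u (unif * x) (unif\<^sup>2 * y)"
  by (simp add: delta_eq u_eq adj_mat3 mat3_mult conj_simps power2_eq_square)

lemma adj_delta_conj: "adj delta ** g ** delta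
    = mat3 (g$1$1) (inverse unif * g$1$2) (inverse unif * inverse unif * g$1$3)
        (unif * g$2$1) (g$2$2) (inverse unif * g$2$3) (unif * unif * g$3$1) (unif * g$3$2) (g$3$3)"
  by (cases g rule: mat3_cases) (simp add: delta_eq adj_mat3 mat3_mult conj_simps field_simps)

lemma u_corner: "u 0 y \<in> corner \<longleftrightarrow> isotropic 0 y" "u x y \<in> corner \<Longrightarrow> x = 0"
  unfolding corner_def by (auto simp: u_mem) (auto simp: u_eq conj_zero)

lemma low_corner: "isotropic 0 y \<Longrightarrow> low 0 y \<in> corner"
  unfolding corner_def by (auto simp: low_mem) (auto simp: low_def conj_zero)

lemma swap_corner: "swap k \<in> corner"
  using swap_mem[of k] by (simp add: corner_def) (simp add: swap_def)

end

text \<open>\<open>corner\<close> is the copy of \<open>SU(1,1)\<close> whose unipotent radical is the centre of \<open>U\<close>; the same argument for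
  \<open>Q = carrier G\<close> and for \<open>Q = corner\<close> serves the supercuspidal and the non-generic case.\<close>

locale level_structure = smooth_representation v \<omega> \<iota> \<sigma> sc \<pi>
  for v :: "'f::field_char_0 \<Rightarrow> int" and \<omega> :: 'f and \<iota> :: "'f \<Rightarrow> 'e::field_char_0" and \<sigma> :: "'e \<Rightarrow> 'e"
    and sc :: "complex \<Rightarrow> 'v::ab_group_add \<Rightarrow> 'v" and \<pi> :: "'e ^ 3 ^ 3 \<Rightarrow> 'v \<Rightarrow> 'v" +
  fixes n :: nat and Q :: "('e ^ 3 ^ 3) set"
  assumes n: "n \<ge> 1" and Q: "Q = carrier G \<or> Q = corner"
begin

text \<open>The exponent \<open>int n - 1\<close> excludes \<open>swap n\<close> and gives the
  factorization of \<open>L\<close> into \<open>A\<close> and \<open>B\<close>. Within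
  \<open>corner\<close> it yields an Iwahori subgroup, whose two simple reflections are
  \<open>swap n\<close> and \<open>swap (n - 1)\<close>.\<close>

definition L :: "('e ^ 3 ^ 3) set" where "L = parahoric n (int n - 1) \<inter> Q"
definition A :: "('e ^ 3 ^ 3) set" where "A = upper 0 (1 - int n) \<inter> Q"
definition B :: "('e ^ 3 ^ 3) set" where "B = {g \<in> L. g$1$2 = 0 \<and> g$1$3 = 0 \<and> g$2$3 = 0}"

lemma compact_Q: "compact_subgroup S \<Longrightarrow> compact_subgroup (S \<inter> Q)"
  using Q compact_subgroup_corner compact_subgroupD(1)
  by (metis Int_absorb2 subsetI)

lemma L_compact: "compact_subgroup L"
  unfolding L_def using n by (intro compact_Q parahoric_compact) auto

lemma A_compact: "compact_subgroup A"
  unfolding A_def using n by (intro compact_Q upper_compact) auto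

lemma L_G: "g \<in> L \<Longrightarrow> g \<in> carrier G"
  by (simp add: L_def parahoric_def)

lemma Q_mult: "g \<in> Q \<Longrightarrow> h \<in> Q \<Longrightarrow> g ** h \<in> Q"
  using Q by (auto simp: G_mult) (auto simp: corner_def G_mult matrix_mult_nth3)

lemma Q_adj: "g \<in> Q \<Longrightarrow> adj g \<in> Q"
  using Q by (auto simp: G_adj) (auto simp: corner_def G_adj adj_nth conj_zero conj_one)

lemma Q_corner: "g \<in> corner \<Longrightarrow> g \<in> Q"
  using Q by (auto simp: corner_def)

lemma Q_delta: "g \<in> Q \<Longrightarrow> adj delta ** g ** delta \<in> Q" "g \<in> Q \<Longrightarrow> delta ** g ** adj delta \<in> Q"
proof -
  have d: "delta \<in> Q"
    using swap_product[of 1] Q_mult Q_corner swap_corner by metis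
  then show "g \<in> Q \<Longrightarrow> adj delta ** g ** delta \<in> Q" "g \<in> Q \<Longrightarrow> delta ** g ** adj delta \<in> Q"
    using Q_mult Q_adj by blast+
qed

lemma unif_mem: "unif \<in> pE 1"
  using emb_uniformizer by (simp add: pE_iff)

lemma A_subset_L: "A \<subseteq> L"
proof
  fix g assume "g \<in> A"
  then obtain x y where g: "g = u x y" "x \<in> pE 0" "y \<in> pE (1 - int n)" "isotropic x y" "g \<in> Q"
    by (auto simp: A_def upper_def)
  then have "g \<in> carrier G" by (simp add: u_mem)
  then show "g \<in> L" using g by (simp add: L_def parahoric_def) (simp add: u_eq)
qed

lemma u_mem_A: "x \<in> pE 0 \<Longrightarrow> y \<in> pE (1 - int n) \<Longrightarrow> isotropic x y \<Longrightarrow> u x y \<in> Q \<Longrightarrow> u x y \<in> A"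
  by (auto simp: A_def upper_def)

lemma B_subset_L: "B \<subseteq> L"
  by (auto simp: B_def)

lemma B_delta: "b \<in> B \<Longrightarrow> adj delta ** b ** delta \<in> B"
proof -
  assume b: "b \<in> B"
  have 1: "unif * x \<in> pE (int n)" if "x \<in> pE (int n)" for x
    by (rule pE_mult[OF unif_mem that]) simp
  have "adj delta ** b ** delta \<in> carrier G"
    using b L_G delta_mem by (simp add: B_def G_mult G_adj)
  moreover have "adj delta ** b ** delta \<in> Q" using b Q_delta by (simp add: B_def L_def)
  ultimately show ?thesis
    using b 1 1[OF 1] by (simp add: B_def L_def parahoric_def) (simp add: adj_delta_conj mult.assoc)
qed

lemma L_decomposition: "g \<in> L \<Longrightarrow> \<exists>a\<in>A. \<exists>b\<in>B. g = a ** b"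
proof -
  assume g: "g \<in> L"
  note g' = g[unfolded L_def parahoric_def Int_iff mem_Collect_eq]
  have u33: "g$3$3 \<noteq> 0" "valE (g$3$3) = 0"
    using parahoric_units(2)[of g n "int n - 1"] g n by (auto simp: L_def)
  define x where "x = - \<sigma> (g$2$3 / g$3$3)"
  define y where "y = g$1$3 / g$3$3"
  have iso: "isotropic x y"
    and z: "(adj (u x y) ** g)$1$2 = 0 \<and> (adj (u x y) ** g)$1$3 = 0 \<and> (adj (u x y) ** g)$2$3 = 0"
    using upper_lower_decomposition[OF L_G[OF g] u33(1)] by (simp_all add: x_def y_def)
  have "x \<in> pE 0" unfolding x_def pE_uminus_iff pE_conj using g' u33 by (intro pE_divide) auto
  moreover have "y \<in> pE (1 - int n)" unfolding y_def using g' u33 by (intro pE_divide) auto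
  moreover have "u x y \<in> Q"
  proof (cases "Q = corner")
    case True
    then have "g$2$3 = 0" using g' by (simp add: corner_def)
    then show ?thesis using iso True u_corner(1) by (simp add: x_def conj_zero)
  next
    case False
    then show ?thesis using Q iso by (simp add: u_mem)
  qed
  ultimately have a: "u x y \<in> A" using iso by (auto simp: A_def upper_def)
  have "adj (u x y) ** g \<in> L" using a g A_subset_L compact_subgroupD[OF L_compact] by blast
  then have "adj (u x y) ** g \<in> B" using z by (simp add: B_def)
  moreover have "g = u x y ** (adj (u x y) ** g)" using iso by (simp add: adj_cancel' u_mem)
  ultimately show ?thesis using a by blast
qed

lemma A_delta: "a \<in> A \<Longrightarrow> delta ** a ** adj delta \<in> A"
proof -
  assume a: "a \<in> A"
  then obtain x y where g: "a = u x y" "x \<in> pE 0" "y \<in> pE (1 - int n)" "isotropic x y" "a \<in> Q"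
    by (auto simp: A_def upper_def)
  have "u (unif * x) (unif\<^sup>2 * y) \<in> carrier G"
    unfolding delta_u_conj[symmetric] using g by (simp add: G_mult G_adj delta_mem u_mem)
  then have "isotropic (unif * x) (unif\<^sup>2 * y)" by (simp add: u_mem)
  moreover have "unif * x \<in> pE 0" using g unif_mem by (intro pE_mult[of unif 1 x 0]) auto
  moreover have "unif\<^sup>2 * y \<in> pE (1 - int n)" unfolding power2_eq_square
    using g unif_mem by (intro pE_mult[of "unif * unif" 2 y "1 - int n"] pE_mult[of unif 1 unif 1]) auto
  moreover have "delta ** a ** adj delta \<in> Q" using Q_delta g by blast
  ultimately show ?thesis unfolding A_def upper_def delta_u_conj g(1) by blast
qed

text \<open>Covers \<open>L\<close> modulo its intersection with the conjugate by
  \<open>swap n\<close>. One root subgroup is enough, because the only extra condition for that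
  conjugate of \<open>b\<close> to lie in \<open>L\<close> is
  \<open>b$3$1 \<in> pE (n + 1)\<close>.\<close>

definition Z_low :: "('e ^ 3 ^ 3) set" where
  "Z_low = {low 0 c | c. c \<in> pE (int n) \<and> isotropic 0 c}"

lemma Z_low_subset: "Z_low \<subseteq> L"
proof
  fix g assume "g \<in> Z_low"
  then obtain c where c: "g = low 0 c" "c \<in> pE (int n)" "isotropic 0 c" by (auto simp: Z_low_def)
  then have "g \<in> carrier G" "g \<in> Q" using low_corner Q_corner by (auto simp: low_mem)
  then show "g \<in> L" using c by (simp add: L_def parahoric_def) (simp add: low_def conj_zero)
qed

lemma low_mult: "low 0 x ** low 0 y = low 0 (x + y)"
  by (simp add: low_def mat3_mult conj_zero algebra_simps)

lemma Z_low_compact: "compact_subgroup Z_low"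
proof -
  note L = L_compact[unfolded compact_subgroup_def]
  have "mat 1 \<in> Z_low"
    unfolding Z_low_def by (intro CollectI exI[of _ 0]) (simp add: low_def mat1_eq isotropic_def conj_zero)
  moreover have "adj g \<in> Z_low" if g: "g \<in> Z_low" for g
  proof -
    obtain c where c: "g = low 0 c" "c \<in> pE (int n)" "isotropic 0 c" using g by (auto simp: Z_low_def)
    then have "adj g = low 0 (\<sigma> c)" "\<sigma> c \<in> pE (int n)" "isotropic 0 (\<sigma> c)"
      using isotropic_conj[of 0 c] by (simp_all add: adj_low)
    then show ?thesis unfolding Z_low_def by blast
  qed
  moreover have "g ** h \<in> Z_low" if gh: "g \<in> Z_low" "h \<in> Z_low" for g h
  proof -
    obtain c d where c: "g = low 0 c" "c \<in> pE (int n)" "isotropic 0 c"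
      "h = low 0 d" "d \<in> pE (int n)" "isotropic 0 d" using gh by (auto simp: Z_low_def)
    then have "g ** h = low 0 (c + d)" "c + d \<in> pE (int n)" "isotropic 0 (c + d)"
      by (auto simp: low_mult isotropic_def conj_add pE_add algebra_simps add_eq_0_iff)
    then show ?thesis unfolding Z_low_def by blast
  qed
  ultimately show ?thesis unfolding compact_subgroup_def using Z_low_subset L by blast
qed

text \<open>\<open>low 0 c\<close> is unitary only for \<open>c\<close> of trace zero, so only the
  skew part of \<open>z = g$3$1 / g$1$1\<close> can be divided out. By \<open>column1\<close> the
  trace of \<open>z\<close> is a norm of \<open>g$2$1\<close> up to units; it lies in
  \<open>pE (2 * n)\<close>, and \<open>2 * n \<ge> n + 1\<close>.\<close>

lemma L_decomposition_low:
  assumes g: "g \<in> L"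
  obtains c b where "c \<in> Z_low" "b \<in> L" "g = c ** b" "swap (int n) ** b ** swap (int n) \<in> L"
proof -
  note g' = g[unfolded L_def parahoric_def Int_iff mem_Collect_eq]
  have u11: "g$1$1 \<noteq> 0" "valE (g$1$1) = 0"
    using parahoric_units(1)[of g n "int n - 1"] g n by (auto simp: L_def)
  define z where "z = g$3$1 / g$1$1"
  define c where "c = (z - \<sigma> z) / 2"
  have z: "z \<in> pE (int n)" unfolding z_def using g' u11 by (intro pE_divide) auto
  have c: "c \<in> pE (int n)" unfolding c_def using z by (intro pE_half pE_diff) auto
  have iso: "isotropic 0 c" by (simp add: isotropic_def c_def conj_simps conj_numeral field_simps)
  have cZ: "low 0 c \<in> Z_low" using c iso by (auto simp: Z_low_def)
  have "z + \<sigma> z = - (\<sigma> (g$2$1) * g$2$1) / (\<sigma> (g$1$1) * g$1$1)"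
  proof -
    have "z + \<sigma> z = (\<sigma> (g$1$1) * g$3$1 + \<sigma> (g$3$1) * g$1$1) / (\<sigma> (g$1$1) * g$1$1)"
      using u11 by (simp add: z_def conj_simps field_simps)
    moreover have "\<sigma> (g$1$1) * g$3$1 + \<sigma> (g$3$1) * g$1$1 = - (\<sigma> (g$2$1) * g$2$1)"
      using column1[OF L_G[OF g]] by (simp add: algebra_simps eq_neg_iff_add_eq_0)
    ultimately show ?thesis by simp
  qed
  moreover have "- (\<sigma> (g$2$1) * g$2$1) / (\<sigma> (g$1$1) * g$1$1) \<in> pE (2 * int n)"
    using g' u11 by (intro pE_divide[of _ "2 * int n"] pE_uminus pE_mult[of _ "int n" _ "int n"])
      (auto simp: valE_mult valE_conj conj_eq_zero)
  ultimately have "(z + \<sigma> z) / 2 \<in> pE (2 * int n)" using pE_half by metis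
  then have "(z + \<sigma> z) / 2 \<in> pE (int n + 1)" by (rule pE_mono) (use n in simp)
  then have "(z + \<sigma> z) / 2 * g$1$1 \<in> pE (int n + 1)" by (rule pE_mult[of _ _ _ 0]) (use g' in auto)
  moreover have "(z + \<sigma> z) / 2 * g$1$1 = g$3$1 - c * g$1$1"
    using u11 by (simp add: c_def z_def field_simps)
  ultimately have d: "g$3$1 - c * g$1$1 \<in> pE (int n + 1)" by (simp only:)
  define b where "b = adj (low 0 c) ** g"
  have bL: "b \<in> L" unfolding b_def using cZ Z_low_subset g compact_subgroupD[OF L_compact] by blast
  have gb: "g = low 0 c ** b" using iso by (simp add: b_def adj_cancel' low_mem)
  have sc: "\<sigma> c = - c" using iso by (simp add: isotropic_def add_eq_0_iff)
  have b31: "b$3$1 \<in> pE (int n + 1)"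
  proof -
    have "b$3$1 = g$3$1 - c * g$1$1"
      unfolding b_def adj_low unfolding low_def matrix_mult_nth3 by (simp add: sc conj_zero)
    then show ?thesis using d by simp
  qed
  note b' = bL[unfolded L_def parahoric_def Int_iff mem_Collect_eq]
  have "swap (int n) ** b ** swap (int n) \<in> Q"
    using b' Q_mult Q_corner swap_corner by blast
  moreover have "swap (int n) ** b ** swap (int n) \<in> carrier G"
    using b' by (simp add: G_mult swap_mem)
  moreover have "unif powi (- int n) * b$3$2 \<in> pE 0" "unif powi (- int n) * b$2$1 \<in> pE 0"
    using b' by (auto intro!: pE_mult[of _ "- int n" _ "int n"] unif_power_mem)
  moreover have "unif powi (- 2 * int n) * b$3$1 \<in> pE (1 - int n)"
    using b31 by (intro pE_mult[of _ "- 2 * int n" _ "int n + 1"] unif_power_mem) auto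
  moreover have "unif powi (int n) * b$2$3 \<in> pE (int n)" "unif powi (int n) * b$1$2 \<in> pE (int n)"
    using b' by (auto intro!: pE_mult[of _ "int n" _ 0] unif_power_mem)
  moreover have "unif powi (2 * int n) * b$1$3 \<in> pE (int n)"
    using b' by (intro pE_mult[of _ "2 * int n" _ "1 - int n"] unif_power_mem) auto
  ultimately have "swap (int n) ** b ** swap (int n) \<in> L"
    using b' by (simp add: L_def parahoric_def) (simp add: swap_conj)
  then show ?thesis using that cZ bL gb by blast
qed

section \<open>The Hecke operators of the two affine reflections\<close>

lemma rep_swap_swap: "\<pi> (swap k) (\<pi> (swap k) x) = x"
  using rep_mult[OF swap_mem swap_mem, of k k x] by (simp add: swap_swap)

lemma rep_swap_past:
  assumes "b \<in> carrier G" "swap k ** b ** swap k \<in> L" "fixed_by L w"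
  shows "\<pi> b (\<pi> (swap k) w) = \<pi> (swap k) w"
proof -
  have "\<pi> (swap k) (\<pi> b (\<pi> (swap k) w)) = \<pi> (swap k ** b ** swap k) w"
    using assms by (simp add: rep_mult G_mult swap_mem)
  also have "\<dots> = w" using assms by (simp add: fixed_by_def)
  finally have "\<pi> (swap k) (\<pi> (swap k) (\<pi> b (\<pi> (swap k) w))) = \<pi> (swap k) w" by simp
  then show ?thesis by (simp add: rep_swap_swap)
qed

lemma avg_L_swap_n:
  assumes w: "fixed_by L w"
  shows "avg L (\<pi> (swap (int n)) w) = avg Z_low (\<pi> (swap (int n)) w)"
proof (rule avg_cong)
  have "\<pi> g (\<pi> (swap (int n)) w) \<in> (\<lambda>g. \<pi> g (\<pi> (swap (int n)) w)) ` Z_low" if g: "g \<in> L" for g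
  proof -
    obtain c b where cb: "c \<in> Z_low" "b \<in> L" "g = c ** b" "swap (int n) ** b ** swap (int n) \<in> L"
      using L_decomposition_low[OF g] by blast
    have "\<pi> g (\<pi> (swap (int n)) w) = \<pi> c (\<pi> b (\<pi> (swap (int n)) w))"
      unfolding cb(3) using cb Z_low_subset L_G by (intro rep_mult) auto
    also have "\<pi> b (\<pi> (swap (int n)) w) = \<pi> (swap (int n)) w"
      using rep_swap_past cb L_G w by blast
    finally show ?thesis using cb(1) by blast
  qed
  then show "(\<lambda>g. \<pi> g (\<pi> (swap (int n)) w)) ` L = (\<lambda>g. \<pi> g (\<pi> (swap (int n)) w)) ` Z_low"
    using Z_low_subset by blast
qed

lemma low_conj_swap: "swap k ** low x y ** swap k = u (unif powi (- k) * - \<sigma> x) (unif powi (- 2 * k) * y)"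
  unfolding swap_conj unfolding low_def u_eq by (simp add: conj_simps)

lemma u_conj_swap: "swap k ** u x y ** swap k = low (unif powi k * - \<sigma> x) (unif powi (2 * k) * y)"
  unfolding swap_conj unfolding low_def u_eq by (simp add: conj_simps)

text \<open>The lengths add: conjugation by \<open>swap (n - 1)\<close> moves \<open>Z_low\<close>
  from the lower left corner to the upper right one, where it falls into \<open>A\<close> and is
  absorbed by the outer average.\<close>

lemma compose_reflections:
  assumes w: "fixed_by L w"
  shows "avg L (\<pi> (swap (int n - 1)) (avg L (\<pi> (swap (int n)) w))) = avg L (\<pi> delta w)"
proof -
  let ?s0 = "swap (int n - 1)" and ?s1 = "swap (int n)"
  have Zlow: "g \<in> Z_low \<Longrightarrow> g \<in> carrier G" for g using Z_low_subset L_G by blast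
  have sub: "conjugate ?s0 Z_low \<subseteq> L"
  proof
    fix h assume "h \<in> conjugate ?s0 Z_low"
    then obtain c where c: "h = ?s0 ** low 0 c ** ?s0" "c \<in> pE (int n)" "isotropic 0 c"
      by (auto simp: conjugate_def Z_low_def adj_swap)
    let ?y = "unif powi (- 2 * (int n - 1)) * c"
    have h: "h = u 0 ?y" unfolding c(1) low_conj_swap by (simp add: conj_zero)
    have "h \<in> carrier G" unfolding c(1) using c by (simp add: G_mult swap_mem low_mem)
    then have iso: "isotropic 0 ?y" unfolding h by (simp add: u_mem)
    have "?y \<in> pE (1 - int n)"
      using c by (intro pE_mult[of _ "- 2 * (int n - 1)" _ "int n"] unif_power_mem) auto
    moreover have "h \<in> Q" using h iso u_corner(1) Q_corner by blast
    ultimately have "h \<in> A" unfolding h using iso by (intro u_mem_A) simp_all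
    then show "h \<in> L" using A_subset_L by blast
  qed
  have "\<pi> ?s0 (avg L (\<pi> ?s1 w)) = avg (conjugate ?s0 Z_low) (\<pi> ?s0 (\<pi> ?s1 w))"
    using rep_avg_conjugate[of Z_low ?s0] Zlow swap_mem by (simp add: avg_L_swap_n[OF w] subset_iff)
  also have "\<pi> ?s0 (\<pi> ?s1 w) = \<pi> delta w"
    using rep_mult[OF swap_mem swap_mem, of "int n - 1" "int n" w] by (simp add: swap_product)
  finally show ?thesis
    using avg_avg[OF L_compact compact_subgroup_conjugate[OF Z_low_compact swap_mem sub L_compact] sub]
    by simp
qed

text \<open>A translate of \<open>\<pi> (swap n) w\<close> that differs from it comes from a lower
  unipotent whose conjugate by \<open>swap n\<close> is \<open>u 0 y\<close> with \<open>y\<close>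
  of valuation exactly \<open>- n\<close>. The identity
  \<open>u 0 y = low 0 (1 / y) ** (swap n ** b')\<close>, familiar from 2 by 2 matrices, has both
  outer factors in \<open>L\<close>, which reduces the average to the one assumed to vanish.\<close>

lemma reflection_n_injective:
  assumes w: "fixed_by L w" and zero: "avg L (\<pi> (swap (int n)) w) = 0"
  shows "w = 0"
proof (rule reflection_injective[OF L_compact swap_mem swap_swap w zero])
  let ?s = "swap (int n)"
  fix x assume x: "x \<in> L" and ne: "\<pi> x (\<pi> ?s w) \<noteq> \<pi> ?s w"
  obtain g b where cb: "g \<in> Z_low" "b \<in> L" "x = g ** b" "?s ** b ** ?s \<in> L"
    using L_decomposition_low[OF x] by blast
  obtain c where c: "g = low 0 c" "c \<in> pE (int n)" "isotropic 0 c" using cb(1) by (auto simp: Z_low_def)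
  have gG: "g \<in> carrier G" using c by (simp add: low_mem)
  have xs: "\<pi> x (\<pi> ?s w) = \<pi> g (\<pi> ?s w)"
    unfolding cb(3) using rep_swap_past[OF L_G[OF cb(2)] cb(4) w] cb L_G gG by (simp add: rep_mult)
  let ?y = "unif powi (- 2 * int n) * c"
  have sgs: "?s ** g ** ?s = u 0 ?y" unfolding c(1) low_conj_swap by (simp add: conj_zero)
  have yG: "u 0 ?y \<in> carrier G" unfolding sgs[symmetric] using gG by (simp add: G_mult swap_mem)
  then have isoy: "isotropic 0 ?y" by (simp add: u_mem)
  have nc: "c \<notin> pE (int n + 1)"
  proof
    assume "c \<in> pE (int n + 1)"
    then have "?y \<in> pE (1 - int n)" by (intro pE_mult[of _ "- 2 * int n" _ "int n + 1"] unif_power_mem) auto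
    moreover have "u 0 ?y \<in> Q" using isoy u_corner(1) Q_corner by blast
    ultimately have "u 0 ?y \<in> A" using isoy by (intro u_mem_A) simp_all
    then have "?s ** g ** ?s \<in> L" using A_subset_L sgs by auto
    then show False using rep_swap_past[OF gG _ w] ne xs by simp
  qed
  then have c0: "c \<noteq> 0" "valE c = int n" using valE_eqI[OF c(2)] by auto
  then have y: "?y \<noteq> 0" "valE ?y = - int n" by (auto simp: valE_mult valE_uniformizer_power)
  define y where "y = ?y"
  have sy: "\<sigma> y = - y" using isoy by (simp add: isotropic_def y_def add_eq_0_iff)
  have iso': "isotropic 0 (1 / y)" "isotropic 0 (- (1 / y))"
    by (simp_all add: isotropic_def conj_simps sy)
  define b' where "b' = ?s ** adj (low 0 (1 / y)) ** u 0 y"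
  have b'_eq: "b' = mat3 (- (unif powi (- int n) / y)) 0 0 0 1 0 (unif powi (int n)) 0 (unif powi (int n) * y)"
    using y unfolding b'_def adj_low y_def[symmetric]
    by (simp add: low_def swap_def u_eq mat3_mult conj_simps sy)
  have b'L: "b' \<in> L"
  proof -
    have "b' \<in> carrier G" unfolding b'_def using yG iso'
      by (simp add: G_mult G_adj swap_mem low_mem y_def)
    moreover have "b' \<in> corner" using calculation unfolding corner_def by (simp add: b'_eq)
    moreover have "unif powi (- int n) / y \<in> pE 0"
      using y by (intro pE_divide[of _ "- int n"] unif_power_mem) (auto simp: y_def)
    moreover have "unif powi (int n) * y \<in> pE 0"
      using y by (intro pE_mult[of _ "int n" _ "- int n"] unif_power_mem) (auto simp: y_def pE_iff)
    ultimately show ?thesis using Q_corner unfolding L_def parahoric_def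
      using unif_power_mem[of "int n" "int n"] by (simp add: b'_eq)
  qed
  have lowL: "low 0 (1 / y) \<in> L"
  proof -
    have "1 / y \<in> pE (int n)" using y by (intro pE_divide[of _ 0]) (auto simp: y_def)
    then have "low 0 (1 / y) \<in> Z_low" using iso' by (auto simp: Z_low_def)
    then show ?thesis using Z_low_subset by blast
  qed
  have "u 0 y = low 0 (1 / y) ** (?s ** b')"
  proof -
    have "?s ** b' = adj (low 0 (1 / y)) ** u 0 y"
      unfolding b'_def matrix_mul_assoc swap_swap by simp
    then show ?thesis using iso' by (simp add: adj_cancel' low_mem)
  qed
  then have "\<pi> (u 0 y) w = \<pi> (low 0 (1 / y)) (\<pi> ?s (\<pi> b' w))"
    using lowL b'L L_G by (simp add: rep_mult G_mult swap_mem)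
  then have "\<pi> (u 0 y) w = \<pi> (low 0 (1 / y)) (\<pi> ?s w)" using b'L w by (simp add: fixed_by_def)
  moreover have "\<pi> ?s (\<pi> x (\<pi> ?s w)) = \<pi> (u 0 y) w"
    unfolding xs y_def sgs[symmetric] using gG by (simp add: rep_mult G_mult swap_mem)
  ultimately show "avg L (\<pi> ?s (\<pi> x (\<pi> ?s w))) = 0" using avg_rep[OF L_compact lowL] zero by simp
qed

lemma norm_one_unit:
  assumes "m * \<sigma> m = 1"
  shows "m \<noteq> 0" "valE m = 0" "\<sigma> m = inverse m"
proof -
  show m: "m \<noteq> 0" using assms by auto
  have "valE m + valE (\<sigma> m) = 0" using assms m valE_mult[of m "\<sigma> m"] valE_one by (simp add: conj_eq_zero)
  then show "valE m = 0" by (simp add: valE_conj)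
  show "\<sigma> m = inverse m" using assms by (simp add: inverse_unique)
qed

text \<open>The middle entry \<open>m\<close> may keep \<open>torus 1 m\<close> out of
  \<open>L\<close>, but the element normalizes \<open>L\<close> and hence commutes with
  \<open>avg L\<close> (\<open>torus_avg\<close>). This disposes of the torus factor that appears
  for \<open>swap (n - 1)\<close>.\<close>

lemma torus_L:
  assumes m: "m * \<sigma> m = 1" and g: "g \<in> L"
  shows "torus 1 m ** g ** adj (torus 1 m) \<in> L"
proof -
  have t: "torus 1 m \<in> carrier G" using m by (simp add: torus_mem)
  have e: "torus 1 m ** g ** adj (torus 1 m)
      = mat3 (g$1$1) (g$1$2 * \<sigma> m) (g$1$3) (m * g$2$1) (g$2$2) (m * g$2$3) (g$3$1) (g$3$2 * \<sigma> m) (g$3$3)"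
    using m by (cases g rule: mat3_cases) (simp add: torus_def adj_mat3 mat3_mult conj_simps mult_ac)
  have c: "torus 1 m ** g ** adj (torus 1 m) \<in> carrier G" using g t L_G by (simp add: G_mult G_adj)
  have i: "m * x \<in> pE k \<longleftrightarrow> x \<in> pE k" "x * \<sigma> m \<in> pE k \<longleftrightarrow> x \<in> pE k" for x k
    using norm_one_unit[OF m] by (cases "x = 0"; simp add: pE_iff valE_mult valE_inverse)+
  have "torus 1 m ** g ** adj (torus 1 m) \<in> Q"
    using Q c g by (auto simp: L_def) (auto simp: corner_def e)
  then show ?thesis using g c by (simp add: L_def parahoric_def) (simp add: e i)
qed

lemma torus_avg:
  assumes m: "m * \<sigma> m = 1"
  shows "\<pi> (torus 1 m) (avg L x) = avg L (\<pi> (torus 1 m) x)"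
proof -
  have t: "torus 1 m \<in> carrier G" using m by (simp add: torus_mem)
  have m': "\<sigma> m * \<sigma> (\<sigma> m) = 1" using m by (simp add: conj_conj mult.commute)
  have inv: "torus 1 (\<sigma> m) = adj (torus 1 m)" by (simp add: torus_def adj_mat3 conj_simps)
  have "conjugate (torus 1 m) L = L"
  proof (intro equalityI subsetI)
    show "g \<in> conjugate (torus 1 m) L \<Longrightarrow> g \<in> L" for g
      using torus_L[OF m] by (auto simp: conjugate_def)
    fix g assume g: "g \<in> L"
    have "adj (torus 1 m) ** g ** torus 1 m \<in> L"
      using torus_L[OF m' g] by (simp add: inv adj_adj)
    moreover have "g = torus 1 m ** (adj (torus 1 m) ** g ** torus 1 m) ** adj (torus 1 m)"
      using t by (simp add: adj_cancel' adj_right flip: matrix_mul_assoc)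
    ultimately show "g \<in> conjugate (torus 1 m) L" unfolding conjugate_def by blast
  qed
  then show ?thesis using rep_avg_conjugate[of L "torus 1 m" x] t L_G by (simp add: subset_iff)
qed

lemma mat_avg:
  assumes m: "m * \<sigma> m = 1"
  shows "\<pi> (mat m) (avg L x) = avg L (\<pi> (mat m) x)"
proof -
  have "mat m ** g ** adj (mat m) = g" for g :: "'e ^ 3 ^ 3"
    using adj_right[OF mat_mem[OF m]] by (simp add: mat_central[of m g] flip: matrix_mul_assoc)
  then have "conjugate (mat m) L = L" by (simp add: conjugate_def)
  then show ?thesis using rep_avg_conjugate[of L "mat m" x] mat_mem[OF m] L_G by (simp add: subset_iff)
qed

text \<open>The lower unipotent elements between \<open>L\<close> and \<open>swap (n - 1) L swap (n - 1)\<close> whose double coset is not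
  that of the reflection: commuting them with upper unipotents produces all of \<open>E1 (n - 1)\<close>.\<close>

lemma avg_intermediate_fixed:
  assumes w: "fixed_by L w" and n2: "n \<ge> 2" and QG: "Q = carrier G"
    and X: "X \<noteq> 0" "valE X = int n - 1" and Y: "Y \<in> pE (int n)" and iso: "isotropic X Y"
    and m: "m \<in> E1 (n - 1)"
  shows "\<pi> (mat m) (avg L (\<pi> (low X Y) w)) = avg L (\<pi> (low X Y) w)"
proof -
  have m1: "m * \<sigma> m = 1" and mp: "m - 1 \<in> pE (int n - 1)"
    using m n2 by (auto simp: E1_def of_nat_diff)
  note mu = norm_one_unit[OF m1]
  \<comment> \<open>Chosen with \<open>b * X = (1 - m) / 2\<close>: up to the term with
    \<open>y\<close>, the middle entry of \<open>k\<close> becomes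
    \<open>1 + (m - \<sigma> m) / 2\<close>, which for \<open>m\<close> of norm one differs from
    \<open>m\<close> by \<open>(m - 1) * (\<sigma> m - 1) / 2\<close>.\<close>
  define b where "b = (1 - m) / (2 * X)"
  define y where "y = - (b * \<sigma> b) / 2"
  have v2X: "2 * X \<noteq> 0" "valE (2 * X) = int n - 1" using X by (auto simp: valE_mult valE_two)
  have b: "b \<in> pE 0" unfolding b_def using pE_uminus[OF mp] v2X by (intro pE_divide[of _ "int n - 1"]) simp_all
  have y: "y \<in> pE 0" unfolding y_def using b by (intro pE_half pE_uminus pE_mult[of b 0 "\<sigma> b" 0]) auto
  have isob: "isotropic b y" unfolding y_def by (rule isotropic_half)
  have uL: "u b y \<in> L"
  proof -
    have "u b y \<in> Q" using QG isob by (simp add: u_mem)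
    then have "u b y \<in> A" using b pE_mono[OF y, of "1 - int n"] isob n by (intro u_mem_A) auto
    then show ?thesis using A_subset_L by blast
  qed
  have lowG: "low X Y \<in> carrier G" using iso by (simp add: low_mem)
  define k where "k = adj (low X Y) ** u b y ** low X Y"
  have kG: "k \<in> carrier G" unfolding k_def using lowG uL L_G by (simp add: G_mult G_adj)
  have k_eq: "k = mat3 (1 + b * X + y * Y) (b - y * \<sigma> X) y
      (- (X * (b * X + y * Y)) - \<sigma> b * Y) (1 - X * (b - y * \<sigma> X) + \<sigma> b * \<sigma> X) (- (X * y) - \<sigma> b)
      (\<sigma> Y * (1 + b * X + y * Y) + \<sigma> X * (X - \<sigma> b * Y) + Y)
      (\<sigma> Y * (b - y * \<sigma> X) + \<sigma> X * (1 + \<sigma> b * \<sigma> X) - \<sigma> X) (1 + \<sigma> Y * y - \<sigma> X * \<sigma> b)"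
    unfolding k_def adj_low by (simp add: low_def u_eq mat3_mult conj_simps algebra_simps)
  have Xm: "X \<in> pE (int n - 1)" using X by (simp add: pE_iff)
  have Ym: "Y \<in> pE 0" using Y by (rule pE_mono) simp
  have X0: "X \<in> pE 0" using Xm by (rule pE_mono) (use n in simp)
  \<comment> \<open>Here \<open>n \<ge> 2\<close> is used: \<open>2 * (n - 1) \<ge> n\<close> puts
    products of two elements of valuation \<open>n - 1\<close> into \<open>pE n\<close>.\<close>
  have XX: "X * X \<in> pE (int n)" "\<sigma> X * \<sigma> X \<in> pE (int n)" "X * \<sigma> X \<in> pE (int n)"
    using Xm n2 by (auto intro!: pE_mult[of _ "int n - 1" _ "int n - 1"])
  have P: "s * t \<in> pE 0" if "s \<in> pE 0" "t \<in> pE 0" for s t using that pE_mult by fastforce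
  have N: "s * t \<in> pE (int n)" if "s \<in> pE (int n)" "t \<in> pE 0" for s t using that pE_mult by fastforce
  have cb: "\<sigma> b \<in> pE 0" "\<sigma> X \<in> pE 0" "\<sigma> Y \<in> pE 0" "\<sigma> Y \<in> pE (int n)" using b X0 Ym Y by auto
  have k11: "k$1$1 \<in> pE 0" unfolding k_eq mat3_nth by (intro pE_add P) (use b X0 y Ym in auto)
  have k12: "k$1$2 \<in> pE 0" unfolding k_eq mat3_nth by (intro pE_diff P) (use b cb y in auto)
  have k13: "k$1$3 \<in> pE 0" unfolding k_eq mat3_nth by (rule y)
  have k21: "k$2$1 \<in> pE (int n)"
  proof -
    have "k$2$1 = - ((X * X) * b) - Y * (X * y) - Y * \<sigma> b" by (simp add: k_eq algebra_simps)
    also have "\<dots> \<in> pE (int n)"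
      by (intro pE_diff pE_uminus N[of "X * X"] N[of Y] P) (use XX Y b X0 y cb in auto)
    finally show ?thesis .
  qed
  have k23: "k$2$3 \<in> pE 0" unfolding k_eq mat3_nth by (intro pE_diff pE_uminus P) (use cb X0 y in auto)
  have k31: "k$3$1 \<in> pE (int n)"
  proof -
    have "k$3$1 = \<sigma> Y * (1 + b * X + y * Y) + X * \<sigma> X - Y * (\<sigma> X * \<sigma> b) + Y"
      by (simp add: k_eq algebra_simps)
    also have "\<dots> \<in> pE (int n)"
      by (intro pE_diff pE_add N[of "\<sigma> Y"] N[of Y] P) (use XX Y b X0 y cb Ym in auto)
    finally show ?thesis .
  qed
  have k32: "k$3$2 \<in> pE (int n)"
  proof -
    have "k$3$2 = \<sigma> Y * (b - y * \<sigma> X) + (\<sigma> X * \<sigma> X) * \<sigma> b"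
      by (simp add: k_eq algebra_simps)
    also have "\<dots> \<in> pE (int n)"
      by (intro pE_diff pE_add N[of "\<sigma> Y"] N[of "\<sigma> X * \<sigma> X"] P) (use XX Y b X0 y cb Ym in auto)
    finally show ?thesis .
  qed
  have k33: "k$3$3 \<in> pE 0" unfolding k_eq mat3_nth by (intro pE_diff pE_add P) (use cb y in auto)
  have k22: "k$2$2 - m \<in> pE (int n)"
  proof -
    have bX: "X * b = (1 - m) / 2" using X by (simp add: b_def)
    have bX': "\<sigma> b * \<sigma> X = (1 - \<sigma> m) / 2"
      using X by (simp add: b_def conj_simps conj_numeral conj_eq_zero)
    have "(m - 1) * (\<sigma> m - 1) = - ((m - 1) + (\<sigma> m - 1))" using m1 by (simp add: algebra_simps)
    then have "k$2$2 - m = ((m - 1) * (\<sigma> m - 1)) / 2 + (X * \<sigma> X) * y"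
      unfolding k_eq mat3_nth using bX bX' by (simp add: field_simps)
    also have "\<dots> \<in> pE (int n)"
    proof (rule pE_add)
      have "\<sigma> m - 1 \<in> pE (int n - 1)" using mp pE_conj[of "m - 1"] by (simp add: conj_simps)
      then show "(m - 1) * (\<sigma> m - 1) / 2 \<in> pE (int n)"
        using mp n2 by (intro pE_half pE_mult[of _ "int n - 1" _ "int n - 1"]) auto
    qed (use XX y in \<open>intro N[of "X * \<sigma> X"]\<close>)
    finally show ?thesis .
  qed
  have tG: "torus 1 m \<in> carrier G" "torus m 1 \<in> carrier G"
    using m1 mu by (simp_all add: torus_mem conj_one)
  define l where "l = adj (torus 1 m) ** k"
  have l_eq: "l = mat3 (k$1$1) (k$1$2) (k$1$3) (\<sigma> m * k$2$1) (\<sigma> m * k$2$2) (\<sigma> m * k$2$3) (k$3$1) (k$3$2) (k$3$3)"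
    unfolding l_def by (cases k rule: mat3_cases) (simp add: torus_def adj_mat3 mat3_mult conj_simps)
  have sm: "\<sigma> m * x \<in> pE i" if "x \<in> pE i" for x i
    using that mu by (cases "x = 0") (auto simp: pE_iff valE_mult valE_inverse)
  have l22: "\<sigma> m * k$2$2 - 1 \<in> pE (int n)"
  proof -
    have "\<sigma> m * k$2$2 - 1 = \<sigma> m * (k$2$2 - m)" using m1 by (simp add: algebra_simps)
    then show ?thesis using sm[OF k22] by simp
  qed
  have "l \<in> carrier G" unfolding l_def using tG kG by (simp add: G_mult G_adj)
  moreover from this have "l \<in> Q" using QG by simp
  ultimately have lL: "l \<in> L" unfolding L_def Int_iff parahoric_def mem_Collect_eq
    using k11 k12 k13 k31 k32 k33 l22 sm[OF k21] sm[OF k23] pE_mono[OF k13, of "- (int n - 1)"] n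
    by (simp add: l_eq)
  have aL: "torus m 1 \<in> L"
  proof -
    have "torus m 1 \<in> Q" using QG tG by simp
    then show ?thesis using tG mu unfolding L_def Int_iff parahoric_def mem_Collect_eq
      by (simp add: torus_def pE_iff valE_inverse)
  qed
  \<comment> \<open>\<open>k\<close> is \<open>torus 1 m\<close> times an element of
    \<open>L\<close>, and \<open>torus m 1\<close> lies in \<open>L\<close>, so on \<open>w\<close>
    the element \<open>k\<close> acts like the central \<open>mat m\<close>.\<close>
  have mat: "mat m = torus 1 m ** torus m 1"
    using mu by (simp add: mat_eq torus_def mat3_mult conj_simps)
  have "k = torus 1 m ** l" using tG by (simp add: l_def adj_cancel')
  then have "\<pi> k w = \<pi> (torus 1 m) w"
    using rep_mult[OF tG(1) L_G[OF lL]] lL w by (simp add: fixed_by_def)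
  also have "\<dots> = \<pi> (mat m) w"
    using rep_mult[OF tG] aL w by (simp add: mat fixed_by_def)
  finally have kw: "\<pi> k w = \<pi> (mat m) w" .
  have "u b y ** low X Y = low X Y ** k"
    using lowG by (simp add: k_def adj_cancel' flip: matrix_mul_assoc)
  then have "\<pi> (u b y) (\<pi> (low X Y) w) = \<pi> (low X Y) (\<pi> k w)"
    using rep_mult[OF L_G[OF uL] lowG, of w] rep_mult[OF lowG kG, of w] by simp
  also have "\<dots> = \<pi> (mat m) (\<pi> (low X Y) w)"
    using rep_mult[OF lowG mat_mem[OF m1], of w] rep_mult[OF mat_mem[OF m1] lowG, of w]
    by (simp add: kw mat_central)
  finally have "avg L (\<pi> (low X Y) w) = avg L (\<pi> (mat m) (\<pi> (low X Y) w))"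
    using avg_rep[OF L_compact uL, of "\<pi> (low X Y) w"] by simp
  then show ?thesis unfolding mat_avg[OF m1] by (rule sym)
qed

lemma swap_B:
  assumes b: "b \<in> B"
  shows "swap (int n - 1) ** b ** swap (int n - 1) \<in> L"
proof -
  let ?m = "int n - 1"
  note b' = b[unfolded B_def L_def parahoric_def Int_iff mem_Collect_eq]
  have "swap ?m ** b ** swap ?m \<in> Q" using b' Q_mult Q_corner swap_corner by blast
  moreover have "swap ?m ** b ** swap ?m \<in> carrier G" using b' by (simp add: G_mult swap_mem)
  moreover have "unif powi (- ?m) * b$3$2 \<in> pE 0" "unif powi (- ?m) * b$2$1 \<in> pE 0"
    using b' by (auto intro!: pE_mult[of _ "- ?m" _ "int n"] unif_power_mem)
  moreover have "unif powi (- 2 * ?m) * b$3$1 \<in> pE (- ?m)"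
    using b' by (intro pE_mult[of _ "- 2 * ?m" _ "int n"] unif_power_mem) auto
  ultimately show ?thesis using b' unfolding L_def Int_iff parahoric_def mem_Collect_eq
    by (simp only: swap_conj mat3_nth) simp
qed

text \<open>Elements of \<open>A\<close> conjugate to lower unipotents \<open>low X Y\<close>. If
  \<open>Y\<close> has the least possible valuation, a rank one identity applies as for
  \<open>swap n\<close>, up to a torus element. Otherwise either \<open>X\<close> is small too and
  the conjugate lies in \<open>L\<close>, or \<open>X\<close> has valuation exactly
  \<open>n - 1\<close>, and \<open>avg_intermediate_fixed\<close> together with \<open>noZ\<close>
  gives zero.\<close>

lemma reflection_pred_injective:
  assumes w: "fixed_by L w" and zero: "avg L (\<pi> (swap (int n - 1)) w) = 0"
    and noZ: "\<And>z. Q = carrier G \<Longrightarrow> n \<ge> 2 \<Longrightarrow> (\<And>m. m \<in> E1 (n - 1) \<Longrightarrow> \<pi> (mat m) z = z) \<Longrightarrow> z = 0"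
  shows "w = 0"
proof (rule reflection_injective[OF L_compact swap_mem swap_swap w zero])
  let ?m = "int n - 1"
  let ?s = "swap ?m"
  fix g assume g: "g \<in> L" and ne: "\<pi> g (\<pi> ?s w) \<noteq> \<pi> ?s w"
  obtain a b where ab: "a \<in> A" "b \<in> B" "g = a ** b" using L_decomposition[OF g] by blast
  obtain x y where a: "a = u x y" "x \<in> pE 0" "y \<in> pE (- ?m)" "isotropic x y" "a \<in> Q"
    using ab(1) by (auto simp: A_def upper_def)
  have aL: "a \<in> L" and bL: "b \<in> L" using ab A_subset_L B_subset_L by blast+
  have aG: "a \<in> carrier G" using aL L_G by blast
  have gs: "\<pi> g (\<pi> ?s w) = \<pi> a (\<pi> ?s w)"
    unfolding ab(3) using rep_swap_past[OF L_G[OF bL] swap_B[OF ab(2)] w] aL bL L_G by (simp add: rep_mult)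
  define X where "X = unif powi ?m * - \<sigma> x"
  define Y where "Y = unif powi (2 * ?m) * y"
  have sas: "?s ** a ** ?s = low X Y" unfolding a(1) u_conj_swap X_def Y_def ..
  have lowG: "low X Y \<in> carrier G" unfolding sas[symmetric] using aG by (simp add: G_mult swap_mem)
  then have iso: "isotropic X Y" by (simp add: low_mem)
  have lw: "\<pi> ?s (\<pi> g (\<pi> ?s w)) = \<pi> (low X Y) w"
    unfolding gs sas[symmetric] using aG by (simp add: rep_mult G_mult swap_mem)
  have Xm: "X \<in> pE ?m" unfolding X_def using a by (intro pE_mult[of _ ?m _ 0] unif_power_mem) auto
  have lowQ: "low X Y \<in> Q" unfolding sas[symmetric] using a(5) Q_mult Q_corner swap_corner by blast
  show "avg L (\<pi> ?s (\<pi> g (\<pi> ?s w))) = 0"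
  proof (cases "y \<in> pE (- ?m + 1)")
    case False
    then have y0: "y \<noteq> 0" "valE y = - ?m" using valE_eqI[OF a(3)] by auto
    then have Y0: "Y \<noteq> 0" "valE Y = ?m" by (auto simp: Y_def valE_mult valE_uniformizer_power)
    \<comment> \<open>The last column of \<open>u x1 y1\<close> is the first column
      \<open>(1, X, Y)\<close> of \<open>low X Y\<close> divided by \<open>Y\<close>. Dividing by
      \<open>u x1 y1\<close> therefore leaves \<open>(0, 0, Y)\<close>, which the reflection moves
      to the diagonal.\<close>
    define x1 where "x1 = - \<sigma> (X / Y)"
    define y1 where "y1 = 1 / Y"
    \<comment> \<open>The middle entry that remains. By isotropy it is
      \<open>- \<sigma> Y / Y\<close>, of norm one but not necessarily close to \<open>1\<close>,
      whence the torus factor.\<close>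
    define m where "m = 1 + X * \<sigma> X / Y"
    have isoXY: "Y + \<sigma> Y + X * \<sigma> X = 0" using iso by (simp add: isotropic_def)
    have mY: "m = - \<sigma> Y / Y"
    proof -
      have "m * Y = Y + X * \<sigma> X" using Y0 by (simp add: m_def field_simps)
      also have "\<dots> = - \<sigma> Y" using isoXY by (simp add: eq_neg_iff_add_eq_0 algebra_simps)
      finally show ?thesis using Y0 by (simp add: field_simps)
    qed
    have m1: "m * \<sigma> m = 1" using Y0 by (simp add: mY conj_simps conj_eq_zero)
    note mu = norm_one_unit[OF m1]
    have iso1: "isotropic x1 y1"
    proof -
      have "y1 + \<sigma> y1 + x1 * \<sigma> x1 = (Y + \<sigma> Y + X * \<sigma> X) / (Y * \<sigma> Y)"
        using Y0 by (simp add: x1_def y1_def conj_simps field_simps)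
      then show ?thesis using isoXY by (simp add: isotropic_def)
    qed
    have x1p: "x1 \<in> pE 0" unfolding x1_def pE_uminus_iff pE_conj using Xm Y0 by (intro pE_divide) auto
    have y1p: "y1 \<in> pE (- ?m)" unfolding y1_def using Y0 by (intro pE_divide[of _ 0]) auto
    have u1Q: "u x1 y1 \<in> Q"
    proof (cases "Q = corner")
      case True
      then have "x = 0" using a u_corner(2) by blast
      then have "x1 = 0" by (simp add: x1_def X_def conj_zero)
      then show ?thesis using iso1 True u_corner(1) by simp
    next
      case False
      then show ?thesis using Q iso1 by (simp add: u_mem)
    qed
    have u1L: "u x1 y1 \<in> L" using u_mem_A[OF x1p _ iso1 u1Q] y1p A_subset_L by auto
    define b' where "b' = ?s ** (adj (u x1 y1) ** low X Y)"
    have b'_eq: "b' = mat3 (unif powi (- ?m) * Y) (- (unif powi (- ?m) * \<sigma> X)) (unif powi (- ?m))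
        0 m (\<sigma> x1) 0 0 (unif powi ?m * \<sigma> y1)"
    proof -
      have z11: "1 - x1 * X + \<sigma> y1 * Y = 0"
      proof -
        have "1 - x1 * X + \<sigma> y1 * Y = (Y + \<sigma> Y + X * \<sigma> X) / \<sigma> Y"
          using Y0 by (simp add: x1_def y1_def conj_simps field_simps)
        then show ?thesis using isoXY by simp
      qed
      have z12: "- x1 - \<sigma> y1 * \<sigma> X = 0" by (simp add: x1_def y1_def conj_simps)
      have z21: "X + \<sigma> x1 * Y = 0" using Y0 by (simp add: x1_def conj_simps)
      have z22: "1 - \<sigma> x1 * \<sigma> X = m" by (simp add: x1_def m_def conj_simps)
      have "adj (u x1 y1) ** low X Y = mat3 (1 - x1 * X + \<sigma> y1 * Y) (- x1 - \<sigma> y1 * \<sigma> X) (\<sigma> y1)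
          (X + \<sigma> x1 * Y) (1 - \<sigma> x1 * \<sigma> X) (\<sigma> x1) Y (- \<sigma> X) 1"
        unfolding adj_u by (simp add: u_eq low_def mat3_mult conj_simps)
      then show ?thesis unfolding b'_def z11 z12 z21 z22 by (simp add: swap_def mat3_mult)
    qed
    have tG: "torus 1 m \<in> carrier G" using m1 by (simp add: torus_mem)
    have u1G: "u x1 y1 \<in> carrier G" using u1L L_G by blast
    have b'G: "b' \<in> carrier G" unfolding b'_def using u1G lowG by (simp add: G_mult G_adj swap_mem)
    have b'Q: "b' \<in> Q" unfolding b'_def using u1Q lowQ Q_mult Q_adj Q_corner swap_corner by blast
    define l where "l = adj (torus 1 m) ** b'"
    have l_eq: "l = mat3 (unif powi (- ?m) * Y) (- (unif powi (- ?m) * \<sigma> X)) (unif powi (- ?m))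
        0 1 (\<sigma> m * \<sigma> x1) 0 0 (unif powi ?m * \<sigma> y1)"
      using m1 by (simp add: l_def b'_eq torus_def adj_mat3 mat3_mult conj_simps mult.commute)
    have lG: "l \<in> carrier G" unfolding l_def using tG b'G by (simp add: G_mult G_adj)
    have lQ: "l \<in> Q"
    proof (cases "Q = corner")
      case True
      then show ?thesis using b'Q lG by (simp add: corner_def) (simp add: l_eq b'_eq)
    next
      case False
      then show ?thesis using Q lG by simp
    qed
    have "Y \<in> pE ?m" using Y0 by (simp add: pE_iff)
    then have "unif powi (- ?m) * Y \<in> pE 0" "unif powi (- ?m) * \<sigma> X \<in> pE 0"
      using Xm by (auto intro!: pE_mult[of _ "- ?m" _ ?m] unif_power_mem)
    moreover have "unif powi ?m * \<sigma> y1 \<in> pE 0"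
      using y1p by (intro pE_mult[of _ ?m _ "- ?m"] unif_power_mem) auto
    moreover have "\<sigma> m \<in> pE 0" using mu by (simp add: pE_iff valE_inverse)
    then have "\<sigma> m * \<sigma> x1 \<in> pE 0" using x1p by (intro pE_mult[of _ 0 _ 0]) auto
    moreover have "unif powi (- ?m) \<in> pE (- ?m)" by (rule unif_power_mem) simp
    ultimately have lL: "l \<in> L" using lG lQ unfolding L_def Int_iff parahoric_def mem_Collect_eq
      by (simp only: l_eq mat3_nth) simp
    have "low X Y = u x1 y1 ** (?s ** b')"
      using u1G by (simp add: b'_def matrix_mul_assoc swap_swap)
         (simp add: adj_cancel' flip: matrix_mul_assoc)
    then have "\<pi> (low X Y) w = \<pi> (u x1 y1) (\<pi> ?s (\<pi> b' w))"
      using u1G b'G by (simp add: rep_mult G_mult swap_mem)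
    also have "\<pi> b' w = \<pi> (torus 1 m) (\<pi> l w)"
      using rep_mult[OF tG lG, of w] tG by (simp add: l_def adj_cancel')
    also have "\<pi> l w = w" using lL w by (simp add: fixed_by_def)
    also have "\<pi> ?s (\<pi> (torus 1 m) w) = \<pi> (torus 1 m) (\<pi> ?s w)"
      using torus_commute_swap[OF m1, of ?m] tG by (simp add: swap_mem flip: rep_mult)
    finally have "avg L (\<pi> (low X Y) w) = \<pi> (torus 1 m) (avg L (\<pi> ?s w))"
      using avg_rep[OF L_compact u1L] torus_avg[OF m1] by simp
    then show ?thesis using zero tG by (simp add: lw rep_zero)
  next
    case True
    have Yn: "Y \<in> pE (int n)" unfolding Y_def
      using True by (intro pE_mult[of _ "2 * ?m" _ "- ?m + 1"] unif_power_mem) auto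
    have nx: "x \<notin> pE 1"
    proof
      assume "x \<in> pE 1"
      then have "X \<in> pE (int n)" unfolding X_def
        by (intro pE_mult[of _ ?m _ 1] unif_power_mem) auto
      then have "low X Y \<in> L" using Yn lowG lowQ unfolding L_def Int_iff parahoric_def mem_Collect_eq
        using pE_mono[of X "int n" 0] by (simp only: low_def mat3_nth) simp
      then have "\<pi> a (\<pi> ?s w) = \<pi> ?s w" using rep_swap_past[OF aG _ w] by (simp add: sas)
      then show False using ne gs by simp
    qed
    have QG: "Q = carrier G"
    proof (rule ccontr)
      assume "Q \<noteq> carrier G"
      then have "x = 0" using Q a u_corner(2) by blast
      then show False using nx by simp
    qed
    have xv: "x \<noteq> 0" "valE x = 0" using valE_eqI[OF a(2)] nx by auto
    \<comment> \<open>For \<open>n = 1\<close> isotropy would express the norm of the unit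
      \<open>x\<close> through the trace of \<open>y \<in> pE 1\<close>.\<close>
    have n2: "n \<ge> 2"
    proof (rule ccontr)
      assume "\<not> n \<ge> 2"
      then have "n = 1" using n by simp
      then have "y \<in> pE 1" using True by simp
      then have "y + \<sigma> y \<in> pE 1" by (simp add: pE_add)
      then have "- (y + \<sigma> y) \<in> pE 1" by (simp only: pE_uminus_iff)
      moreover have "x * \<sigma> x = - (y + \<sigma> y)"
        using a(4) by (simp add: isotropic_def eq_neg_iff_add_eq_0 algebra_simps)
      ultimately have "x * \<sigma> x \<in> pE 1" by simp
      then show False using xv by (simp add: pE_iff valE_mult valE_conj conj_eq_zero)
    qed
    have X0: "X \<noteq> 0" "valE X = ?m"
      using xv by (auto simp: X_def valE_mult valE_uniformizer_power valE_conj valE_uminus conj_eq_zero)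
    have "\<pi> (mat m) (avg L (\<pi> (low X Y) w)) = avg L (\<pi> (low X Y) w)" if "m \<in> E1 (n - 1)" for m
      by (rule avg_intermediate_fixed[OF w n2 QG X0 Yn iso that])
    from noZ[OF QG n2 this] show ?thesis by (simp add: lw)
  qed
qed

text \<open>Since \<open>delta\<close> contracts \<open>U\<close>, the conjugate of a given
  \<open>g\<close> by a high power lies in \<open>A\<close>, and \<open>avg A\<close> no longer sees
  the difference \<open>\<pi> g w - w\<close>. Vanishing in the coinvariants thus becomes vanishing
  after finitely many steps, which \<open>chain_injective\<close> carries back to
  \<open>x\<close>.\<close>

theorem fixed_vector_vanishes:
  assumes x: "fixed_by L x" and span: "x \<in> V.span {\<pi> g w - w | g w. g \<in> U \<inter> Q}"
    and noZ: "\<And>z. Q = carrier G \<Longrightarrow> n \<ge> 2 \<Longrightarrow> (\<And>m. m \<in> E1 (n - 1) \<Longrightarrow> \<pi> (mat m) z = z) \<Longrightarrow> z = 0"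
  shows "x = 0"
proof -
  \<comment> \<open>Vanishing for all large \<open>k\<close>, not just for one, so that the property
    passes to linear combinations.\<close>
  let ?P = "\<lambda>x. \<exists>k0. \<forall>k\<ge>k0. avg A ((\<pi> delta ^^ k) x) = 0"
  have pow_add: "(\<pi> delta ^^ k) (x + y) = (\<pi> delta ^^ k) x + (\<pi> delta ^^ k) y"
    and pow_scale: "(\<pi> delta ^^ k) (sc c x) = sc c ((\<pi> delta ^^ k) x)" for k x y c
    by (induction k) (simp_all add: rep_add rep_scale delta_mem)
  have pow_diff: "(\<pi> delta ^^ k) (x - y) = (\<pi> delta ^^ k) x - (\<pi> delta ^^ k) y" for k x y
    using pow_add[of k "x - y" y] by simp
  have "?P x"
    using span
  proof (induction rule: V.span_induct_alt)
    case base
    have "(\<pi> delta ^^ k) 0 = 0" for k by (induction k) (simp_all add: rep_zero delta_mem)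
    then show ?case by (simp add: avg_zero[OF A_compact])
  next
    case (step c y z)
    then obtain g w where y: "y = \<pi> g w - w" "g \<in> U" "g \<in> Q" by blast
    then obtain a b where g: "g = u a b" "isotropic a b" by (auto simp: U_def isotropic_def)
    have conj_pow: "u (unif ^ k * a) (unif ^ (2 * k) * b) \<in> Q \<and> isotropic (unif ^ k * a) (unif ^ (2 * k) * b) \<and>
        (\<pi> delta ^^ k) (\<pi> g w) = \<pi> (u (unif ^ k * a) (unif ^ (2 * k) * b)) ((\<pi> delta ^^ k) w)" for k
    proof (induction k)
      case 0
      then show ?case using y g by simp
    next
      case (Suc k)
      let ?h = "u (unif ^ k * a) (unif ^ (2 * k) * b)" and ?h' = "u (unif ^ Suc k * a) (unif ^ (2 * Suc k) * b)"
      have h: "delta ** ?h ** adj delta = ?h'"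
        unfolding delta_u_conj by (simp add: power2_eq_square mult_ac)
      have hG: "?h \<in> carrier G" using Suc.IH by (simp add: u_mem)
      have h'G: "?h' \<in> carrier G" unfolding h[symmetric] using hG by (simp add: G_mult G_adj delta_mem)
      have "?h' \<in> Q" unfolding h[symmetric] using Suc.IH Q_delta(2) by blast
      moreover have "delta ** ?h = ?h' ** delta"
        unfolding h[symmetric] using delta_mem by (simp add: adj_left flip: matrix_mul_assoc)
      then have "\<pi> delta (\<pi> ?h z) = \<pi> ?h' (\<pi> delta z)" for z
        using delta_mem hG h'G by (simp flip: rep_mult)
      ultimately show ?case using Suc.IH h'G by (simp add: u_mem)
    qed
    obtain k1 where k1: "avg A ((\<pi> delta ^^ k) z) = 0" if "k \<ge> k1" for k using step.IH by blast
    define k2 where "k2 = nat (max (- valE a) (- valE b))"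
    have inA: "u (unif ^ k * a) (unif ^ (2 * k) * b) \<in> A" if "k \<ge> k2" for k
    proof (rule u_mem_A)
      have v: "valE (unif ^ j) = int j" for j using emb_uniformizer by (simp add: valE_power)
      have "int k \<ge> - valE a" "int k \<ge> - valE b" using that by (auto simp: k2_def)
      then show "unif ^ k * a \<in> pE 0" "unif ^ (2 * k) * b \<in> pE (1 - int n)"
        using n by (cases "a = 0"; cases "b = 0"; auto simp: pE_iff valE_mult v)+
    qed (use conj_pow in auto)
    have "avg A ((\<pi> delta ^^ k) (sc c y + z)) = 0" if "k \<ge> max k1 k2" for k
      using that k1 conj_pow[of k] avg_rep[OF A_compact inA[of k], of "(\<pi> delta ^^ k) w"]
      by (simp add: y pow_add pow_scale pow_diff avg_add[OF A_compact] avg_scale[OF A_compact] avg_diff[OF A_compact])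
    then show ?case by blast
  qed
  then obtain k where "avg A ((\<pi> delta ^^ k) x) = 0" by blast
  moreover have "delta = swap (int n - 1) ** swap (int n)" by (simp add: swap_product)
  ultimately show ?thesis
    using chain_injective[OF L_compact A_compact A_subset_L swap_mem swap_mem _ _ _ _ B_subset_L B_delta
        L_decomposition A_delta x]
      reflection_pred_injective[OF _ _ noZ] reflection_n_injective compose_reflections
    by blast
qed

end

section \<open>Twisted coinvariants\<close>

lemma separating_functional:
  fixes sc :: "complex \<Rightarrow> 'v::ab_group_add \<Rightarrow> 'v"
  assumes "vector_space sc" and z: "z \<notin> module.span sc S"
  obtains l where "Vector_Spaces.linear sc (*) l" "l z \<noteq> 0" "\<And>s. s \<in> S \<Longrightarrow> l s = 0"
proof -
  interpret V: vector_space sc by fact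
  interpret VC: vector_space_pair sc "(*) :: complex \<Rightarrow> complex \<Rightarrow> complex"
    by (intro vector_space_pair.intro assms(1)) (unfold_locales, simp_all add: algebra_simps)
  obtain B where B: "B \<subseteq> V.span S" "V.independent B" "V.span S \<subseteq> V.span B"
    using V.basis_exists[of "V.span S"] by metis
  have "z \<notin> V.span B" using z B(1) V.span_minimal[OF B(1)] V.subspace_span by blast
  then have ind: "V.independent (insert z B)" using B(2) by (simp add: V.independent_insert)
  have zB: "z \<notin> B" using \<open>z \<notin> V.span B\<close> V.span_base by blast
  obtain l where l: "Vector_Spaces.linear sc (*) l" "\<forall>x\<in>insert z B. l x = (if x = z then 1 else 0)"
    using VC.linear_independent_extend[OF ind, of "\<lambda>x. if x = z then 1 else 0"] by blast
  interpret l: Vector_Spaces.linear sc "(*)" l by (rule l(1))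
  have "l s = 0" if "s \<in> V.span B" for s
    using that
  proof (induction rule: V.span_induct_alt)
    case (step c x y)
    then have "l x = 0" using l(2) zB by auto
    then show ?case using step by (simp add: l.add l.scale)
  qed (rule l.zero)
  then have "l s = 0" if "s \<in> S" for s using B(3) V.span_base[OF that] by blast
  then show ?thesis using that l by auto
qed

text \<open>Realizes the quotient by \<open>W\<close> as the range of \<open>p\<close> within the
  same space; \<open>p\<close> is a projection because \<open>x - p x\<close> lies in its
  kernel.\<close>

lemma projection_with_kernel:
  fixes sc :: "complex \<Rightarrow> 'v::ab_group_add \<Rightarrow> 'v"
  assumes "vector_space sc" and W: "module.subspace sc W"
  obtains p where "Vector_Spaces.linear sc sc p" "\<And>x. p x = 0 \<longleftrightarrow> x \<in> W" "\<And>x. x - p x \<in> W"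
proof -
  interpret V: vector_space sc by fact
  interpret VV: vector_space_pair sc sc by (intro vector_space_pair.intro assms(1))
  obtain B where B: "B \<subseteq> W" "V.independent B" "W \<subseteq> V.span B"
    using V.basis_exists[of W] by metis
  define C where "C = V.extend_basis B"
  have C: "B \<subseteq> C" "V.independent C" "V.span C = UNIV"
    using V.extend_basis_superset[OF B(2)] V.independent_extend_basis[OF B(2)] V.span_extend_basis[OF B(2)]
    by (simp_all add: C_def)
  obtain p where p: "Vector_Spaces.linear sc sc p" "\<forall>x\<in>C. p x = (if x \<in> B then 0 else x)"
    using VV.linear_independent_extend[OF C(2), of "\<lambda>x. if x \<in> B then 0 else x"] by blast
  interpret p: Vector_Spaces.linear sc sc p by (rule p(1))
  have zero: "p x = 0" if "x \<in> W" for x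
  proof -
    have "x \<in> V.span B" using B(3) that by blast
    then show ?thesis
    proof (induction rule: V.span_induct_alt)
      case (step c x y)
      then have "p x = 0" using p(2) C(1) by auto
      then show ?case using step by (simp add: p.add p.scale)
    qed (rule p.zero)
  qed
  have diff: "x - p x \<in> W" for x
  proof -
    have "x \<in> V.span C" using C(3) by simp
    then show ?thesis
    proof (induction rule: V.span_induct_alt)
      case base
      then show ?case using V.subspace_0[OF W] by (simp add: p.zero)
    next
      case (step c x y)
      have "x - p x \<in> W" using step(1) p(2) B(1) V.subspace_0[OF W] by auto
      then have "sc c (x - p x) + (y - p y) \<in> W"
        using step V.subspace_add[OF W] V.subspace_scale[OF W] by blast
      then show ?case by (simp add: p.add p.scale V.scale_right_diff_distrib algebra_simps)
    qed
  qed
  have "p x = 0 \<Longrightarrow> x \<in> W" for x using diff[of x] by simp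
  then show ?thesis using that p(1) zero diff by blast
qed

section \<open>Fourier analysis with the additive character\<close>

context unramified_quadratic begin

context
  fixes \<psi> assumes psi: "character_of_conductor_oE \<psi>"
begin

lemma psi_add: "\<psi> (x + y) = \<psi> x * \<psi> y"
  and psi_integral: "x \<in> pE 0 \<Longrightarrow> \<psi> x = 1"
  using psi by (simp_all add: character_of_conductor_oE_def oE_eq_pE)

lemma psi_zero: "\<psi> 0 = 1"
  by (rule psi_integral) simp

lemma psi_minus: "\<psi> x * \<psi> (- x) = 1"
  using psi_add[of x "- x"] psi_zero by simp

text \<open>As \<open>pE (- 1)\<close> is not contained in \<open>oE\<close>, the conductor
  condition provides \<open>t\<close> in it with \<open>\<psi> t \<noteq> 1\<close>; division by
  \<open>a\<close> moves \<open>t\<close> to the required scale.\<close>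

lemma psi_detects:
  assumes "a \<notin> pE m"
  obtains x where "x \<in> pE (- m)" "\<psi> (a * x) \<noteq> 1"
proof -
  have "fractional_ideal (pE (- 1))"
    unfolding fractional_ideal_def oE_eq_pE
  proof (intro conjI ballI exI)
    show "unif \<noteq> 0" by simp
    show "unif * x \<in> pE 0" if "x \<in> pE (- 1)" for x
      using that emb_uniformizer by (intro pE_mult[of unif 1 x "- 1"]) (auto simp: pE_iff)
    show "x * y \<in> pE (- 1)" if "x \<in> pE 0" "y \<in> pE (- 1)" for x y using that by (rule pE_mult) simp
  qed (auto intro: pE_add)
  moreover have "\<not> pE (- 1) \<subseteq> oE"
  proof
    assume "pE (- 1) \<subseteq> oE"
    then have "unif powi (- 1) \<in> pE 0" using unif_power_mem[of "- 1" "- 1"] by (auto simp: oE_eq_pE)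
    then show False using valE_uniformizer_power[of "- 1"] by (simp only: pE_iff) simp
  qed
  ultimately have "\<exists>t\<in>pE (- 1). \<psi> t \<noteq> 1" using psi unfolding character_of_conductor_oE_def by blast
  then obtain t where t: "t \<in> pE (- 1)" "\<psi> t \<noteq> 1" by blast
  have a: "a \<noteq> 0" "valE a < m" using assms by (auto simp: pE_iff)
  show ?thesis
  proof (rule that[of "t / a"])
    show "t / a \<in> pE (- m)" using t a by (intro pE_divide) auto
    show "\<psi> (a * (t / a)) \<noteq> 1" using t a by simp
  qed
qed

lemma sum_transversal_shift:
  assumes X: "transversal i j X" and ij: "i \<le> j" and x0: "x0 \<in> pE i"
    and F: "\<And>x t. x \<in> pE i \<Longrightarrow> t \<in> pE j \<Longrightarrow> F (x + t) = F x"
  shows "(\<Sum>x\<in>X. F (x0 + x)) = (\<Sum>x\<in>X. (F x :: 'b::comm_monoid_add))"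
proof -
  have Xi: "x \<in> pE i" if "x \<in> X" for x using X that by (auto simp: transversal_def)
  have "\<forall>x\<in>X. \<exists>y. y \<in> X \<and> x0 + x - y \<in> pE j" using X Xi x0 pE_add by (metis transversal_def)
  then obtain r where r: "\<And>x. x \<in> X \<Longrightarrow> r x \<in> X" "\<And>x. x \<in> X \<Longrightarrow> x0 + x - r x \<in> pE j" by metis
  have inj: "inj_on r X"
  proof (rule inj_onI)
    fix x y assume xy: "x \<in> X" "y \<in> X" "r x = r y"
    have "(x0 + x - r x) - (x0 + y - r y) \<in> pE j" using xy r by (intro pE_diff[of "x0 + x - r x"])
    then have "x - y \<in> pE j" using xy(3) by simp
    moreover have "x - x \<in> pE j" by simp
    ultimately show "x = y" using X Xi[OF xy(1)] xy(1,2) unfolding transversal_def by blast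
  qed
  have img: "r ` X = X" using X r(1) inj by (intro endo_inj_surj) (auto simp: transversal_def)
  have "(\<Sum>x\<in>X. F (x0 + x)) = (\<Sum>x\<in>X. F (r x))"
  proof (rule sum.cong)
    fix x assume x: "x \<in> X"
    have "F (r x + (x0 + x - r x)) = F (r x)" using r[OF x] Xi by (intro F) auto
    then show "F (x0 + x) = F (r x)" by simp
  qed simp
  also have "\<dots> = (\<Sum>x\<in>r ` X. F x)" by (simp add: sum.reindex[OF inj])
  finally show ?thesis by (simp add: img)
qed

text \<open>Orthogonality of characters: translating the summation variable by a suitable
  \<open>s\<close> multiplies the sum by \<open>\<psi> (b * s) \<noteq> 1\<close>.\<close>

lemma psi_sum_transversal:
  assumes X: "transversal i j X" and ij: "i \<le> j" and b: "b \<in> pE (- j)" "b \<notin> pE (- i)"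
  shows "(\<Sum>x\<in>X. \<psi> (b * x)) = 0"
proof -
  obtain s where s: "s \<in> pE i" "\<psi> (b * s) \<noteq> 1" using psi_detects[OF b(2)] by auto
  have "(\<Sum>x\<in>X. \<psi> (b * (s + x))) = (\<Sum>x\<in>X. \<psi> (b * x))"
  proof (rule sum_transversal_shift[OF X ij s(1)])
    fix z t assume "t \<in> pE j"
    then have "b * t \<in> pE 0" using b(1) by (intro pE_mult) auto
    then show "\<psi> (b * (z + t)) = \<psi> (b * z)" by (simp add: ring_distribs psi_add psi_integral)
  qed
  then have "\<psi> (b * s) * (\<Sum>x\<in>X. \<psi> (b * x)) = (\<Sum>x\<in>X. \<psi> (b * x))"
    by (simp add: ring_distribs psi_add sum_distrib_left)
  then show ?thesis using s(2) by simp
qed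

context
  fixes sc :: "complex \<Rightarrow> 'v::ab_group_add \<Rightarrow> 'v" and R :: "'e \<Rightarrow> 'v \<Rightarrow> 'v"
  assumes vs: "vector_space sc"
    and R_linear: "\<And>x. Vector_Spaces.linear sc sc (R x)"
    and R_add: "\<And>x y w. R (x + y) w = R x (R y w)"
    and R_smooth: "\<And>w. \<exists>k. \<forall>x\<in>pE k. R x w = R 0 w"
begin

interpretation V: vector_space sc by (rule vs)

text \<open>\<open>R\<close> is meant for the action of \<open>U\<close> modulo its centre on a
  quotient realized by a projection, which is then \<open>R 0\<close>. The factor is inverted so
  that a vector is fixed by \<open>twist a x\<close> exactly if \<open>R x\<close> acts on it by
  \<open>\<psi> (a * x)\<close>.\<close>

definition twist :: "'e \<Rightarrow> 'e \<Rightarrow> 'v \<Rightarrow> 'v" where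
  "twist a x w = sc (\<psi> (- (a * x))) (R x w)"

definition twists :: "'e \<Rightarrow> int \<Rightarrow> ('v \<Rightarrow> 'v) set" where
  "twists a m = twist a ` pE (- m)"

lemma R_scale: "R x (sc c w) = sc c (R x w)"
  using R_linear[of x] by (simp add: Vector_Spaces.linear_iff)

lemma R_sum: "R x (\<Sum>i\<in>I. f i) = (\<Sum>i\<in>I. R x (f i))"
proof -
  interpret R: Vector_Spaces.linear sc sc "R x" by (rule R_linear)
  show ?thesis by (rule R.sum)
qed

lemma twist_twist: "twist a x (twist a y w) = twist a (x + y) w"
  using psi_add[of "- (a * x)" "- (a * y)"] by (simp add: twist_def R_scale R_add ring_distribs)

lemma twist_linear: "Vector_Spaces.linear sc sc (twist a x)"
  using R_linear[of x] V.vector_space_axioms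
  by (simp add: Vector_Spaces.linear_iff twist_def V.scale_right_distrib mult.commute)

lemma twists_group: "linear_group sc (twists a m)"
proof (intro linear_group.intro linear_group_axioms.intro vs)
  show "twists a m \<noteq> {}" using pE_zero[of "- m"] by (auto simp: twists_def simp del: pE_zero)
  show "f \<in> twists a m \<Longrightarrow> Vector_Spaces.linear sc sc f" for f using twist_linear by (auto simp: twists_def)
  have comp: "twist a x \<circ> twist a y = twist a (x + y)" for x y by (simp add: fun_eq_iff twist_twist)
  have *: "(\<lambda>y. twist a (x + y)) ` pE (- m) = twist a ` pE (- m)" if "x \<in> pE (- m)" for x
  proof (intro equalityI subsetI)
    fix f assume "f \<in> (\<lambda>y. twist a (x + y)) ` pE (- m)"
    then show "f \<in> twist a ` pE (- m)" using pE_add[OF that] by blast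
  next
    fix f assume "f \<in> twist a ` pE (- m)"
    then obtain y where y: "y \<in> pE (- m)" "f = twist a y" by blast
    then have "f = twist a (x + (y - x))" "y - x \<in> pE (- m)" using that by (auto intro: pE_diff)
    then show "f \<in> (\<lambda>y. twist a (x + y)) ` pE (- m)" by blast
  qed
  show "(\<lambda>g. f \<circ> g) ` twists a m = twists a m" if f: "f \<in> twists a m" for f
  proof -
    obtain x where x: "x \<in> pE (- m)" "f = twist a x" using f by (auto simp: twists_def)
    show ?thesis using *[OF x(1)] by (simp only: twists_def image_image x(2) comp)
  qed
  show "(\<lambda>g. g \<circ> f) ` twists a m = twists a m" if f: "f \<in> twists a m" for f
  proof -
    obtain x where x: "x \<in> pE (- m)" "f = twist a x" using f by (auto simp: twists_def)
    have "twist a y \<circ> f = twist a (x + y)" for y using comp[of y x] by (simp add: x add.commute)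
    then show ?thesis using *[OF x(1)] by (simp only: twists_def image_image)
  qed
qed

lemma twists_finite_orbit: "finite (orbit (twists a m) w)"
proof -
  obtain k where k: "\<And>x. x \<in> pE k \<Longrightarrow> R x w = R 0 w" using R_smooth by blast
  define j where "j = max (max k (- valE a)) (- m)"
  have j: "twist a (x + t) w = twist a x w" if "t \<in> pE j" for x t
  proof -
    have "t \<in> pE k" using that by (rule pE_mono) (simp add: j_def)
    from k[OF this] have "R (x + t) w = R x (R 0 w)" by (simp add: R_add)
    then have "R (x + t) w = R x w" using R_add[of x 0 w] by simp
    moreover have "0 \<le> valE a + j" by (simp add: j_def)
    then have "a * t \<in> pE 0" using that by (intro pE_mult[of a "valE a" t j]) (auto simp: pE_iff[of a])
    then have "\<psi> (- (a * (x + t))) = \<psi> (- (a * x))"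
      using psi_add[of "- (a * x)" "- (a * t)"] psi_integral[of "- (a * t)"] by (simp add: ring_distribs)
    ultimately show ?thesis by (simp add: twist_def)
  qed
  obtain C where C: "finite C" "\<And>z. z \<in> pE (- m) \<Longrightarrow> \<exists>c\<in>C. z - c \<in> pE j"
    using pE_cover[of "- m" j] by (auto simp: j_def)
  have "orbit (twists a m) w \<subseteq> (\<lambda>c. twist a c w) ` C"
  proof
    fix y assume "y \<in> orbit (twists a m) w"
    then obtain z where z: "z \<in> pE (- m)" "y = twist a z w" by (auto simp: orbit_def twists_def)
    then obtain c where c: "c \<in> C" "z - c \<in> pE j" using C(2) by blast
    have "y = twist a c w" using j[OF c(2), of c] z by simp
    then show "y \<in> (\<lambda>c. twist a c w) ` C" using c by blast
  qed
  then show ?thesis using C(1) by (rule finite_subset[OF _ finite_imageI])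
qed

text \<open>On \<open>pE (- m)\<close> the frequency \<open>a\<close> matters only modulo
  \<open>pE m\<close>, so it can be refined one level at a time.\<close>

lemma twists_cong: "a - b \<in> pE m \<Longrightarrow> twists a m = twists b m"
proof -
  assume ab: "a - b \<in> pE m"
  have "twist a x = twist b x" if "x \<in> pE (- m)" for x
  proof -
    have "(b - a) * x \<in> pE 0"
      using pE_uminus[OF ab] that by (intro pE_mult[of _ m x "- m"]) auto
    then have "\<psi> ((b - a) * x) = 1" by (rule psi_integral)
    moreover have "\<psi> (- (a * x)) = \<psi> (- (b * x)) * \<psi> ((b - a) * x)"
      by (simp add: algebra_simps flip: psi_add)
    ultimately show ?thesis by (simp add: twist_def fun_eq_iff)
  qed
  then show ?thesis by (simp add: twists_def cong: image_cong)
qed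

lemma twists_mono: "m \<le> m' \<Longrightarrow> twists a m \<subseteq> twists a m'"
  unfolding twists_def by (intro image_mono subsetI) (rule pE_mono, auto)

text \<open>Fourier inversion on the finite group \<open>pE (- m - 1) / pE (- m)\<close>.\<close>

lemma extend_character:
  assumes "average sc (twists a m) w \<noteq> 0"
  shows "\<exists>b. b - a \<in> pE m \<and> average sc (twists b (m + 1)) w \<noteq> 0"
proof (rule ccontr)
  assume none: "\<not> ?thesis"
  interpret T: linear_group sc "twists a m" by (rule twists_group)
  define y where "y = average sc (twists a m) w"
  have y_fixed: "twist a x y = y" if "x \<in> pE (- m)" for x
    unfolding y_def by (rule T.apply_average) (use that twists_finite_orbit in \<open>auto simp: twists_def\<close>)
  obtain X where X: "transversal (- (m + 1)) (- m) X"
    using transversal_exists[of "- (m + 1)" "- m"] by auto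
  obtain Y where Y: "transversal m (m + 1) Y"
    using transversal_exists[of m "m + 1"] by auto
  \<comment> \<open>For each refined frequency \<open>a + r\<close> this sum is invariant at level
    \<open>m + 1\<close>, hence equal to its own average, which is a sum of averages assumed to
    vanish.\<close>
  have sum_zero: "(\<Sum>x\<in>X. twist (a + r) x y) = 0" if r: "r \<in> Y" for r
  proof -
    have rm: "r \<in> pE m" using Y r by (auto simp: transversal_def)
    interpret T': linear_group sc "twists (a + r) (m + 1)" by (rule twists_group)
    have tw: "twists a m = twists (a + r) m" by (rule twists_cong) (use rm in simp)
    have F: "twist (a + r) (x + t) y = twist (a + r) x y" if "t \<in> pE (- m)" for x t
    proof -
      have "r * t \<in> pE 0" using rm that by (intro pE_mult) auto
      then have "\<psi> (- (r * t)) = 1" by (intro psi_integral) simp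
      then have "twist (a + r) t y = twist a t y"
        using psi_add[of "- (a * t)" "- (r * t)"] by (simp add: twist_def ring_distribs)
      then show ?thesis using y_fixed[OF that] by (simp flip: twist_twist)
    qed
    have inv: "f (\<Sum>x\<in>X. twist (a + r) x y) = (\<Sum>x\<in>X. twist (a + r) x y)" if f: "f \<in> twists (a + r) (m + 1)" for f
    proof -
      obtain x0 where x0: "x0 \<in> pE (- (m + 1))" "f = twist (a + r) x0" using f unfolding twists_def by blast
      have "f (\<Sum>x\<in>X. twist (a + r) x y) = (\<Sum>x\<in>X. twist (a + r) (x0 + x) y)"
        by (simp add: x0 twist_def R_sum R_scale V.scale_sum_right R_add psi_add ring_distribs)
      also have "\<dots> = (\<Sum>x\<in>X. twist (a + r) x y)"
        by (rule sum_transversal_shift[OF X _ x0(1) F]) auto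
      finally show ?thesis .
    qed
    have "(\<Sum>x\<in>X. twist (a + r) x y) = average sc (twists (a + r) (m + 1)) (\<Sum>x\<in>X. twist (a + r) x y)"
      using T'.average_fixed inv by metis
    also have "\<dots> = (\<Sum>x\<in>X. average sc (twists (a + r) (m + 1)) (twist (a + r) x y))"
      using X T'.average_sum twists_finite_orbit unfolding transversal_def by blast
    also have "\<dots> = (\<Sum>x\<in>X. 0)"
    proof (rule sum.cong)
      fix x assume "x \<in> X"
      then have "twist (a + r) x \<in> twists (a + r) (m + 1)" using X by (auto simp: transversal_def twists_def)
      then have "average sc (twists (a + r) (m + 1)) (twist (a + r) x y) = average sc (twists (a + r) (m + 1)) y"
        by (rule T'.average_apply)
      also have "\<dots> = average sc (twists (a + r) (m + 1)) w"
        unfolding y_def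
        by (rule T'.average_average) (use twists_group twists_finite_orbit tw twists_mono[of m "m + 1"] in auto)
      also have "\<dots> = 0" using none rm by auto
      finally show "average sc (twists (a + r) (m + 1)) (twist (a + r) x y) = 0" .
    qed simp
    finally show ?thesis by simp
  qed
  \<comment> \<open>In the sum over all \<open>r\<close>, orthogonality leaves only the
    representative of \<open>pE (- m)\<close> in \<open>X\<close>, and \<open>y\<close> reappears
    with the factor \<open>card Y\<close>.\<close>
  define c where "c x = (\<Sum>r\<in>Y. \<psi> (- (r * x)))" for x
  have "0 = (\<Sum>r\<in>Y. \<Sum>x\<in>X. twist (a + r) x y)" using sum_zero by simp
  also have "\<dots> = (\<Sum>x\<in>X. \<Sum>r\<in>Y. twist (a + r) x y)" by (rule sum.swap)
  also have "\<dots> = (\<Sum>x\<in>X. sc (c x) (twist a x y))"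
  proof (rule sum.cong)
    fix x assume "x \<in> X"
    have "twist (a + r) x y = sc (\<psi> (- (r * x))) (twist a x y)" for r
      using psi_add[of "- (a * x)" "- (r * x)"] by (simp add: twist_def ring_distribs mult.commute)
    then show "(\<Sum>r\<in>Y. twist (a + r) x y) = sc (c x) (twist a x y)"
      by (simp add: c_def V.scale_sum_left)
  qed simp
  finally have total: "(\<Sum>x\<in>X. sc (c x) (twist a x y)) = 0" by simp
  have c0: "c x = 0" if x: "x \<in> X" "x \<notin> pE (- m)" for x
  proof -
    have "- x \<in> pE (- (m + 1))" using X x by (auto simp: transversal_def)
    moreover have "- x \<notin> pE (- m)" using x by simp
    moreover have "c x = (\<Sum>r\<in>Y. \<psi> (- x * r))" by (simp add: c_def mult.commute)
    ultimately show ?thesis using psi_sum_transversal[OF Y, of "- x"] by simp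
  qed
  obtain x1 where x1: "x1 \<in> X" "x1 \<in> pE (- m)" "\<And>x. x \<in> X \<Longrightarrow> x \<in> pE (- m) \<Longrightarrow> x = x1"
  proof -
    have "\<forall>z\<in>pE (- (m + 1)). \<exists>!x. x \<in> X \<and> z - x \<in> pE (- m)" using X by (simp add: transversal_def)
    from bspec[OF this pE_zero] have "\<exists>!x. x \<in> X \<and> 0 - x \<in> pE (- m)" .
    then obtain x where x: "x \<in> X \<and> 0 - x \<in> pE (- m)" "\<forall>x'. x' \<in> X \<and> 0 - x' \<in> pE (- m) \<longrightarrow> x' = x"
      by (elim ex1E) (rule that)
    show ?thesis
    proof (rule that[of x])
      show "x \<in> X" "x \<in> pE (- m)" using x(1) by simp_all
      show "x' = x" if "x' \<in> X" "x' \<in> pE (- m)" for x' using x(2) that by simp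
    qed
  qed
  have finX: "finite X" using X by (simp add: transversal_def)
  have "(\<Sum>x\<in>X - {x1}. sc (c x) (twist a x y)) = 0"
  proof (rule sum.neutral, rule ballI)
    fix x assume x: "x \<in> X - {x1}"
    then have "x \<notin> pE (- m)" using x1(3)[of x] by blast
    then show "sc (c x) (twist a x y) = 0" using c0[of x] x by simp
  qed
  then have "sc (c x1) (twist a x1 y) = 0" using total sum.remove[OF finX x1(1), of "\<lambda>x. sc (c x) (twist a x y)"] by simp
  moreover have "c x1 = of_nat (card Y)"
  proof -
    have "\<psi> (- (r * x1)) = 1" if "r \<in> Y" for r
      using that Y x1(2) by (intro psi_integral pE_uminus pE_mult[of r m x1 "- m"]) (auto simp: transversal_def)
    then show ?thesis by (simp add: c_def)
  qed
  moreover have "card Y \<noteq> 0" using Y pE_zero[of m] unfolding transversal_def by (metis card_0_eq empty_iff)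
  ultimately have "y = 0" using y_fixed[OF x1(2)] by simp
  then show False using assms by (simp add: y_def)
qed

text \<open>At a level where \<open>R\<close> moves \<open>w0\<close> no further than
  \<open>R 0\<close> does, the average is \<open>R 0 w0\<close> and hence non-zero. Refining the
  frequency keeps the averages non-zero, and completeness of \<open>E\<close> gives one
  \<open>a\<close> for all levels. Vectors in the span of the twisted relations are killed by
  averages of high level, so \<open>R 0 w0\<close> lies outside and a functional separates
  it.\<close>

lemma twisted_functional:
  assumes w0: "R 0 w0 \<noteq> 0"
  obtains a l where "Vector_Spaces.linear sc (*) l" "l (R 0 w0) \<noteq> 0"
    "\<And>x w. l (R x w) = \<psi> (a * x) * l (R 0 w)"
proof -
  have R0: "twist a 0 w = R 0 w" for a w by (simp add: twist_def psi_zero)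
  obtain k where k: "\<And>x. x \<in> pE k \<Longrightarrow> R x w0 = R 0 w0" using R_smooth by blast
  have start: "average sc (twists 0 (int 0 - k)) w0 \<noteq> 0"
  proof -
    interpret T: linear_group sc "twists 0 (int 0 - k)" by (rule twists_group)
    have "average sc (twists 0 (int 0 - k)) (twist 0 0 w0) = average sc (twists 0 (int 0 - k)) w0"
      by (rule T.average_apply) (simp add: twists_def)
    moreover have "average sc (twists 0 (int 0 - k)) (R 0 w0) = R 0 w0"
    proof (rule T.average_fixed)
      fix f assume "f \<in> twists 0 (int 0 - k)"
      then obtain x where x: "x \<in> pE k" "f = twist 0 x" by (auto simp: twists_def)
      then show "f (R 0 w0) = R 0 w0" using k[OF x(1)] R_add[of x 0 w0] by (simp add: twist_def psi_zero)
    qed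
    ultimately show ?thesis using w0 by (simp add: R0)
  qed
  have "\<exists>A. \<forall>n. average sc (twists (A n) (int n - k)) w0 \<noteq> 0 \<and> A (Suc n) - A n \<in> pE (int n - k)"
  proof (rule dependent_nat_choice)
    show "\<exists>a. average sc (twists a (int 0 - k)) w0 \<noteq> 0" using start by blast
    fix a n assume "average sc (twists a (int n - k)) w0 \<noteq> 0"
    then obtain b where "b - a \<in> pE (int n - k)" "average sc (twists b (int n - k + 1)) w0 \<noteq> 0"
      using extend_character by blast
    then show "\<exists>b. average sc (twists b (int (Suc n) - k)) w0 \<noteq> 0 \<and> b - a \<in> pE (int n - k)"
      by (intro exI[of _ b]) (simp add: algebra_simps)
  qed
  then obtain A where A: "\<And>n. average sc (twists (A n) (int n - k)) w0 \<noteq> 0"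
    "\<And>n. A (Suc n) - A n \<in> pE (int n + (- k))" by auto
  obtain a where a: "\<And>n. a - A n \<in> pE (int n + (- k))" using pE_complete[OF A(2)] by blast
  have nz: "average sc (twists a (int n - k)) w0 \<noteq> 0" for n
    using A(1)[of n] a[of n] twists_cong[of a "A n" "int n - k"] by simp
  define S where "S = {R x w - sc (\<psi> (a * x)) (R 0 w) | x w. True}"
  have "R 0 w0 \<notin> V.span S"
  proof
    assume "R 0 w0 \<in> V.span S"
    then have "\<exists>n0. \<forall>n\<ge>n0. average sc (twists a (int n - k)) (R 0 w0) = 0"
    proof (induction rule: V.span_induct_alt)
      case base
      show ?case using linear_group.average_zero[OF twists_group] by blast
    next
      case (step c y z)
      then obtain x w where y: "y = R x w - sc (\<psi> (a * x)) (R 0 w)" by (auto simp: S_def)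
      obtain n1 where n1: "\<And>n. n \<ge> n1 \<Longrightarrow> average sc (twists a (int n - k)) z = 0" using step.IH by blast
      have "average sc (twists a (int n - k)) (sc c y + z) = 0" if n: "n \<ge> max n1 (nat (k - valE x))" for n
      proof -
        interpret T: linear_group sc "twists a (int n - k)" by (rule twists_group)
        have "x \<in> pE (- (int n - k))" using n by (auto simp: pE_iff)
        then have "twist a x \<in> twists a (int n - k)" "twist a 0 \<in> twists a (int n - k)" by (auto simp: twists_def)
        then have e: "average sc (twists a (int n - k)) (twist a x w) = average sc (twists a (int n - k)) (twist a 0 w)"
          by (simp add: T.average_apply)
        have Rx: "R x w = sc (\<psi> (a * x)) (twist a x w)" using psi_minus[of "a * x"] by (simp add: twist_def)
        note fin = twists_finite_orbit
        have "average sc (twists a (int n - k)) y = 0"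
          unfolding y Rx T.average_diff[OF fin fin] T.average_scale e by (simp add: R0)
        then show ?thesis using n1[of n] n by (simp add: T.average_add[OF fin fin] T.average_scale)
      qed
      then show ?case by blast
    qed
    then obtain n where n: "average sc (twists a (int n - k)) (R 0 w0) = 0" by blast
    interpret T: linear_group sc "twists a (int n - k)" by (rule twists_group)
    have "average sc (twists a (int n - k)) (twist a 0 w0) = average sc (twists a (int n - k)) w0"
      by (rule T.average_apply) (simp add: twists_def)
    then show False using n nz[of n] by (simp add: R0)
  qed
  from separating_functional[OF vs this] obtain l where l: "Vector_Spaces.linear sc (*) l" "l (R 0 w0) \<noteq> 0"
    "\<And>s. s \<in> S \<Longrightarrow> l s = 0" by blast
  interpret l: Vector_Spaces.linear sc "(*)" l by (rule l(1))
  have "l (R x w) = \<psi> (a * x) * l (R 0 w)" for x w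
  proof -
    have "l (R x w - sc (\<psi> (a * x)) (R 0 w)) = 0" by (rule l(3)) (auto simp: S_def)
    then show ?thesis by (simp add: l.diff l.scale)
  qed
  then show ?thesis using that l(1,2) by blast
qed

end

end

end

section \<open>Coinvariants of the centre of \<open>U\<close> for non-generic
  representations\<close>

context smooth_representation begin

lemma u_zero: "u 0 0 = mat 1"
  by (simp add: u_eq mat1_eq conj_zero)

text \<open>A section of the projection from \<open>U\<close> to \<open>E\<close>. It is
  multiplicative only modulo the centre of \<open>U\<close>, so it acts additively only on the
  coinvariants of that centre.\<close>

definition u_half :: "'e \<Rightarrow> 'e ^ 3 ^ 3" where
  "u_half x = u x (- (x * \<sigma> x) / 2)"

lemma u_half_mem: "u_half x \<in> carrier G"
  unfolding u_half_def u_mem by (rule isotropic_half)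

lemma u_half_near_one: "x \<in> pE k \<Longrightarrow> 0 \<le> k \<Longrightarrow> u_half x \<in> near_one k"
proof -
  assume x: "x \<in> pE k" "0 \<le> k"
  have "- (x * \<sigma> x) / 2 \<in> pE k"
    using x by (intro pE_half pE_uminus pE_mult[of x k "\<sigma> x" k]) auto
  then have "\<forall>i j. u_half x $ i $ j - mat 1 $ i $ j \<in> pE k"
    using x unfolding forall_3 by (simp add: u_half_def u_eq mat1_eq)
  then show ?thesis using u_half_mem by (simp add: near_one_def)
qed

lemma u_decomposition:
  assumes "isotropic x y"
  obtains t where "u x y = u_half x ** u 0 t" "isotropic 0 t"
proof (rule that[of "y - (- (x * \<sigma> x) / 2)"])
  show "u x y = u_half x ** u 0 (y - (- (x * \<sigma> x) / 2))"
    by (simp add: u_half_def u_mult conj_zero)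
  show "isotropic 0 (y - (- (x * \<sigma> x) / 2))"
    using assms isotropic_half[of x] by (simp add: isotropic_def conj_simps conj_numeral algebra_simps)
qed

definition Z_kernel :: "'v set" where
  "Z_kernel = V.span {\<pi> g w - w | g w. g \<in> U \<inter> corner}"

lemma Z_kernel_mem:
  assumes "isotropic 0 t"
  shows "\<pi> (u 0 t) w - w \<in> Z_kernel"
proof -
  have "u 0 t \<in> U \<inter> corner" using assms u_corner(1) unfolding U_def isotropic_def by blast
  then show ?thesis unfolding Z_kernel_def by (intro V.span_base) blast
qed

lemma Z_kernel_invariant:
  assumes w: "w \<in> Z_kernel"
  shows "\<pi> (u_half x) w \<in> Z_kernel"
  using w unfolding Z_kernel_def
proof (induction rule: V.span_induct_alt)
  case base
  then show ?case by (simp add: rep_zero u_half_mem V.span_zero)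
next
  case (step c y z)
  obtain g w where y: "y = \<pi> g w - w" "g \<in> U \<inter> corner" using step.hyps by blast
  obtain a b where ab: "g = u a b" "isotropic a b" using y(2) by (auto simp: U_def isotropic_def)
  have a: "a = 0" using y(2) ab u_corner(2) by blast
  have gG: "g \<in> carrier G" using ab by (simp add: u_mem)
  have "u_half x ** g = g ** u_half x"
    by (simp add: ab a u_half_def u_mult conj_zero add.commute)
  then have "\<pi> (u_half x) y = \<pi> g (\<pi> (u_half x) w) - \<pi> (u_half x) w"
    using gG by (simp add: y rep_diff u_half_mem flip: rep_mult)
  then have "\<pi> (u_half x) y \<in> V.span {\<pi> g w - w | g w. g \<in> U \<inter> corner}"
    using y(2) by (intro V.span_base) blast
  then show ?case using step.IH
    by (simp add: rep_add rep_scale u_half_mem V.span_add V.span_scale)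
qed

text \<open>On the coinvariants of the centre \<open>U\<close> acts through \<open>E\<close>, so a
  vector outside \<open>Z_kernel\<close> yields a functional that transforms by
  \<open>\<psi> (a * x)\<close>. The frequency \<open>a = 0\<close> contradicts the vanishing
  Jacquet module; any other is conjugate under the torus to \<open>a = 1\<close> and contradicts
  non-genericity.\<close>

lemma nongeneric_supercuspidal:
  assumes psi: "character_of_conductor_oE \<psi>" and sup: "supercuspidal sc \<pi>" and ng: "\<not> generic \<psi> sc \<pi>"
  shows "x0 \<in> Z_kernel"
proof (rule ccontr)
  assume x0: "x0 \<notin> Z_kernel"
  have "V.subspace Z_kernel" unfolding Z_kernel_def by (rule V.subspace_span)
  from projection_with_kernel[OF V.vector_space_axioms this] obtain p
    where p: "Vector_Spaces.linear sc sc p" "\<And>x. p x = 0 \<longleftrightarrow> x \<in> Z_kernel" "\<And>x. x - p x \<in> Z_kernel"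
    by blast
  interpret p: Vector_Spaces.linear sc sc p by (rule p(1))
  have p_eq: "p a = p b" if "a - b \<in> Z_kernel" for a b
    using p(2)[of "a - b"] that by (simp add: p.diff)
  define R where "R x w = p (\<pi> (u_half x) w)" for x w
  have u_half_zero: "\<pi> (u_half 0) w = w" for w by (simp add: u_half_def u_zero)
  have R_u: "R x w = p (\<pi> (u x y) w)" if iso: "isotropic x y" for x y w
  proof -
    obtain t where t: "u x y = u_half x ** u 0 t" "isotropic 0 t" using u_decomposition[OF iso] by blast
    have tG: "u 0 t \<in> carrier G" using t by (simp add: u_mem)
    have "\<pi> (u x y) w - \<pi> (u_half x) w = \<pi> (u_half x) (\<pi> (u 0 t) w - w)"
      by (simp add: t(1) rep_mult u_half_mem tG rep_diff)
    also have "\<dots> \<in> Z_kernel" by (intro Z_kernel_invariant Z_kernel_mem t)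
    finally show ?thesis unfolding R_def by (rule p_eq[symmetric])
  qed
  have R_linear: "Vector_Spaces.linear sc sc (R x)" for x
    using V.vector_space_axioms unfolding Vector_Spaces.linear_iff R_def
    by (simp add: rep_add rep_scale u_half_mem p.add p.scale)
  have R_add: "R (x + y) w = R x (R y w)" for x y w
  proof -
    have e: "u_half x ** u_half y = u (x + y) (- (x * \<sigma> x) / 2 + - (y * \<sigma> y) / 2 - x * \<sigma> y)"
      by (simp add: u_half_def u_mult)
    have "isotropic (x + y) (- (x * \<sigma> x) / 2 + - (y * \<sigma> y) / 2 - x * \<sigma> y)"
      unfolding u_mem[symmetric] e[symmetric] by (simp add: G_mult u_half_mem)
    from R_u[OF this] have "R (x + y) w = p (\<pi> (u_half x) (\<pi> (u_half y) w))"
      unfolding e[symmetric] by (simp add: rep_mult u_half_mem)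
    also have "\<dots> = p (\<pi> (u_half x) (p (\<pi> (u_half y) w)))"
    proof (rule p_eq)
      show "\<pi> (u_half x) (\<pi> (u_half y) w) - \<pi> (u_half x) (p (\<pi> (u_half y) w)) \<in> Z_kernel"
        using Z_kernel_invariant[OF p(3)] by (simp add: rep_diff u_half_mem)
    qed
    finally show ?thesis by (simp add: R_def)
  qed
  have R_smooth: "\<exists>k. \<forall>x\<in>pE k. R x w = R 0 w" for w
  proof -
    obtain k where k: "k \<ge> 0" "\<And>g. g \<in> near_one k \<Longrightarrow> \<pi> g w = w" using smooth_near_one by metis
    then have "R x w = R 0 w" if "x \<in> pE k" for x
      using u_half_near_one[OF that k(1)] by (simp add: R_def u_half_zero)
    then show ?thesis by blast
  qed
  have "R 0 x0 \<noteq> 0" using x0 p(2) by (simp add: R_def u_half_zero)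
  from twisted_functional[OF psi V.vector_space_axioms R_linear R_add R_smooth this]
  obtain a l where l: "Vector_Spaces.linear sc (*) l" "l (R 0 x0) \<noteq> 0"
    "\<And>x w. l (R x w) = \<psi> (a * x) * l (R 0 w)" by metis
  interpret l: Vector_Spaces.linear sc "(*)" l by (rule l(1))
  define l' where "l' w = l (p w)" for w
  have l'_lin: "Vector_Spaces.linear sc (*) l'"
    using l(1) unfolding Vector_Spaces.linear_iff l'_def by (simp add: p.add p.scale)
  have l'_u: "l' (\<pi> (u x y) w) = \<psi> (a * x) * l' w" if "isotropic x y" for x y w
    using l(3)[of x w] R_u[OF that, of w] R_u[of 0 0 w]
    by (simp add: l'_def isotropic_def u_zero conj_zero)
  have l'_nz: "l' x0 \<noteq> 0" using l(2) by (simp add: l'_def R_def u_half_zero)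
  show False
  proof (cases "a = 0")
    case True
    interpret l': Vector_Spaces.linear sc "(*)" l' by (rule l'_lin)
    have "x0 \<in> V.span {\<pi> n x - x | n x. n \<in> U}" using supercuspidal_span[OF sup] by simp
    then have "l' x0 = 0"
    proof (induction rule: V.span_induct_alt)
      case (step c y z)
      then obtain x t w where "y = \<pi> (u x t) w - w" "isotropic x t" by (auto simp: U_def isotropic_def)
      then have "l' y = 0" using l'_u[of x t w] psi_zero[OF psi] True by (simp add: l'.diff)
      then show ?case using step by (simp add: l'.add l'.scale)
    qed (rule l'.zero)
    then show False using l'_nz by simp
  next
    case False
    \<comment> \<open>Conjugation by \<open>g\<close> divides the coordinate \<open>x\<close> by
      \<open>a\<close>, which turns the frequency \<open>a\<close> into \<open>1\<close>.\<close>
    define g where "g = torus (1 / a) 1"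
    have g: "g \<in> carrier G" unfolding g_def using False by (simp add: torus_mem conj_one)
    have gu: "g ** u x y = u (x / a) (y / (a * \<sigma> a)) ** g" for x y
      using False by (simp add: g_def torus_def u_eq mat3_mult conj_simps)
    define l'' where "l'' w = l' (\<pi> g w)" for w
    have "Vector_Spaces.linear sc (*) l''"
      using l'_lin unfolding Vector_Spaces.linear_iff l''_def by (simp add: rep_add rep_scale g)
    moreover have "l'' (\<pi> (adj g) x0) \<noteq> 0" using l'_nz by (simp add: l''_def rep_adj' g)
    moreover have "l'' (\<pi> (u x y) w) = \<psi> x * l'' w" if "isotropic x y" for x y w
    proof -
      have uG: "u x y \<in> carrier G" using that by (simp add: u_mem)
      have iso': "isotropic (x / a) (y / (a * \<sigma> a))"
      proof -
        have "y / (a * \<sigma> a) + \<sigma> (y / (a * \<sigma> a)) + x / a * \<sigma> (x / a) = (y + \<sigma> y + x * \<sigma> x) / (a * \<sigma> a)"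
          by (simp add: conj_simps add_divide_distrib mult.commute)
        then show ?thesis using that by (simp add: isotropic_def)
      qed
      have "\<pi> g (\<pi> (u x y) w) = \<pi> (u (x / a) (y / (a * \<sigma> a))) (\<pi> g w)"
        using rep_mult[OF g uG] rep_mult[OF _ g] iso' by (simp add: gu u_mem)
      then show ?thesis using l'_u[OF iso', of "\<pi> g w"] False by (simp add: l''_def)
    qed
    ultimately have "generic \<psi> sc \<pi>" unfolding generic_def isotropic_def[symmetric] by blast
    then show False using ng by blast
  qed
qed

lemma nongeneric_no_fixed_vectors:
  assumes psi: "character_of_conductor_oE \<psi>" and sup: "supercuspidal sc \<pi>" and ng: "\<not> generic \<psi> sc \<pi>"
  shows "fixed_vectors \<pi> (K n) = {0}"
proof -
  have G0: "\<pi> g 0 = 0" if "g \<in> K n" for g using that by (intro rep_zero) (simp add: K_def)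
  have "x = 0" if x: "x \<in> fixed_vectors \<pi> (K n)" for x
  proof -
    \<comment> \<open>Levels start at \<open>1\<close>; the group \<open>K 0\<close> is reached
      through its subgroup \<open>parahoric 1 0\<close>.\<close>
    define m where "m = max 1 n"
    interpret level_structure v \<omega> \<iota> \<sigma> sc \<pi> m corner
      by unfold_locales (simp_all add: m_def)
    have "parahoric m (int m - 1) \<subseteq> K n"
    proof (cases "n = 0")
      case True
      then show ?thesis using parahoric_1_subset_K_0 by (simp add: m_def)
    next
      case False
      then have "m = n" by (simp add: m_def)
      then show ?thesis using parahoric_mono[of "int n - 1" "int n" n] K_eq[of n] False by simp
    qed
    then have "L \<subseteq> K n" by (auto simp: L_def)
    then have "fixed_by L x" using x by (auto simp: fixed_by_def fixed_vectors_def)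
    moreover have "x \<in> V.span {\<pi> g w - w | g w. g \<in> U \<inter> corner}"
      using nongeneric_supercuspidal[OF psi sup ng] by (simp add: Z_kernel_def)
    \<comment> \<open>This makes the condition on central elements in
      \<open>fixed_vector_vanishes\<close> vacuous.\<close>
    moreover have "corner \<noteq> carrier G"
    proof
      assume "corner = carrier G"
      then have "u 1 (- (1 * \<sigma> 1) / 2) \<in> corner" using isotropic_half[of 1] u_mem by blast
      then show False using u_corner(2) by fastforce
    qed
    ultimately show ?thesis using fixed_vector_vanishes by blast
  qed
  moreover have "0 \<in> fixed_vectors \<pi> (K n)" using G0 by (simp add: fixed_vectors_def)
  ultimately show ?thesis by blast
qed

end

section \<open>Fixed vectors of generic representations\<close>

context smooth_representation begin

definition coset :: "('e ^ 3 ^ 3) set \<Rightarrow> 'e ^ 3 ^ 3 \<Rightarrow> ('e ^ 3 ^ 3) set" where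
  "coset P g = (\<lambda>p. g ** p) ` P"

text \<open>The chosen representative is immaterial for vectors fixed by \<open>P\<close>, by
  \<open>coset_vector_coset\<close>.\<close>

definition coset_vector :: "'v \<Rightarrow> ('e ^ 3 ^ 3) set \<Rightarrow> 'v" where
  "coset_vector x C = \<pi> (SOME g. g \<in> C) x"

context
  fixes P x assumes P: "compact_subgroup P" and x: "fixed_by P x"
begin

lemma coset_vector_coset:
  assumes g: "g \<in> carrier G"
  shows "coset_vector x (coset P g) = \<pi> g x"
proof -
  have "g \<in> coset P g" unfolding coset_def
    using compact_subgroupD(2)[OF P] by (intro image_eqI[of _ _ "mat 1"]) simp_all
  then have "(SOME h. h \<in> coset P g) \<in> coset P g" by (rule someI)
  then obtain p where p: "p \<in> P" "(SOME h. h \<in> coset P g) = g ** p" by (auto simp: coset_def)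
  then show ?thesis
    using g x compact_subgroupD(1)[OF P] by (simp add: coset_vector_def rep_mult fixed_by_def)
qed

lemma coset_eq_iff:
  assumes g: "g \<in> carrier G" and h: "h \<in> carrier G"
  shows "coset P g = coset P h \<longleftrightarrow> adj h ** g \<in> P"
proof
  note D = compact_subgroupD[OF P]
  assume "coset P g = coset P h"
  moreover have "g \<in> coset P g" unfolding coset_def
    using D(2) by (intro image_eqI[of _ _ "mat 1"]) simp_all
  ultimately obtain p where "p \<in> P" "g = h ** p" by (auto simp: coset_def)
  then show "adj h ** g \<in> P" using h by (simp add: adj_cancel)
next
  note D = compact_subgroupD[OF P]
  assume a: "adj h ** g \<in> P"
  have 1: "g ** p = h ** ((adj h ** g) ** p)" for p
    using h by (simp add: adj_cancel' flip: matrix_mul_assoc)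
  have 2: "h ** p = g ** (adj (adj h ** g) ** p)" for p
    using g by (simp add: adj_mult adj_adj adj_cancel' flip: matrix_mul_assoc)
  have "g ** p \<in> coset P h" if "p \<in> P" for p
    unfolding coset_def using 1 D(3)[OF a that] by blast
  moreover have "h ** p \<in> coset P g" if "p \<in> P" for p
    unfolding coset_def using 2 D(3)[OF D(4)[OF a] that] by blast
  ultimately show "coset P g = coset P h" by (auto simp: coset_def[of P g] coset_def[of P h])
qed

lemma sum_translate_cosets:
  assumes X: "X \<subseteq> carrier G" and s: "s \<in> carrier G"
  shows "(\<Sum>C\<in>coset P ` (\<lambda>g. s ** g) ` X. coset_vector x C) = \<pi> s (\<Sum>C\<in>coset P ` X. coset_vector x C)"
proof -
  let ?t = "\<lambda>C. (\<lambda>h. s ** h) ` C"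
  have t: "coset P (s ** g) = ?t (coset P g)" for g by (simp add: coset_def image_image matrix_mul_assoc)
  have "inj_on ?t (coset P ` X)"
  proof (rule inj_on_inverseI)
    show "(\<lambda>h. adj s ** h) ` ?t C = C" for C using s by (simp add: image_image adj_cancel)
  qed
  moreover have "coset P ` (\<lambda>g. s ** g) ` X = ?t ` coset P ` X" by (simp add: image_image t)
  ultimately have "(\<Sum>C\<in>coset P ` (\<lambda>g. s ** g) ` X. coset_vector x C) = (\<Sum>C\<in>coset P ` X. coset_vector x (?t C))"
    by (simp add: sum.reindex)
  also have "\<dots> = (\<Sum>C\<in>coset P ` X. \<pi> s (coset_vector x C))"
  proof (rule sum.cong)
    fix C assume "C \<in> coset P ` X"
    then obtain g where "g \<in> carrier G" "C = coset P g" using X by auto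
    then show "coset_vector x (?t C) = \<pi> s (coset_vector x C)"
      using s by (simp add: coset_vector_coset G_mult rep_mult flip: t)
  qed simp
  finally show ?thesis by (simp add: rep_sum[OF s])
qed

lemma sum_cosets_invariant:
  assumes S: "compact_subgroup S" and s: "s \<in> S"
  shows "\<pi> s (\<Sum>C\<in>coset P ` S. coset_vector x C) = (\<Sum>C\<in>coset P ` S. coset_vector x C)"
proof -
  note D = compact_subgroupD[OF S]
  have "g \<in> (\<lambda>g. s ** g) ` S" if "g \<in> S" for g
    using that s D by (intro image_eqI[of _ _ "adj s ** g"]) (simp_all add: adj_cancel')
  then have "(\<lambda>g. s ** g) ` S = S" using D(3)[OF s] by blast
  then show ?thesis using sum_translate_cosets[of S s] D s by (simp add: subset_iff)
qed

text \<open>The sum is invariant under \<open>S\<close>, hence equal to its own average, and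
  averaging turns each summand into \<open>avg S x\<close>.\<close>

lemma sum_cosets_eq_avg:
  assumes S: "compact_subgroup S" and fin: "finite (coset P ` S)"
  shows "(\<Sum>C\<in>coset P ` S. coset_vector x C) = sc (of_nat (card (coset P ` S))) (avg S x)"
proof -
  have "(\<Sum>C\<in>coset P ` S. coset_vector x C) = avg S (\<Sum>C\<in>coset P ` S. coset_vector x C)"
    using avg_fixed[OF S] sum_cosets_invariant[OF S] by metis
  also have "\<dots> = (\<Sum>C\<in>coset P ` S. avg S (coset_vector x C))" by (rule avg_sum[OF S fin])
  also have "\<dots> = (\<Sum>C\<in>coset P ` S. avg S x)"
  proof (rule sum.cong)
    fix C assume "C \<in> coset P ` S"
    then obtain g where "g \<in> S" "C = coset P g" by blast
    then show "avg S (coset_vector x C) = avg S x"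
      using compact_subgroupD(1)[OF S] by (simp add: coset_vector_coset avg_rep[OF S])
  qed simp
  finally show ?thesis by (simp add: V.sum_constant_scale)
qed

end

lemma near_one_mono: "i \<le> j \<Longrightarrow> near_one j \<subseteq> near_one i"
  by (auto simp: near_one_def intro: pE_mono[where i = j])

lemma near_one_parahoric: "near_one (int n) \<subseteq> parahoric n 0"
proof
  fix g assume g: "g \<in> near_one (int n)"
  then have e: "\<And>i j. g$i$j - mat 1$i$j \<in> pE (int n)" and gG: "g \<in> carrier G" by (auto simp: near_one_def)
  have z: "a \<in> pE 0" if "a \<in> pE (int n)" for a using that by (rule pE_mono) simp
  have o: "a \<in> pE 0" if "a - 1 \<in> pE (int n)" for a using pE_add[OF z[OF that], of 1] by simp
  show "g \<in> parahoric n 0"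
    using e[of 1 1] e[of 1 2] e[of 1 3] e[of 2 1] e[of 2 2] e[of 2 3] e[of 3 1] e[of 3 2] e[of 3 3] gG
    by (simp add: parahoric_def mat1_eq z o)
qed

lemma finite_cosets:
  assumes "n \<ge> 1" and S: "compact_subgroup S"
  shows "finite (coset (parahoric n 0) ` S)"
proof -
  have P: "compact_subgroup (parahoric n 0)" using assms(1) by (intro parahoric_compact) auto
  obtain m where m: "\<And>g i j. g \<in> S \<Longrightarrow> g$i$j \<in> pE (- m)" using S unfolding compact_subgroup_def by blast
  note D = compact_subgroupD[OF S]
  have fx: "fixed_by (parahoric n 0) 0"
    using compact_subgroupD(1)[OF P] by (auto simp: fixed_by_def rep_zero)
  show ?thesis
  proof (rule finite_congruence_classes[of S m "int n"])
    show "S \<subseteq> carrier G" using D(1) by blast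
    fix g h assume "g \<in> S" "h \<in> S" "adj h ** g \<in> near_one (int n)"
    then show "coset (parahoric n 0) g = coset (parahoric n 0) h"
      using coset_eq_iff[OF P fx] D(1) near_one_parahoric by blast
  qed (rule m)
qed

section \<open>Decomposing the larger parahoric subgroup into cosets\<close>

definition Z_up :: "nat \<Rightarrow> ('e ^ 3 ^ 3) set" where
  "Z_up k = upper 0 (- int k) \<inter> corner"

lemma Z_up_compact: "compact_subgroup (Z_up k)"
  unfolding Z_up_def by (intro compact_subgroup_corner upper_compact) simp

lemma Z_up_iff: "g \<in> Z_up k \<longleftrightarrow> (\<exists>y. g = u 0 y \<and> y \<in> pE (- int k) \<and> isotropic 0 y)"
  using u_corner by (fastforce simp: Z_up_def upper_def)

lemma Z_up_parahoric: "k \<le> n \<Longrightarrow> Z_up k \<subseteq> parahoric n (int n)"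
proof
  fix g assume "k \<le> n" "g \<in> Z_up k"
  then obtain y where y: "g = u 0 y" "y \<in> pE (- int n)" "isotropic 0 y"
    using pE_mono[of _ "- int k" "- int n"] by (auto simp: Z_up_iff)
  then have "g \<in> carrier G" by (simp add: u_mem)
  then show "g \<in> parahoric n (int n)" using y by (simp add: parahoric_def) (simp add: u_eq conj_zero)
qed

text \<open>As in \<open>L_decomposition_low\<close>, only the skew part of
  \<open>g$1$3 / g$3$3\<close> can be removed by the centre of \<open>U\<close>; its trace is
  integral by \<open>column3\<close>.\<close>

lemma parahoric_reduce:
  assumes g: "g \<in> parahoric n (int n)" and n: "n \<ge> 1"
    and unit: "g$3$3 \<noteq> 0" "valE (g$3$3) = 0" and k: "g$1$3 \<in> pE (- int k)" "k \<le> n"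
  shows "\<exists>z\<in>Z_up k. adj z ** g \<in> parahoric n 0"
proof -
  note g' = g[unfolded parahoric_def mem_Collect_eq]
  define z where "z = g$1$3 / g$3$3"
  define y where "y = (z - \<sigma> z) / 2"
  have "z \<in> pE (- int k)" unfolding z_def using k unit by (intro pE_divide) auto
  then have y: "y \<in> pE (- int k)" unfolding y_def by (intro pE_half pE_diff) auto
  have iso: "isotropic 0 y" by (simp add: isotropic_def y_def conj_simps conj_numeral field_simps)
  have yZ: "u 0 y \<in> Z_up k" using y iso by (auto simp: Z_up_iff)
  have K: "compact_subgroup (parahoric n (int n))" using n by (intro parahoric_compact) auto
  have h: "adj (u 0 y) ** g \<in> parahoric n (int n)"
    using compact_subgroupD[OF K] Z_up_parahoric[OF k(2)] yZ g by blast
  have "z + \<sigma> z = - (\<sigma> (g$2$3) * g$2$3) / (\<sigma> (g$3$3) * g$3$3)"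
  proof -
    have "z + \<sigma> z = (\<sigma> (g$3$3) * g$1$3 + \<sigma> (g$1$3) * g$3$3) / (\<sigma> (g$3$3) * g$3$3)"
      using unit by (simp add: z_def conj_simps field_simps)
    moreover have "\<sigma> (g$3$3) * g$1$3 + \<sigma> (g$1$3) * g$3$3 = - (\<sigma> (g$2$3) * g$2$3)"
      using column3[of g] g' by (simp add: algebra_simps eq_neg_iff_add_eq_0)
    ultimately show ?thesis by simp
  qed
  moreover have "- (\<sigma> (g$2$3) * g$2$3) / (\<sigma> (g$3$3) * g$3$3) \<in> pE 0"
    using g' unit by (intro pE_divide[of _ 0] pE_uminus pE_mult[of _ 0 _ 0])
      (auto simp: valE_mult valE_conj conj_eq_zero)
  ultimately have "(z + \<sigma> z) / 2 \<in> pE 0" using pE_half by metis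
  then have "(z + \<sigma> z) / 2 * g$3$3 \<in> pE 0" using g' by (intro pE_mult[of _ 0 _ 0]) auto
  moreover have "(z + \<sigma> z) / 2 * g$3$3 = g$1$3 - y * g$3$3"
    using unit by (simp add: y_def z_def field_simps)
  moreover have "\<sigma> y = - y" using iso by (simp add: isotropic_def add_eq_0_iff)
  then have "(adj (u 0 y) ** g)$1$3 = g$1$3 - y * g$3$3"
    unfolding adj_u unfolding u_eq matrix_mult_nth3 by simp
  ultimately have "(adj (u 0 y) ** g)$1$3 \<in> pE 0" by (simp only:)
  then have "adj (u 0 y) ** g \<in> parahoric n 0" using h by (simp add: parahoric_def)
  then show ?thesis using yZ by blast
qed

lemma swap_parahoric: "n \<ge> 1 \<Longrightarrow> swap (int n) \<in> parahoric n (int n)"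
  using swap_mem[of "int n"] unif_power_mem[of "- int n" "- int n"]
  by (simp add: parahoric_def) (simp add: swap_def)

text \<open>The Bruhat decomposition of \<open>parahoric n n\<close> modulo \<open>parahoric n 0\<close>.\<close>

lemma parahoric_cosets:
  assumes n: "n \<ge> 1"
  defines "P \<equiv> parahoric n 0" and "s \<equiv> swap (int n)"
  shows "coset P ` parahoric n (int n) = coset P ` Z_up n \<union> coset P ` (\<lambda>g. s ** g) ` Z_up (n - 1)"
    and "coset P ` Z_up n \<inter> coset P ` (\<lambda>g. s ** g) ` Z_up (n - 1) = {}"
proof -
  have P: "compact_subgroup P" unfolding P_def using n by (intro parahoric_compact) auto
  have K: "compact_subgroup (parahoric n (int n))" using n by (intro parahoric_compact) auto
  note D = compact_subgroupD[OF K]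
  have fx: "fixed_by P 0" using compact_subgroupD(1)[OF P] by (auto simp: fixed_by_def rep_zero)
  have sK: "s \<in> parahoric n (int n)" unfolding s_def by (rule swap_parahoric[OF n])
  have ZK: "g \<in> Z_up n \<Longrightarrow> g \<in> parahoric n (int n)" "g \<in> Z_up (n - 1) \<Longrightarrow> g \<in> parahoric n (int n)" for g
    using Z_up_parahoric[of n n] Z_up_parahoric[of "n - 1" n] by auto
  have mem: "coset P g \<in> coset P ` Z_up n \<union> coset P ` (\<lambda>g. s ** g) ` Z_up (n - 1)"
    if g: "g \<in> parahoric n (int n)" for g
  proof (cases "g$3$3 \<in> pE 1")
    case False
    note g' = g[unfolded parahoric_def mem_Collect_eq]
    have "g$3$3 \<noteq> 0 \<and> valE (g$3$3) = 0" using g' False by (intro valE_eqI) auto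
    then obtain z where "z \<in> Z_up n" "adj z ** g \<in> P"
      unfolding P_def using parahoric_reduce[OF g n] g' by blast
    then have "coset P g = coset P z" using coset_eq_iff[OF P fx] ZK D(1) g by blast
    then show ?thesis using \<open>z \<in> Z_up n\<close> by blast
  next
    case True
    note g' = g[unfolded parahoric_def mem_Collect_eq]
    \<comment> \<open>As \<open>g$3$3\<close> is a non-unit, \<open>column13\<close> forces
      \<open>g$3$1\<close> and \<open>g$1$3\<close> to have opposite valuations, hence the extreme
      ones. Then \<open>s ** g\<close> has a unit in place \<open>(3, 3)\<close>, and its upper
      right entry gains one power, whence \<open>Z_up (n - 1)\<close>.\<close>
    have "\<sigma> (g$3$1) * g$1$3 - 1 = - (\<sigma> (g$1$1) * g$3$3 + \<sigma> (g$2$1) * g$2$3)"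
      using column13[of g] g' by (simp add: algebra_simps eq_neg_iff_add_eq_0)
    moreover have "\<sigma> (g$1$1) * g$3$3 + \<sigma> (g$2$1) * g$2$3 \<in> pE 1"
      using g' True n by (intro pE_add pE_mult[of _ 0 _ 1] pE_mult[of "\<sigma> (g$2$1)" "int n" _ 0]) auto
    ultimately have "\<sigma> (g$3$1) * g$1$3 - 1 \<in> pE 1" by (metis pE_uminus_iff)
    from valE_one_plus[OF this] have e: "g$3$1 \<noteq> 0" "g$1$3 \<noteq> 0" "valE (g$3$1) + valE (g$1$3) = 0"
      by (auto simp: conj_eq_zero valE_mult valE_conj)
    then have v13: "valE (g$1$3) = - int n" using g' by (auto simp: pE_iff)
    have h: "s ** g \<in> parahoric n (int n)" using D(3)[OF sK g] .
    have h33: "(s ** g)$3$3 = unif powi int n * g$1$3" and h13: "(s ** g)$1$3 = unif powi (- int n) * g$3$3"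
      by (simp_all add: s_def swap_def matrix_mult_nth3)
    have "(s ** g)$3$3 \<noteq> 0" "valE ((s ** g)$3$3) = 0"
      unfolding h33 using e v13 valE_mult[of "unif powi int n" "g$1$3"] valE_uniformizer_power[of "int n"]
      by (simp_all del: power_int_of_nat)
    moreover have "(s ** g)$1$3 \<in> pE (- int (n - 1))" unfolding h13
      using True n by (intro pE_mult[of _ "- int n" _ 1] unif_power_mem) (auto simp: of_nat_diff)
    ultimately obtain z where z: "z \<in> Z_up (n - 1)" "adj z ** (s ** g) \<in> P"
      unfolding P_def using parahoric_reduce[OF h n, of "n - 1"] by auto
    have "adj (s ** z) ** g = adj z ** (s ** g)"
      by (simp add: adj_mult matrix_mul_assoc s_def adj_swap)
    then have "coset P g = coset P (s ** z)"
      using coset_eq_iff[OF P fx, of g "s ** z"] z D(1) ZK sK g G_mult by auto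
    then show ?thesis using z(1) by blast
  qed
  show "coset P ` parahoric n (int n) = coset P ` Z_up n \<union> coset P ` (\<lambda>g. s ** g) ` Z_up (n - 1)"
  proof (rule equalityI)
    show "coset P ` parahoric n (int n) \<subseteq> coset P ` Z_up n \<union> coset P ` (\<lambda>g. s ** g) ` Z_up (n - 1)"
      using mem by blast
    show "coset P ` Z_up n \<union> coset P ` (\<lambda>g. s ** g) ` Z_up (n - 1) \<subseteq> coset P ` parahoric n (int n)"
      using ZK D(3)[OF sK] by auto
  qed
  show "coset P ` Z_up n \<inter> coset P ` (\<lambda>g. s ** g) ` Z_up (n - 1) = {}"
  proof (rule ccontr)
    assume "\<not> ?thesis"
    then obtain z z' where z: "z \<in> Z_up n" "z' \<in> Z_up (n - 1)" "coset P z = coset P (s ** z')"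
      by auto
    then have "adj z ** (s ** z') \<in> P"
      using coset_eq_iff[OF P fx, of "s ** z'" z] D(1) ZK sK G_mult by auto
    then have "(adj z ** (s ** z'))$3$3 \<noteq> 0 \<and> valE ((adj z ** (s ** z'))$3$3) = 0"
      unfolding P_def using n by (intro parahoric_units(2)) auto
    moreover obtain y y' where y: "z = u 0 y" "z' = u 0 y'" "y' \<in> pE (- int (n - 1))" using z by (auto simp: Z_up_iff)
    have "(adj z ** (s ** z'))$3$3 = unif powi int n * y'"
      unfolding y adj_u by (simp add: u_eq s_def swap_def mat3_mult)
    moreover have "unif powi int n * y' \<in> pE 1"
      using y n by (intro pE_mult[of _ "int n" _ "- int (n - 1)"] unif_power_mem) (auto simp: of_nat_diff)
    ultimately show False by (auto simp: pE_iff)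
  qed
qed

text \<open>The invariant sum over cosets, split along the two cells; \<open>a\<close> and
  \<open>b\<close> are the numbers of cosets in them.\<close>

lemma parahoric_sum_fixed:
  assumes n: "n \<ge> 1" and x: "fixed_by (parahoric n 0) x"
  obtains a b :: nat where "a \<noteq> 0" "b \<noteq> 0"
    "sc (of_nat a) (avg (Z_up n) x) + sc (of_nat b) (\<pi> (swap (int n)) (avg (Z_up (n - 1)) x))
      \<in> fixed_vectors \<pi> (parahoric n (int n))"
proof -
  let ?P = "parahoric n 0"
  have P: "compact_subgroup ?P" using n by (intro parahoric_compact) auto
  have K: "compact_subgroup (parahoric n (int n))" using n by (intro parahoric_compact) auto
  have fin: "finite (coset ?P ` S)" if "compact_subgroup S" for S by (rule finite_cosets[OF n that])
  note Zc = Z_up_compact[of n] Z_up_compact[of "n - 1"]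
  have ne: "card (coset ?P ` S) \<noteq> 0" if "compact_subgroup S" for S
    using fin[OF that] compact_subgroupD(2)[OF that] by auto
  have ZG: "Z_up (n - 1) \<subseteq> carrier G" using compact_subgroupD(1)[OF Zc(2)] by blast
  have "(\<Sum>C\<in>coset ?P ` parahoric n (int n). coset_vector x C)
      = (\<Sum>C\<in>coset ?P ` Z_up n. coset_vector x C)
        + (\<Sum>C\<in>coset ?P ` (\<lambda>g. swap (int n) ** g) ` Z_up (n - 1). coset_vector x C)"
    unfolding parahoric_cosets(1)[OF n]
  proof (rule sum.union_disjoint)
    show "finite (coset ?P ` Z_up n)" "finite (coset ?P ` (\<lambda>g. swap (int n) ** g) ` Z_up (n - 1))"
      using fin[OF K] unfolding parahoric_cosets(1)[OF n] by simp_all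
  qed (rule parahoric_cosets(2)[OF n])
  also have "\<dots> = sc (of_nat (card (coset ?P ` Z_up n))) (avg (Z_up n) x)
      + sc (of_nat (card (coset ?P ` Z_up (n - 1)))) (\<pi> (swap (int n)) (avg (Z_up (n - 1)) x))"
    unfolding sum_translate_cosets[OF P x ZG swap_mem] sum_cosets_eq_avg[OF P x Zc(1) fin[OF Zc(1)]]
      sum_cosets_eq_avg[OF P x Zc(2) fin[OF Zc(2)]] by (simp add: rep_scale swap_mem)
  finally have e: "(\<Sum>C\<in>coset ?P ` parahoric n (int n). coset_vector x C) = \<dots>" .
  show ?thesis
  proof (rule that[OF ne[OF Zc(1)] ne[OF Zc(2)]])
    show "sc (of_nat (card (coset ?P ` Z_up n))) (avg (Z_up n) x)
      + sc (of_nat (card (coset ?P ` Z_up (n - 1)))) (\<pi> (swap (int n)) (avg (Z_up (n - 1)) x))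
      \<in> fixed_vectors \<pi> (parahoric n (int n))"
      unfolding e[symmetric] fixed_vectors_def
      using sum_cosets_invariant[OF P x K] by blast
  qed
qed

text \<open>The danger is the average over the unit torus, which could annihilate \<open>l\<close>;
  the vector is prepared by a Fourier sum beforehand. Averaging over the integral part of
  \<open>U\<close> does not change \<open>l\<close>, since \<open>\<psi>\<close> is trivial there,
  and for large \<open>n\<close> smoothness takes care of the lower triangular part.\<close>

lemma generic_fixed_vector:
  assumes psi: "character_of_conductor_oE \<psi>"
    and l: "Vector_Spaces.linear sc (*) l" "\<And>x y w. isotropic x y \<Longrightarrow> l (\<pi> (u x y) w) = \<psi> x * l w"
    and nz: "l w0 \<noteq> 0"
  obtains x n0 where "l x \<noteq> 0" "n0 \<ge> 1" "\<And>n. n \<ge> n0 \<Longrightarrow> fixed_by (parahoric n 0) x"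
proof -
  interpret l: Vector_Spaces.linear sc "(*)" l by (rule l(1))
  obtain k where k: "k \<ge> 1" "\<And>g. g \<in> near_one k \<Longrightarrow> \<pi> g w0 = w0" using smooth_near_one by metis
  obtain X where X: "transversal (- k) 0 X" using transversal_exists[of "- k" 0] k(1) by auto
  have cardX: "card X \<noteq> 0"
  proof -
    have "\<forall>z\<in>pE (- k). \<exists>!x. x \<in> X \<and> z - x \<in> pE 0" "finite X" using X by (simp_all add: transversal_def)
    from bspec[OF this(1) pE_zero] this(2) show ?thesis by (auto simp: card_eq_0_iff)
  qed
  text \<open>\<open>x1\<close> cuts the Whittaker function \<open>a \<mapsto> l (\<pi> (torus a 1) w0)\<close> on the units down to \<open>1 + pE k\<close>.\<close>
  define x1 where "x1 = (\<Sum>x\<in>X. sc (\<psi> (- x)) (\<pi> (u_half x) w0))"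
  have torusG: "torus a 1 \<in> carrier G" if "a \<noteq> 0" for a using that by (simp add: torus_mem conj_one)
  have torus_u: "torus a 1 ** u x y = u (a * x) (a * \<sigma> a * y) ** torus a 1" if "a \<noteq> 0" for a x y
    using that by (simp add: torus_def u_eq mat3_mult conj_simps)
  have torus_iso: "isotropic (a * x) (a * \<sigma> a * y)" if "isotropic x y" for a x y
  proof -
    have "a * \<sigma> a * y + \<sigma> (a * \<sigma> a * y) + a * x * \<sigma> (a * x) = a * \<sigma> a * (y + \<sigma> y + x * \<sigma> x)"
      by (simp add: conj_simps algebra_simps)
    then show ?thesis using that by (simp add: isotropic_def)
  qed
  have l_torus_u: "l (\<pi> (torus a 1) (\<pi> (u x y) w)) = \<psi> (a * x) * l (\<pi> (torus a 1) w)"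
    if "a \<noteq> 0" "isotropic x y" for a x y w
  proof -
    have "\<pi> (torus a 1) (\<pi> (u x y) w) = \<pi> (u (a * x) (a * \<sigma> a * y)) (\<pi> (torus a 1) w)"
      using rep_mult[OF torusG[OF that(1)], of "u x y"] rep_mult[OF _ torusG[OF that(1)]] that
      by (simp add: torus_u torus_iso u_mem)
    then show ?thesis using l(2)[OF torus_iso[OF that(2)]] by simp
  qed
  define c where "c = of_nat (card X) * l w0"
  have c: "c \<noteq> 0" using cardX nz by (simp add: c_def)
  \<comment> \<open>The coefficient \<open>\<psi> (- x)\<close> combines with the action to
    \<open>\<psi> ((a - 1) * x)\<close>, whose sum over \<open>X\<close> vanishes unless
    \<open>a - 1 \<in> pE k\<close>; in that case \<open>torus a 1\<close> fixes
    \<open>w0\<close>.\<close>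
  have l_x1: "l (\<pi> (torus a 1) x1) = (if a - 1 \<in> pE k then c else 0)" if a: "a \<noteq> 0" "valE a = 0" for a
  proof -
    have "\<psi> (- x) * l (\<pi> (torus a 1) (\<pi> (u_half x) w0)) = \<psi> ((a - 1) * x) * l (\<pi> (torus a 1) w0)" for x
      unfolding u_half_def l_torus_u[OF a(1) isotropic_half]
      by (simp add: algebra_simps psi_add[OF psi, of "- x" "a * x", symmetric])
    then have "l (\<pi> (torus a 1) x1) = (\<Sum>x\<in>X. \<psi> ((a - 1) * x)) * l (\<pi> (torus a 1) w0)"
      using torusG[OF a(1)] by (simp add: x1_def rep_sum rep_scale l.sum l.scale sum_distrib_right)
    moreover have "(\<Sum>x\<in>X. \<psi> ((a - 1) * x)) = 0" if "a - 1 \<notin> pE k"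
    proof (rule psi_sum_transversal[OF psi X])
      show "a - 1 \<in> pE (- 0)" using a by (intro pE_diff) (auto simp: pE_iff valE_one)
    qed (use that k(1) in auto)
    moreover have "(\<Sum>x\<in>X. \<psi> ((a - 1) * x)) = of_nat (card X) \<and> l (\<pi> (torus a 1) w0) = l w0" if a1: "a - 1 \<in> pE k"
    proof
      have "\<psi> ((a - 1) * x) = 1" if "x \<in> X" for x
        using X that a1 by (intro psi_integral[OF psi] pE_mult[of _ k _ "- k"]) (auto simp: transversal_def)
      then show "(\<Sum>x\<in>X. \<psi> ((a - 1) * x)) = of_nat (card X)" by simp
      have "inverse (\<sigma> a) - 1 = - \<sigma> (a - 1) / \<sigma> a"
        using a by (simp add: conj_simps field_simps)
      also have "\<dots> \<in> pE k" using a a1 by (intro pE_divide[of _ k]) (auto simp: valE_conj conj_eq_zero)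
      finally have "\<forall>i j. torus a 1 $ i $ j - mat 1 $ i $ j \<in> pE k"
        using a1 unfolding forall_3 by (simp add: torus_def mat1_eq)
      then have "torus a 1 \<in> near_one k" using torusG[OF a(1)] by (simp add: near_one_def)
      then show "l (\<pi> (torus a 1) w0) = l w0" using k(2) by simp
    qed
    ultimately show ?thesis by (auto simp: c_def)
  qed
  define T where "T = {torus a 1 | a. a \<noteq> 0 \<and> valE a = 0}"
  have T: "compact_subgroup T"
    unfolding compact_subgroup_def
  proof (intro conjI ballI)
    show "T \<subseteq> carrier G" using torusG by (auto simp: T_def)
    show "mat 1 \<in> T" unfolding T_def
      by (intro CollectI exI[of _ 1]) (simp add: torus_def mat1_eq conj_one valE_one)
    show "g ** h \<in> T" if gh: "g \<in> T" "h \<in> T" for g h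
    proof -
      obtain a b where "g = torus a 1" "h = torus b 1" "a \<noteq> 0" "b \<noteq> 0" "valE a = 0" "valE b = 0"
        using gh by (auto simp: T_def)
      then have "g ** h = torus (a * b) 1" "a * b \<noteq> 0" "valE (a * b) = 0"
        by (simp_all add: torus_def mat3_mult conj_simps valE_mult)
      then show ?thesis unfolding T_def by blast
    qed
    show "adj g \<in> T" if g: "g \<in> T" for g
    proof -
      obtain a where "g = torus a 1" "a \<noteq> 0" "valE a = 0" using g by (auto simp: T_def)
      then have "adj g = torus (inverse a) 1" "inverse a \<noteq> 0" "valE (inverse a) = 0"
        by (simp_all add: torus_def adj_mat3 conj_simps valE_inverse)
      then show ?thesis unfolding T_def by blast
    qed
    have "g$i$j \<in> pE (- 0)" if "g \<in> T" for g i j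
      using that exhaust_3[of i] exhaust_3[of j] by (auto simp: T_def torus_def pE_iff valE_one valE_inverse valE_conj conj_eq_zero)
    then show "\<exists>m. \<forall>g\<in>T. \<forall>i j. g$i$j \<in> pE (- m)" by blast
  qed
  define x2 where "x2 = avg T x1"
  \<comment> \<open>Along the torus orbit \<open>l\<close> takes only the values \<open>c\<close>
    and \<open>0\<close>, with \<open>c\<close> at \<open>x1\<close> itself, so the terms cannot
    cancel.\<close>
  have l_x2: "l x2 \<noteq> 0"
  proof -
    let ?O = "(\<lambda>g. \<pi> g x1) ` T"
    have finO: "finite ?O" using finite_orbit[OF T] by (simp add: orbit_rep)
    have vals: "l y = c \<or> l y = 0" if y: "y \<in> ?O" for y
    proof -
      obtain a where "a \<noteq> 0" "valE a = 0" "y = \<pi> (torus a 1) x1" using y by (auto simp: T_def)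
      then show ?thesis using l_x1 by simp
    qed
    have "torus 1 1 = mat 1" by (simp add: torus_def mat1_eq conj_one)
    then have x1O: "x1 \<in> ?O" "l x1 = c"
      using compact_subgroupD(2)[OF T] l_x1[of 1] by (auto simp: valE_one intro: image_eqI[of _ _ "mat 1"])
    have "(\<Sum>y\<in>?O. l y) = (\<Sum>y\<in>?O. if l y = c then c else 0)"
      by (rule sum.cong) (use vals in auto)
    also have "\<dots> = of_nat (card {y \<in> ?O. l y = c}) * c"
      by (simp add: sum.If_cases[OF finO] Int_def)
    also have "\<dots> \<noteq> 0"
    proof -
      have "{y \<in> ?O. l y = c} \<noteq> {}" using x1O by blast
      moreover have "finite {y \<in> ?O. l y = c}" by (rule finite_subset[OF _ finO]) simp
      ultimately show ?thesis using c by simp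
    qed
    finally show ?thesis using card_orbit_nonzero[OF T, of x1]
      by (simp add: x2_def avg_def average_def orbit_rep l.scale l.sum)
  qed
  have U0: "compact_subgroup (upper 0 0)" by (rule upper_compact) simp
  define x where "x = avg (upper 0 0) x2"
  have "l x = l x2"
    unfolding x_def
  proof (rule avg_functional[OF U0 l(1)])
    fix g assume "g \<in> upper 0 0"
    then obtain a b where "g = u a b" "a \<in> pE 0" "isotropic a b" by (auto simp: upper_def)
    then show "l (\<pi> g x2) = l x2" using l(2) psi_integral[OF psi] by simp
  qed
  then have lx: "l x \<noteq> 0" using l_x2 by simp
  have x_U: "\<pi> g x = x" if "g \<in> upper 0 0" for g unfolding x_def using that by (rule rep_avg[OF U0])
  have x_T: "\<pi> t x = x" if t: "t \<in> T" for t
  proof -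
    obtain a where a: "a \<noteq> 0" "valE a = 0" "t = torus a 1" using t by (auto simp: T_def)
    have tG: "t \<in> carrier G" using a torusG by simp
    have sub: "t' ** g ** adj t' \<in> upper 0 0" if t': "t' \<in> T" and g: "g \<in> upper 0 0" for t' g
    proof -
      obtain b where b: "b \<noteq> 0" "valE b = 0" "t' = torus b 1" using t' by (auto simp: T_def)
      obtain p q where p: "g = u p q" "p \<in> pE 0" "q \<in> pE 0" "isotropic p q" using g by (auto simp: upper_def)
      have bm: "b \<in> pE 0" using b by (simp add: pE_iff)
      have "t' ** g ** adj t' = u (b * p) (b * \<sigma> b * q)"
        using torusG[OF b(1)] by (simp add: b(3) p(1) torus_u[OF b(1)] adj_right flip: matrix_mul_assoc)
      moreover have "b * p \<in> pE 0" "b * \<sigma> b * q \<in> pE 0"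
        using bm p by (auto intro!: pE_mult[of _ 0 _ 0])
      ultimately show ?thesis using torus_iso[OF p(4)] by (auto simp: upper_def)
    qed
    have "conjugate t (upper 0 0) = upper 0 0"
    proof (intro equalityI subsetI)
      show "g \<in> conjugate t (upper 0 0) \<Longrightarrow> g \<in> upper 0 0" for g using sub[OF t] by (auto simp: conjugate_def)
      fix g assume g: "g \<in> upper 0 0"
      have "adj t ** g ** t \<in> upper 0 0"
        using sub[OF compact_subgroupD(4)[OF T t] g] by (simp add: adj_adj)
      moreover have "g = t ** (adj t ** g ** t) ** adj t"
        using tG by (simp add: adj_cancel' adj_right flip: matrix_mul_assoc)
      ultimately show "g \<in> conjugate t (upper 0 0)" unfolding conjugate_def by blast
    qed
    then have "\<pi> t x = avg (upper 0 0) (\<pi> t x2)"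
      unfolding x_def using rep_avg_conjugate[of "upper 0 0" t] tG compact_subgroupD(1)[OF U0]
      by (simp add: subset_iff)
    then show ?thesis using rep_avg[OF T t] by (simp add: x2_def x_def)
  qed
  obtain n1 where n1: "n1 \<ge> 1" "\<And>g. g \<in> near_one n1 \<Longrightarrow> \<pi> g x = x" using smooth_near_one by metis
  show ?thesis
  proof (rule that[OF lx, of "nat n1"])
    show "nat n1 \<ge> 1" using n1(1) by simp
    fix n assume n: "nat n1 \<le> n"
    then have n1': "n1 \<le> int n" and n_pos: "n \<ge> 1" using n1(1) by auto
    have "\<pi> g x = x" if g: "g \<in> parahoric n 0" for g
    proof -
      note g' = g[unfolded parahoric_def mem_Collect_eq]
      have P: "compact_subgroup (parahoric n 0)" using n_pos by (intro parahoric_compact) auto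
      note D = compact_subgroupD[OF P]
      have u33: "g$3$3 \<noteq> 0" "valE (g$3$3) = 0" using parahoric_units(2)[OF g n_pos] n_pos by auto
      define p where "p = - \<sigma> (g$2$3 / g$3$3)"
      define q where "q = g$1$3 / g$3$3"
      define b where "b = adj (u p q) ** g"
      have iso: "isotropic p q" and z: "b$1$2 = 0" "b$1$3 = 0" "b$2$3 = 0"
        using upper_lower_decomposition[of g] g' u33 by (simp_all add: p_def q_def b_def)
      have "p \<in> pE 0" unfolding p_def pE_uminus_iff pE_conj using g' u33 by (intro pE_divide) auto
      moreover have "q \<in> pE 0" unfolding q_def using g' u33 by (intro pE_divide) auto
      ultimately have uU: "u p q \<in> upper 0 0" using iso by (auto simp: upper_def)
      have "u p q \<in> parahoric n 0"
      proof -
        have "u p q \<in> carrier G" using iso by (simp add: u_mem)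
        then show ?thesis using \<open>p \<in> pE 0\<close> \<open>q \<in> pE 0\<close> by (simp add: parahoric_def) (simp add: u_eq)
      qed
      then have bP: "b \<in> parahoric n 0" unfolding b_def using D g by blast
      note b' = bP[unfolded parahoric_def mem_Collect_eq]
      have b11: "b$1$1 \<noteq> 0" "valE (b$1$1) = 0" using parahoric_units(1)[OF bP n_pos] n_pos by auto
      define t where "t = torus (b$1$1) 1"
      have tT: "t \<in> T" using b11 by (auto simp: T_def t_def)
      have tG: "t \<in> carrier G" using torusG b11 by (simp add: t_def)
      define h where "h = adj t ** b"
      have hG: "h \<in> carrier G" unfolding h_def using tG b' by (simp add: G_mult G_adj)
      \<comment> \<open>For lower triangular \<open>b\<close> the relation \<open>column13\<close>
        reduces to the diagonal term. Dividing by \<open>torus (b$1$1) 1\<close> therefore makes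
        both outer diagonal entries \<open>1\<close> and puts \<open>h\<close> into
        \<open>near_one n\<close>.\<close>
      have "\<sigma> (b$1$1) * b$3$3 = 1" using column13[of b] b' z by simp
      then have h_eq: "h = mat3 1 0 0 (b$2$1) (b$2$2) 0 (\<sigma> (b$1$1) * b$3$1) (\<sigma> (b$1$1) * b$3$2) 1"
        using b11 z unfolding h_def t_def torus_def
        by (intro mat3_eqI) (simp_all add: matrix_mult_nth3 adj_mat3 conj_simps)
      have "\<sigma> (b$1$1) * b$3$1 \<in> pE (int n)" "\<sigma> (b$1$1) * b$3$2 \<in> pE (int n)"
        using b' by (auto intro!: pE_mult[of _ 0 _ "int n"])
      then have "\<forall>i j. h $ i $ j - mat 1 $ i $ j \<in> pE (int n)"
        using b' unfolding forall_3 h_eq mat1_eq by simp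
      then have "h \<in> near_one (int n)" using hG by (simp add: near_one_def)
      then have hx: "\<pi> h x = x" using n1(2) near_one_mono[OF n1'] by blast
      have "g = u p q ** (t ** h)"
        using iso tG by (simp add: h_def b_def adj_cancel' u_mem)
      then have "\<pi> g x = \<pi> (u p q) (\<pi> t (\<pi> h x))"
        using iso tG hG by (simp add: rep_mult G_mult u_mem)
      then show ?thesis by (simp add: hx x_T[OF tT] x_U[OF uU])
    qed
    then show "fixed_by (parahoric n 0) x" by (simp add: fixed_by_def)
  qed
qed

text \<open>If all sums over \<open>parahoric n n / parahoric n 0\<close> vanished, then two consecutive levels would express the
  \<open>Z_up\<close>-average of a vector \<open>x\<close> with \<open>l x \<noteq> 0\<close> through that of its translate by \<open>adj delta\<close>; but \<open>l\<close> vanishes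
  on this translate, because \<open>\<psi>\<close> is non-trivial on \<open>pE (- 1)\<close>.\<close>

theorem generic_has_fixed_vectors:
  assumes psi: "character_of_conductor_oE \<psi>" and gen: "generic \<psi> sc \<pi>"
  shows "\<exists>n. fixed_vectors \<pi> (K n) \<noteq> {0}"
proof (rule ccontr)
  assume none: "\<not> ?thesis"
  obtain l w0 where l: "Vector_Spaces.linear sc (*) l" "l w0 \<noteq> 0"
    "\<And>x y w. isotropic x y \<Longrightarrow> l (\<pi> (u x y) w) = \<psi> x * l w"
    using gen unfolding generic_def isotropic_def by blast
  interpret l: Vector_Spaces.linear sc "(*)" l by (rule l(1))
  obtain x k where x: "l x \<noteq> 0" "k \<ge> 1" "\<And>n. n \<ge> k \<Longrightarrow> fixed_by (parahoric n 0) x"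
    using generic_fixed_vector[OF psi l(1,3,2)] by blast
  have step: "\<exists>c. c \<noteq> 0 \<and> avg (Z_up n) x = sc c (\<pi> (swap (int n)) (avg (Z_up (n - 1)) x))" if n: "n \<ge> k" for n
  proof -
    have n1: "n \<ge> 1" using n x(2) by simp
    obtain a b :: nat where ab: "a \<noteq> 0" "b \<noteq> 0"
      "sc (of_nat a) (avg (Z_up n) x) + sc (of_nat b) (\<pi> (swap (int n)) (avg (Z_up (n - 1)) x))
        \<in> fixed_vectors \<pi> (parahoric n (int n))"
      using parahoric_sum_fixed[OF n1 x(3)[OF n]] by blast
    let ?y = "\<pi> (swap (int n)) (avg (Z_up (n - 1)) x)"
    have "fixed_vectors \<pi> (K n) = {0}" using none by blast
    then have "fixed_vectors \<pi> (parahoric n (int n)) = {0}" by (simp add: K_eq[OF n1])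
    then have "sc (of_nat a) (avg (Z_up n) x) + sc (of_nat b) ?y = 0" using ab(3) by simp
    then have "sc (of_nat a) (avg (Z_up n) x) = - sc (of_nat b) ?y" by (simp add: eq_neg_iff_add_eq_0)
    then have "sc (1 / of_nat a) (sc (of_nat a) (avg (Z_up n) x)) = sc (1 / of_nat a) (- sc (of_nat b) ?y)"
      by (simp only:)
    moreover have "sc (1 / of_nat a) (sc (of_nat a) (avg (Z_up n) x)) = avg (Z_up n) x" using ab(1) by simp
    moreover have "sc (1 / of_nat a) (- sc (of_nat b) ?y) = sc (- (of_nat b / of_nat a)) ?y" by simp
    ultimately have "avg (Z_up n) x = sc (- (of_nat b / of_nat a)) ?y" by (simp only:)
    moreover have "- (of_nat b / of_nat a) \<noteq> (0 :: complex)" using ab by simp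
    ultimately show ?thesis by blast
  qed
  obtain c where c: "c \<noteq> 0" "avg (Z_up k) x = sc c (\<pi> (swap (int k)) (avg (Z_up (k - 1)) x))"
    using step[of k] by auto
  obtain d where d: "d \<noteq> 0" "avg (Z_up (Suc k)) x = sc d (\<pi> (swap (int k + 1)) (avg (Z_up k) x))"
    using step[of "Suc k"] by (auto simp: add.commute)
  \<comment> \<open>The reflections occur in the order opposite to \<open>swap_product\<close>,
    which gives the inverse translation.\<close>
  have swaps: "swap (int k + 1) ** swap (int k) = adj delta"
    using swap_product[of "int k + 1"] by (simp add: adj_swap adj_mult flip: swap_product[of "int k + 1"])
  have e: "avg (Z_up (Suc k)) x = sc (d * c) (\<pi> (adj delta) (avg (Z_up (k - 1)) x))"
    unfolding d(2) c(2) using rep_mult[OF swap_mem swap_mem, of "int k + 1" "int k"]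
    by (simp add: rep_scale swap_mem swaps)
  have adj_delta_u: "adj delta ** u p q = u (inverse unif * p) ((inverse unif)\<^sup>2 * q) ** adj delta" for p q
    by (simp add: delta_eq u_eq adj_mat3 mat3_mult conj_simps power2_eq_square)
  have inv_iso: "isotropic (inverse unif * p) ((inverse unif)\<^sup>2 * q)" if "isotropic p q" for p q
  proof -
    have "(inverse unif)\<^sup>2 * q + \<sigma> ((inverse unif)\<^sup>2 * q) + inverse unif * p * \<sigma> (inverse unif * p)
        = (inverse unif)\<^sup>2 * (q + \<sigma> q + p * \<sigma> p)"
      by (simp add: conj_simps conj_power power2_eq_square algebra_simps)
    then show ?thesis using that by (simp add: isotropic_def)
  qed
  have l_delta: "l (\<pi> (adj delta) (\<pi> (u p q) w)) = \<psi> (inverse unif * p) * l (\<pi> (adj delta) w)"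
    if "isotropic p q" for p q w
  proof -
    have "\<pi> (adj delta) (\<pi> (u p q) w) = \<pi> (u (inverse unif * p) ((inverse unif)\<^sup>2 * q)) (\<pi> (adj delta) w)"
      using rep_mult[OF G_adj[OF delta_mem], of "u p q" w] rep_mult[OF _ G_adj[OF delta_mem]] that inv_iso
      by (simp add: adj_delta_u u_mem)
    then show ?thesis using l(3)[OF inv_iso[OF that]] by simp
  qed
  have "l (\<pi> (adj delta) x) = 0"
  proof -
    have "inverse unif \<notin> pE 0" using emb_uniformizer by (simp add: pE_iff valE_inverse)
    then obtain p where p: "p \<in> pE 0" "\<psi> (inverse unif * p) \<noteq> 1" using psi_detects[OF psi] by (metis neg_0_equal_iff_equal)
    have "- (p * \<sigma> p) / 2 \<in> pE 0" using p by (intro pE_half pE_uminus pE_mult[of p 0 "\<sigma> p" 0]) auto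
    moreover have "u_half p \<in> carrier G" by (rule u_half_mem)
    ultimately have "u_half p \<in> parahoric k 0"
      using p by (simp add: parahoric_def) (simp add: u_half_def u_eq)
    then have "\<pi> (u_half p) x = x" using x(3)[of k] by (simp add: fixed_by_def)
    then show ?thesis using l_delta[OF isotropic_half, of p x] p(2) by (simp add: u_half_def)
  qed
  \<comment> \<open>Elements of \<open>Z_up\<close> have first coordinate \<open>0\<close>, where
    \<open>\<psi>\<close> is \<open>1\<close>, so these averages do not affect the
    functionals.\<close>
  moreover have "l (\<pi> (adj delta) (avg (Z_up (k - 1)) x)) = l (\<pi> (adj delta) x)"
  proof -
    have "Vector_Spaces.linear sc (*) (\<lambda>w. l (\<pi> (adj delta) w))"
      using l(1) unfolding Vector_Spaces.linear_iff by (simp add: rep_add rep_scale G_adj delta_mem l.add l.scale)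
    then show ?thesis
    proof (rule avg_functional[OF Z_up_compact])
      fix g assume "g \<in> Z_up (k - 1)"
      then obtain q where "g = u 0 q" "isotropic 0 q" by (auto simp: Z_up_iff)
      then show "l (\<pi> (adj delta) (\<pi> g x)) = l (\<pi> (adj delta) x)"
        using l_delta psi_zero[OF psi] by simp
    qed
  qed
  moreover have "l (avg (Z_up (Suc k)) x) = l x"
  proof (rule avg_functional[OF Z_up_compact l(1)])
    fix g assume "g \<in> Z_up (Suc k)"
    then obtain q where "g = u 0 q" "isotropic 0 q" by (auto simp: Z_up_iff)
    then show "l (\<pi> g x) = l x" using l(3) psi_zero[OF psi] by simp
  qed
  ultimately have "l x = 0" unfolding e by (simp add: l.scale)
  then show False using x(1) by simp
qed

text \<open>The contrapositive of \<open>fixed_vector_vanishes\<close> for the full group: its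
  condition on central elements can fail only if \<open>n \<ge> 2\<close> and some non-zero vector
  is fixed by all of them.\<close>

lemma supercuspidal_level:
  assumes sup: "supercuspidal sc \<pi>" and n: "n \<ge> 1" and x: "fixed_by (parahoric n (int n - 1)) x" "x \<noteq> 0"
  shows "n \<ge> 2 \<and> (\<exists>z. z \<noteq> 0 \<and> (\<forall>m\<in>E1 (n - 1). \<pi> (mat m) z = z))"
proof -
  interpret level_structure v \<omega> \<iota> \<sigma> sc \<pi> n "carrier G"
    using n by unfold_locales simp_all
  have "L = parahoric n (int n - 1)" by (auto simp: L_def parahoric_def)
  then have xL: "fixed_by L x" using x(1) by simp
  have UG: "U \<inter> carrier G = U" by (auto simp: U_def u_mem isotropic_def)
  have span: "x \<in> V.span {\<pi> g w - w | g w. g \<in> U \<inter> carrier G}"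
    using supercuspidal_span[OF sup] by (simp add: UG)
  show ?thesis
    using fixed_vector_vanishes[OF xL span] x(2) by blast
qed

end

theorem corollary5p5:
  fixes v :: "'f::field_char_0 \<Rightarrow> int"
    and \<omega> :: 'f
    and \<iota> :: "'f \<Rightarrow> 'e::field_char_0"
    and \<sigma> :: "'e \<Rightarrow> 'e"
    and \<psi> :: "'e \<Rightarrow> complex"
    and sc :: "complex \<Rightarrow> 'v::ab_group_add \<Rightarrow> 'v"
    and \<pi> :: "'e ^ 3 ^ 3 \<Rightarrow> 'v \<Rightarrow> 'v"
  assumes "unramified_quadratic v \<omega> \<iota> \<sigma>"
    and "unramified_quadratic.character_of_conductor_oE v \<omega> \<iota> \<psi>"
    and "unramified_quadratic.irreducible_admissible v \<omega> \<iota> \<sigma> sc \<pi>"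
    and "unramified_quadratic.supercuspidal \<sigma> sc \<pi>"
  shows "(unramified_quadratic.generic \<sigma> \<psi> sc \<pi> \<longrightarrow>
            2 \<le> unramified_quadratic.conductor v \<omega> \<iota> \<sigma> \<pi> \<and>
            unramified_quadratic.central_conductor v \<omega> \<iota> \<sigma> sc \<pi>
              < unramified_quadratic.conductor v \<omega> \<iota> \<sigma> \<pi>) \<and>
         (\<not> unramified_quadratic.generic \<sigma> \<psi> sc \<pi> \<longrightarrow>
            (\<forall>n. unramified_quadratic.fixed_vectors \<pi> (unramified_quadratic.K v \<omega> \<iota> \<sigma> n) = {0}))"
proof -
  interpret unramified_quadratic v \<omega> \<iota> \<sigma> by (rule assms(1))
  note psi = assms(2) and irr = assms(3) and sup = assms(4)
  interpret smooth_representation v \<omega> \<iota> \<sigma> sc \<pi>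
    using irr by unfold_locales (simp_all add: irreducible_admissible_def admissible_def)
  have "2 \<le> conductor \<pi> \<and> central_conductor sc \<pi> < conductor \<pi>" if gen: "generic \<psi> sc \<pi>"
  proof -
    define N where "N = conductor \<pi>"
    have "fixed_vectors \<pi> (K N) \<noteq> {0}"
      unfolding N_def conductor_def using generic_has_fixed_vectors[OF psi gen] by (rule LeastI_ex)
    moreover have "0 \<in> fixed_vectors \<pi> (K N)"
      by (auto simp: fixed_vectors_def K_def rep_zero)
    ultimately obtain x where x: "x \<in> fixed_vectors \<pi> (K N)" "x \<noteq> 0" by blast
    have N1: "N \<ge> 1"
    proof (rule ccontr)
      assume "\<not> N \<ge> 1"
      then have N0: "N = 0" by simp
      \<comment> \<open>A \<open>K 0\<close>-fixed vector is treated at level \<open>1\<close>,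
        where the conclusion \<open>2 \<le> 1\<close> is absurd.\<close>
      have "fixed_by (parahoric 1 0) x"
        using x(1) parahoric_1_subset_K_0 unfolding fixed_vectors_def fixed_by_def N0 by blast
      then have "fixed_by (parahoric 1 (int 1 - 1)) x" by simp
      from supercuspidal_level[OF sup _ this x(2)] show False by simp
    qed
    have "fixed_by (parahoric N (int N - 1)) x"
      using x(1) K_eq[OF N1] parahoric_mono[of "int N - 1" "int N" N]
      by (auto simp: fixed_vectors_def fixed_by_def)
    from supercuspidal_level[OF sup N1 this x(2)] obtain z
      where N2: "N \<ge> 2" and z: "z \<noteq> 0" "\<forall>m\<in>E1 (N - 1). \<pi> (mat m) z = z" by blast
    \<comment> \<open>The fixed space of a set of central elements is stable under \<open>G\<close>,
      so irreducibility makes it everything once it contains \<open>z\<close>.\<close>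
    define W where "W = {w. \<forall>m\<in>E1 (N - 1). \<pi> (mat m) w = w}"
    have E1: "m * \<sigma> m = 1" if "m \<in> E1 (N - 1)" for m using that by (simp add: E1_def)
    have "W = UNIV"
    proof -
      have matG: "(mat m :: 'e ^ 3 ^ 3) \<in> carrier G" if "m \<in> E1 (N - 1)" for m
        by (rule mat_mem[OF E1[OF that]])
      have "V.subspace W"
        unfolding W_def by (rule V.subspaceI) (simp_all add: rep_zero rep_add rep_scale matG)
      moreover have "\<pi> g ` W \<subseteq> W" if g: "g \<in> carrier G" for g
      proof
        fix y assume "y \<in> \<pi> g ` W"
        then obtain w where w: "y = \<pi> g w" "w \<in> W" by blast
        have "\<pi> (mat m) y = y" if m: "m \<in> E1 (N - 1)" for m
        proof -
          have "\<pi> (mat m) y = \<pi> g (\<pi> (mat m) w)"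
            using rep_mult[OF matG[OF m] g, of w] rep_mult[OF g matG[OF m], of w]
            by (simp add: w mat_central)
          then show ?thesis using w m by (simp add: W_def)
        qed
        then show "y \<in> W" by (simp add: W_def)
      qed
      moreover have "W \<noteq> {0}" using z by (auto simp: W_def)
      ultimately show ?thesis using irr unfolding irreducible_admissible_def by blast
    qed
    then have triv: "\<pi> (mat m) w = w" if "m \<in> E1 (N - 1)" for m w using that by (auto simp: W_def)
    have "central_char sc \<pi> m = 1" if m: "m \<in> E1 (N - 1)" for m
      unfolding central_char_def
    proof (rule the_equality)
      show "\<forall>x. \<pi> (mat m) x = sc 1 x" using triv[OF m] by simp
      \<comment> \<open>Uniqueness in the definite description requires a non-zero vector;
        \<open>z\<close> serves.\<close>
      fix c assume "\<forall>x. \<pi> (mat m) x = sc c x"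
      then have "sc 1 z = sc c z" using triv[OF m] by simp
      then show "c = 1" using z(1) by (metis V.scale_right_imp_eq)
    qed
    then have "central_conductor sc \<pi> \<le> N - 1"
      unfolding central_conductor_def by (intro Least_le) blast
    then show ?thesis using N2 by (simp add: N_def)
  qed
  moreover have "\<forall>n. fixed_vectors \<pi> (K n) = {0}" if "\<not> generic \<psi> sc \<pi>"
    using nongeneric_no_fixed_vectors[OF psi sup that] by blast
  ultimately show ?thesis by blast
qed

end
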